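(* Let $\mathcal{F}$ be a finite degenerate family of graphs with $\beta'(\mathcal{F})\geq 2$ and $\operatorname{ex}(n,\mathcal{F})=O(n)$. Let $H=K_{\beta'(\mathcal{F})-1,\,n+1-\beta'(\mathcal{F})}$ and $H_1=T\vee I_{n+1-\beta'(\mathcal{F})}$, where $T\in \mathrm{Ex}(\beta'(\mathcal{F})-1,\mathcal{H}(\mathcal{F}))$. For sufficiently large $n$ and some $r\in[\frac12,\frac34)$, if $$e(H)+\left\lfloor \frac{n+1-\beta'(\mathcal{F})}{2}\right\rfloor\leq \operatorname{ex}_{H}(n,\mathcal{F})\leq e(H)+rn+O(1)$$ and $$\operatorname{ex}_{H}(n,\mathcal{F})-\operatorname{ex}_{H_1}(n,\mathcal{F})\leq \frac{1}{8(\beta'(\mathcal{F})-1)}\,n,$$ then $\mathrm{Ex_{sp}}(n,\mathcal{F})\subseteq \mathcal{G}(\mathcal{F})$.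
   Context: All graphs are simple. A graph is $\mathcal{F}$-free if it contains no member of $\mathcal{F}$ as a subgraph. $\operatorname{ex}(n,\mathcal{F})$ is the maximum number of edges of an $\mathcal{F}$-free graph on $n$ vertices and $\mathrm{Ex}(n,\mathcal{F})$ the set of extremal graphs. For a graph $G_0$, $\operatorname{ex}_{G_0}(n,\mathcal{F})$ is the maximum number of edges of an $\mathcal{F}$-free $n$-vertex graph containing $G_0$ as a subgraph, and $\mathrm{Ex}_{G_0}(n,\mathcal{F})$ the set of such graphs attaining it. $\mathrm{Ex_{sp}}(n,\mathcal{F})$ is the set of $\mathcal{F}$-free $n$-vertex graphs with maximum adjacency spectral radius among all $\mathcal{F}$-free $n$-vertex graphs. A covering of $G$ is a vertex set meeting all edges; $\beta(G)$ is the minimum size of a covering, $\beta'(G)$ the minimum size of an independent covering ($+\infty$ if $G$ is not bipartite); $\beta(\mathcal{F})$, $\beta'(\mathcal{F})$ are the minima over $F\in\mathcal{F}$. $\mathcal{F}$ is finite degenerate if it contains a bipartite graph and the orders of its members are bounded by a fixed constant. $\mathcal{M}(\mathcal{F})=\{F[S]: F\in\mathcal{F},\ S\text{ a covering of }F,\ |S|<\beta'(\mathcal{F})\}$; $\mathcal{H}(\mathcal{F})=\{K_{\beta'(\mathcal{F})}\}$ if $\beta'(\mathcal{F})=\beta(\mathcal{F})$ and $\mathcal{H}(\mathcal{F})=\mathcal{M}(\mathcal{F})$ otherwise. $\vee$ is the join, $I_m$ the edgeless graph on $m$ vertices. $\mathcal{G}_0(\mathcal{F})=\{T'\vee I_{n+1-\beta'(\mathcal{F})}: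 T'\in\mathrm{Ex}(\beta'(\mathcal{F})-1,\mathcal{H}(\mathcal{F}))\}$ and $\mathcal{G}(\mathcal{F})=\bigcup_{H'\in\mathcal{G}_0(\mathcal{F})}\mathrm{Ex}_{H'}(n,\mathcal{F})$. *)

theory Defs
  imports "Jordan_Normal_Form.Spectral_Radius" "HOL-Library.Landau_Symbols"
    "HOL-Library.Extended_Nat"
begin

datatype 'a graph = Graph (verts: "'a set") (edges: "'a set set")

definition simple_graph :: "'a graph \<Rightarrow> bool" where
  "simple_graph G \<longleftrightarrow> finite (verts G) \<and> edges G \<subseteq> {e. e \<subseteq> verts G \<and> card e = 2}"

text \<open>Subgraph containment is up to isomorphism and does not require an induced copy;
  the two graphs may have different vertex types.\<close>

definition contains :: "'a graph \<Rightarrow> 'b graph \<Rightarrow> bool" where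
  "contains G H \<longleftrightarrow> (\<exists>f. inj_on f (verts H) \<and> f ` verts H \<subseteq> verts G \<and>
     (\<forall>e\<in>edges H. f ` e \<in> edges G))"

definition free_of :: "'b graph set \<Rightarrow> 'a graph \<Rightarrow> bool" where
  "free_of \<F> G \<longleftrightarrow> (\<forall>F\<in>\<F>. \<not> contains G F)"

definition induced :: "'a graph \<Rightarrow> 'a set \<Rightarrow> 'a graph" where
  "induced G S = Graph S {e \<in> edges G. e \<subseteq> S}"

definition bipartite :: "'a graph \<Rightarrow> bool" where
  "bipartite G \<longleftrightarrow> (\<exists>X Y. X \<union> Y = verts G \<and> X \<inter> Y = {} \<and>
     (\<forall>e\<in>edges G. \<exists>x\<in>X. \<exists>y\<in>Y. e = {x, y}))"

definition edgeless_graph :: "nat \<Rightarrow> nat graph" where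
  "edgeless_graph m = Graph {..<m} {}"

definition complete_graph :: "nat \<Rightarrow> nat graph" where
  "complete_graph m = Graph {..<m} {e. e \<subseteq> {..<m} \<and> card e = 2}"

definition complete_bipartite_graph :: "nat \<Rightarrow> nat \<Rightarrow> (nat + nat) graph" where
  "complete_bipartite_graph s t =
     Graph ({..<s} <+> {..<t}) {{Inl i, Inr j} | i j. i < s \<and> j < t}"

definition graph_join :: "'a graph \<Rightarrow> 'b graph \<Rightarrow> ('a + 'b) graph" where
  "graph_join G H = Graph (verts G <+> verts H)
     ((`) Inl ` edges G \<union> (`) Inr ` edges H \<union> {{Inl u, Inr v} | u v. u \<in> verts G \<and> v \<in> verts H})"

text \<open>Graphs on \<open>n\<close> vertices are all simple graphs whose vertex set is some \<open>n\<close>-element set of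
  natural numbers, so that every isomorphism type of finite graph is represented.\<close>

definition free_graphs :: "nat \<Rightarrow> nat graph set \<Rightarrow> nat graph set" where
  "free_graphs n \<F> = {G. simple_graph G \<and> card (verts G) = n \<and> free_of \<F> G}"

definition ex_num :: "nat \<Rightarrow> nat graph set \<Rightarrow> nat" where
  "ex_num n \<F> = Max ((\<lambda>G. card (edges G)) ` free_graphs n \<F>)"

definition Ex_set :: "nat \<Rightarrow> nat graph set \<Rightarrow> nat graph set" where
  "Ex_set n \<F> = {G \<in> free_graphs n \<F>. card (edges G) = ex_num n \<F>}"

definition ex_containing :: "'b graph \<Rightarrow> nat \<Rightarrow> nat graph set \<Rightarrow> nat" where
  "ex_containing G\<^sub>0 n \<F> = Max ((\<lambda>G. card (edges G)) ` {G \<in> free_graphs n \<F>. contains G G\<^sub>0})"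

definition Ex_containing :: "'b graph \<Rightarrow> nat \<Rightarrow> nat graph set \<Rightarrow> nat graph set" where
  "Ex_containing G\<^sub>0 n \<F> =
     {G \<in> free_graphs n \<F>. contains G G\<^sub>0 \<and> card (edges G) = ex_containing G\<^sub>0 n \<F>}"

text \<open>Rows and columns follow the increasing enumeration of the vertex set; the spectrum does not
  depend on the enumeration. Entries are complex because \<^const>\<open>spectral_radius\<close> expects that.\<close>

definition adjacency_matrix :: "nat graph \<Rightarrow> complex mat" where
  "adjacency_matrix G = (let vs = sorted_list_of_set (verts G) in
     mat (card (verts G)) (card (verts G))
       (\<lambda>(i, j). if {vs ! i, vs ! j} \<in> edges G then 1 else 0))"

definition Ex_sp :: "nat \<Rightarrow> nat graph set \<Rightarrow> nat graph set" where
  "Ex_sp n \<F> = {G \<in> free_graphs n \<F>. \<forall>G'\<in>free_graphs n \<F>.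
     spectral_radius (adjacency_matrix G') \<le> spectral_radius (adjacency_matrix G)}"

definition covering :: "'a graph \<Rightarrow> 'a set \<Rightarrow> bool" where
  "covering G S \<longleftrightarrow> S \<subseteq> verts G \<and> (\<forall>e\<in>edges G. e \<inter> S \<noteq> {})"

definition independent_covering :: "'a graph \<Rightarrow> 'a set \<Rightarrow> bool" where
  "independent_covering G S \<longleftrightarrow> covering G S \<and> (\<forall>e\<in>edges G. \<not> e \<subseteq> S)"

text \<open>The infimum of the empty set in \<^typ>\<open>enat\<close> is \<open>\<infinity>\<close>, the value of \<open>\<beta>'\<close> at a
  non-bipartite graph.\<close>

definition beta :: "'a graph \<Rightarrow> enat" where
  "beta G = (INF S\<in>{S. covering G S}. enat (card S))"

definition beta' :: "'a graph \<Rightarrow> enat" where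
  "beta' G = (INF S\<in>{S. independent_covering G S}. enat (card S))"

definition beta_fam :: "'a graph set \<Rightarrow> enat" where
  "beta_fam \<F> = (INF F\<in>\<F>. beta F)"

definition beta'_fam :: "'a graph set \<Rightarrow> enat" where
  "beta'_fam \<F> = (INF F\<in>\<F>. beta' F)"

text \<open>\<open>\<beta>'(\<F>)\<close> as a natural number; it is finite as soon as \<open>\<F>\<close> has a bipartite member.\<close>

definition beta'_nat :: "'a graph set \<Rightarrow> nat" where
  "beta'_nat \<F> = the_enat (beta'_fam \<F>)"

definition finite_degenerate :: "'a graph set \<Rightarrow> bool" where
  "finite_degenerate \<F> \<longleftrightarrow> (\<forall>F\<in>\<F>. simple_graph F) \<and> (\<exists>F\<in>\<F>. bipartite F) \<and>
     (\<exists>k. \<forall>F\<in>\<F>. card (verts F) \<le> k)"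

definition M_fam :: "'a graph set \<Rightarrow> 'a graph set" where
  "M_fam \<F> = {induced F S | F S. F \<in> \<F> \<and> covering F S \<and> enat (card S) < beta'_fam \<F>}"

definition H_fam :: "nat graph set \<Rightarrow> nat graph set" where
  "H_fam \<F> = (if beta'_fam \<F> = beta_fam \<F> then {complete_graph (beta'_nat \<F>)} else M_fam \<F>)"

definition G0_fam :: "nat \<Rightarrow> nat graph set \<Rightarrow> (nat + nat) graph set" where
  "G0_fam n \<F> = {graph_join T' (edgeless_graph (n + 1 - beta'_nat \<F>)) | T'.
     T' \<in> Ex_set (beta'_nat \<F> - 1) (H_fam \<F>)}"

definition G_fam :: "nat \<Rightarrow> nat graph set \<Rightarrow> nat graph set" where
  "G_fam n \<F> = (\<Union>H'\<in>G0_fam n \<F>. Ex_containing H' n \<F>)"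

end

theory Submission
  imports Defs "HOL-Analysis.Function_Topology" "HOL-Analysis.Convex"
begin

text \<open>
  Write \<open>k = \<beta>'(\<F>) - 1\<close> and let \<open>G\<close> be a spectral extremal graph with spectral radius \<open>\<lambda>\<close> and Perron
  vector \<open>x\<close>, normalised to have largest entry 1. Then \<open>\<lambda>\<^sup>2 \<ge> k (n - k)\<close>, all subgraphs of \<open>G\<close> are
  sparse, and \<open>k + 1\<close> vertices never have many common neighbours. Counting walks of length two shows
  that only boundedly many entries of \<open>x\<close> exceed a given constant, and then that exactly \<open>k\<close> entries
  are close to 1; these belong to a set \<open>L\<close> of vertices of degree close to \<open>n\<close>. Replacing the
  neighbourhood of another vertex by \<open>L\<close> keeps the graph \<open>\<F>\<close>-free, so extremality forces \<open>L\<close> to be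
  completely joined to the rest.

  On the rest, which has bounded degree, \<open>x\<close> is constant up to a factor \<open>1 + O(1 / \<lambda>)\<close>, with products
  of two entries of order \<open>k / n\<close>, while products inside \<open>L\<close> are close to 1. Hence one additional edge
  inside \<open>L\<close> outweighs the loss of \<open>n / (8 k)\<close> edges elsewhere, so that \<open>G[L]\<close> has as many edges as
  possible. A competitor with the same core and more edges would win as well, provided it can be placed
  so that it misses only boundedly many edges of \<open>G\<close>. This is possible because of \<open>r < 3/4\<close>: a
  connected pattern that occurs sufficiently often in the rest may be repeated arbitrarily often, so
  patterns with at least \<open>3/4\<close> edges per vertex are rare and, up to boundedly many edges, the rest is
  either a matching or, again by extremality, an almost perfect packing of paths on three vertices.
\<close>

section \<open>Rayleigh quotients and Perron vectors\<close>

text \<open>The obstacle lies in comparing the rests. Edge weights there agree only up to the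
  relative error \<open>\<epsilon>\<close>, which is at most of order 1 / sqrt n, so over linearly
  many edges the error swamps the gain of a single edge. Edges shared with \<open>G\<close> cancel
  exactly, and this is why a competitor has to be laid over \<open>G\<close> with only boundedly
  many edges of \<open>G\<close> missing. The core comparison needs no such care, its gain being a
  constant.

  The value 3/4 is the number of edges per vertex of the path and the star on four vertices; every
  connected graph on at least four vertices contains one of them, and the triangle is denser still.
  The path on three vertices has only 2/3 and survives. Repeating a pattern is harmless because a
  forbidden graph has at most \<open>t\<close> vertices and so meets at most \<open>t\<close>
  copies.

  The graph \<open>G\<close> is not known to be connected, so \<open>x\<close> is only nonnegative.
  Strictness therefore comes from comparing eigenvalue equations at a vertex, not from positive
  entries.\<close>

definition qform :: "('v \<Rightarrow> 'v \<Rightarrow> real) \<Rightarrow> 'v set \<Rightarrow> ('v \<Rightarrow> real) \<Rightarrow> real" where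
  "qform a V x = (\<Sum>u\<in>V. \<Sum>v\<in>V. a u v * x u * x v)"

lemma qform_perturb:
  assumes "finite V" "v \<in> V" and sym: "\<And>u w. a u w = a w u"
  shows "qform a V (\<lambda>u. x u + (if u = v then h else 0)) =
    qform a V x + 2 * h * (\<Sum>u\<in>V. a v u * x u) + h\<^sup>2 * a v v"
proof -
  have "qform a V (\<lambda>u. x u + (if u = v then h else 0)) =
     (\<Sum>u\<in>V. \<Sum>w\<in>V. a u w * x u * x w + a u w * x u * (if w = v then h else 0)
        + a u w * (if u = v then h else 0) * x w
        + a u w * (if u = v then h else 0) * (if w = v then h else 0))"
    unfolding qform_def by (intro sum.cong refl) (simp add: algebra_simps)
  also have "\<dots> = qform a V x + (\<Sum>u\<in>V. \<Sum>w\<in>V. if w = v then a u w * x u * h else 0)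
      + (\<Sum>u\<in>V. if u = v then (\<Sum>w\<in>V. a u w * h * x w) else 0)
      + (\<Sum>u\<in>V. if u = v then (\<Sum>w\<in>V. if w = v then a u w * h * h else 0) else 0)"
    unfolding qform_def sum.distrib
    by (intro arg_cong2[where f = "(+)"] refl sum.cong) (auto intro!: sum.cong)
  also have "\<dots> = qform a V x + (\<Sum>u\<in>V. a u v * x u * h) + (\<Sum>w\<in>V. a v w * h * x w) + a v v * h * h"
    using assms(1,2) by (simp add: sum.delta)
  also have "(\<Sum>u\<in>V. a u v * x u * h) = (\<Sum>w\<in>V. a v w * h * x w)"
    by (intro sum.cong refl) (simp add: sym[of v])
  also have "(\<Sum>w\<in>V. a v w * h * x w) = h * (\<Sum>u\<in>V. a v u * x u)"
    by (simp add: sum_distrib_left algebra_simps)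
  finally show ?thesis by (simp add: power2_eq_square algebra_simps)
qed

lemma sum_squares_perturb:
  fixes x :: "'v \<Rightarrow> real"
  assumes "finite V" "v \<in> V"
  shows "(\<Sum>u\<in>V. (x u + (if u = v then h else 0))\<^sup>2) = (\<Sum>u\<in>V. (x u)\<^sup>2) + 2 * h * x v + h\<^sup>2"
proof -
  have "(\<Sum>u\<in>V. (x u + (if u = v then h else 0))\<^sup>2) =
     (\<Sum>u\<in>V. (x u)\<^sup>2 + (if u = v then 2 * h * x u + h\<^sup>2 else 0))"
    by (intro sum.cong refl) (simp add: power2_eq_square algebra_simps)
  then show ?thesis using assms by (simp add: sum.distrib)
qed

text \<open>Changing \<open>x\<close> by \<open>h\<close> in the coordinate \<open>v\<close> alone
  changes the defect by \<open>2 * h * D + h\<^sup>2 * (a v v - l)\<close>, which is nonpositive for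
  every \<open>h\<close>, so the linear coefficient \<open>D\<close> vanishes. Since
  \<open>x\<close> merely has to attain the bound, the lemma also applies to a vector taken from
  another graph, as in \<open>rewire_weight\<close>.\<close>

lemma qform_maximizer_eigenvector:
  assumes "finite V" "v \<in> V" and sym: "\<And>u w. a u w = a w u"
    and ub: "\<And>y. qform a V y \<le> l * (\<Sum>u\<in>V. (y u)\<^sup>2)"
    and eq: "qform a V x \<ge> l * (\<Sum>u\<in>V. (x u)\<^sup>2)"
  shows "(\<Sum>u\<in>V. a v u * x u) = l * x v"
proof (rule ccontr)
  define D where "D = (\<Sum>u\<in>V. a v u * x u) - l * x v"
  assume "\<not> ?thesis"
  then have D: "D \<noteq> 0" by (simp add: D_def)
  define K where "K = \<bar>a v v - l\<bar> + 1"
  have K: "K > 0" "a v v - l > - K" by (auto simp: K_def)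
  have 1: "2 * h * D + h\<^sup>2 * (a v v - l) \<le> 0" for h
    using ub[of "\<lambda>u. x u + (if u = v then h else 0)"] eq
    unfolding qform_perturb[OF assms(1,2) sym] sum_squares_perturb[OF assms(1,2)]
    by (simp add: D_def algebra_simps)
  \<comment> \<open>The step size \<open>D / K\<close> is short enough for the linear term to win,
    because \<open>K\<close> exceeds \<open>\<bar>a v v - l\<bar>\<close>.\<close>
  have "2 * (D / K) * D + (D / K)\<^sup>2 * (a v v - l) \<le> 0" by (rule 1)
  then have "(D / K)\<^sup>2 * (2 * K + (a v v - l)) \<le> 0"
    using K by (simp add: power2_eq_square field_simps)
  moreover have "(D / K)\<^sup>2 > 0" using D K by simp
  ultimately show False using K by (simp add: mult_le_0_iff)
qed

lemma qform_scale: "qform a V (\<lambda>v. r * x v) = r\<^sup>2 * qform a V x"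
  by (simp add: qform_def sum_distrib_left power2_eq_square algebra_simps)

lemma qform_abs_ge:
  assumes "\<And>u w. a u w \<ge> 0"
  shows "qform a V x \<le> qform a V (\<lambda>v. \<bar>x v\<bar>)"
  unfolding qform_def
proof (intro sum_mono)
  fix u v
  have "x u * x v \<le> \<bar>x u\<bar> * \<bar>x v\<bar>" by (metis abs_ge_self abs_mult)
  then show "a u v * x u * x v \<le> a u v * \<bar>x u\<bar> * \<bar>x v\<bar>"
    using assms[of u v] by (simp add: mult.assoc mult_left_mono)
qed

text \<open>The unit sphere in the coordinates of \<open>V\<close> is compact; homogeneity carries
  the bound to all vectors, and nonnegativity of \<open>a\<close> allows passing to absolute
  values.\<close>

lemma qform_maximizer_exists:
  fixes a :: "'v \<Rightarrow> 'v \<Rightarrow> real"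
  assumes "finite V" "V \<noteq> {}" and nonneg: "\<And>u w. a u w \<ge> 0"
  obtains x where "\<And>v. x v \<ge> 0" "(\<Sum>v\<in>V. (x v)\<^sup>2) = 1"
    "\<And>y. qform a V y \<le> qform a V x * (\<Sum>v\<in>V. (y v)\<^sup>2)"
proof -
  \<comment> \<open>Vectors are functions on the whole type. Pinning the coordinates off
    \<open>V\<close> to 0 makes the full product compact by Tychonoff.\<close>
  define S :: "'v \<Rightarrow> real set" where "S v = (if v \<in> V then {-1..1} else {0})" for v
  have "compactin (product_topology (\<lambda>_. euclidean) UNIV) (PiE UNIV S)"
    unfolding compactin_PiE by (auto simp: S_def)
  then have cP: "compact (PiE UNIV S)" by (simp add: euclidean_product_topology)
  define K where "K = PiE UNIV S \<inter> {x. (\<Sum>v\<in>V. (x v)\<^sup>2) = 1}"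
  have "closed {x :: 'v \<Rightarrow> real. (\<Sum>v\<in>V. (x v)\<^sup>2) = 1}"
    by (intro closed_Collect_eq continuous_intros)
       (auto intro!: continuous_on_subset[OF continuous_on_product_coordinates])
  then have cK: "compact K" unfolding K_def using cP by (rule compact_Int_closed[rotated])
  obtain v0 where v0: "v0 \<in> V" using assms(2) by auto
  have "(\<lambda>v. if v = v0 then 1 else 0) \<in> K"
    using v0 assms(1) by (auto simp: K_def S_def if_distrib[of "\<lambda>z. z\<^sup>2"] cong: if_cong)
  then have neK: "K \<noteq> {}" by auto
  have "continuous_on K (qform a V)"
    unfolding qform_def
    by (intro continuous_intros) (auto intro!: continuous_on_subset[OF continuous_on_product_coordinates])
  from continuous_attains_sup[OF cK neK this]
  obtain x where x: "x \<in> K" "\<And>y. y \<in> K \<Longrightarrow> qform a V y \<le> qform a V x" by auto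
  have bound: "qform a V y \<le> qform a V x * (\<Sum>v\<in>V. (y v)\<^sup>2)" for y
  proof (cases "(\<Sum>v\<in>V. (y v)\<^sup>2) = 0")
    case True
    then have "\<forall>v\<in>V. y v = 0" using assms(1) by (simp add: sum_nonneg_eq_0_iff)
    then show ?thesis by (simp add: qform_def True)
  next
    case False
    define s where "s = (\<Sum>v\<in>V. (y v)\<^sup>2)"
    have s: "s > 0" using False sum_nonneg[of V "\<lambda>v. (y v)\<^sup>2"] by (simp add: s_def less_le)
    define z where "z v = (if v \<in> V then (1 / sqrt s) * y v else 0)" for v
    have zn: "(\<Sum>v\<in>V. (z v)\<^sup>2) = 1"
    proof -
      have "(\<Sum>v\<in>V. (z v)\<^sup>2) = (\<Sum>v\<in>V. (y v)\<^sup>2 / s)"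
        using s by (intro sum.cong refl) (simp add: z_def power_divide)
      also have "\<dots> = s / s" unfolding s_def by (rule sum_divide_distrib[symmetric])
      finally show ?thesis using s by simp
    qed
    have "(z v)\<^sup>2 \<le> 1" if "v \<in> V" for v
      using member_le_sum[OF that, of "\<lambda>v. (z v)\<^sup>2"] assms(1) zn by simp
    then have "z v \<in> {-1..1}" if "v \<in> V" for v
      using that by (simp add: abs_square_le_1 abs_le_iff)
    then have "z \<in> K" using zn by (auto simp: K_def S_def z_def)
    then have "qform a V z \<le> qform a V x" by (rule x(2))
    moreover have "qform a V z = qform a V (\<lambda>v. (1 / sqrt s) * y v)"
      unfolding qform_def z_def by (intro sum.cong refl) simp
    ultimately have "qform a V y / s \<le> qform a V x"
      using s by (simp only: qform_scale) (simp add: power_divide)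
    then show ?thesis using s by (simp add: field_simps s_def)
  qed
  have n1: "(\<Sum>v\<in>V. (\<bar>x v\<bar>)\<^sup>2) = 1" using x(1) by (simp add: K_def)
  show ?thesis
  proof (rule that[of "\<lambda>v. \<bar>x v\<bar>"])
    fix y
    have "qform a V x \<le> qform a V (\<lambda>v. \<bar>x v\<bar>)" by (rule qform_abs_ge) (rule nonneg)
    then have "qform a V x * (\<Sum>v\<in>V. (y v)\<^sup>2) \<le> qform a V (\<lambda>v. \<bar>x v\<bar>) * (\<Sum>v\<in>V. (y v)\<^sup>2)"
      by (intro mult_right_mono sum_nonneg) auto
    then show "qform a V y \<le> qform a V (\<lambda>v. \<bar>x v\<bar>) * (\<Sum>v\<in>V. (y v)\<^sup>2)"
      using bound[of y] by simp
  qed (use n1 in auto)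
qed

section \<open>Neighbourhoods, edge sums and the adjacency form\<close>

definition nbr :: "'a graph \<Rightarrow> 'a \<Rightarrow> 'a set" where
  "nbr G v = {u. {v, u} \<in> edges G}"

definition adj :: "'a graph \<Rightarrow> 'a \<Rightarrow> 'a \<Rightarrow> real" where
  "adj G u v = (if {u, v} \<in> edges G then 1 else 0)"

lemma simple_graphD:
  assumes "simple_graph G"
  shows "finite (verts G)" "e \<in> edges G \<Longrightarrow> e \<subseteq> verts G" "e \<in> edges G \<Longrightarrow> card e = 2"
  using assms by (auto simp: simple_graph_def)

lemma finite_edges: "simple_graph G \<Longrightarrow> finite (edges G)"
  by (rule finite_subset[of _ "Pow (verts G)"]) (auto simp: simple_graph_def)

lemma nbr_sym: "u \<in> nbr G v \<longleftrightarrow> v \<in> nbr G u"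
  by (simp add: nbr_def insert_commute)

lemma nbr_subset: "simple_graph G \<Longrightarrow> nbr G v \<subseteq> verts G"
  by (auto simp: nbr_def dest: simple_graphD(2))

lemma finite_nbr: "simple_graph G \<Longrightarrow> finite (nbr G v)"
  using nbr_subset simple_graphD(1) finite_subset by metis

lemma not_in_nbr_self: "simple_graph G \<Longrightarrow> v \<notin> nbr G v"
  by (auto simp: nbr_def dest: simple_graphD(3))

lemma edge_cases:
  assumes "simple_graph G" "e \<in> edges G"
  obtains u v where "e = {u, v}" "u \<noteq> v" "u \<in> verts G" "v \<in> verts G" "v \<in> nbr G u"
  using simple_graphD(2,3)[OF assms] assms(2) by (auto simp: card_2_iff nbr_def)

lemma sum_nbr_eq_sum_edges:
  fixes g :: "'a set \<Rightarrow> real"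
  assumes "simple_graph G"
  shows "(\<Sum>v\<in>verts G. \<Sum>u\<in>nbr G v. g {v, u}) = 2 * (\<Sum>e\<in>edges G. g e)"
proof -
  define P where "P = (SIGMA v:verts G. nbr G v)"
  have fP: "finite P" unfolding P_def
    by (intro finite_SigmaI finite_nbr[OF assms] simple_graphD(1)[OF assms])
  have "(\<Sum>v\<in>verts G. \<Sum>u\<in>nbr G v. g {v, u}) = (\<Sum>p\<in>P. g {fst p, snd p})"
    unfolding P_def using assms simple_graphD(1) finite_nbr
    by (subst sum.Sigma) (auto simp: case_prod_beta)
  also have "\<dots> = (\<Sum>e\<in>edges G. \<Sum>p\<in>{p \<in> P. {fst p, snd p} = e}. g {fst p, snd p})"
    by (rule sum.group[symmetric]) (use fP finite_edges[OF assms] in \<open>auto simp: P_def nbr_def\<close>)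
  also have "\<dots> = (\<Sum>e\<in>edges G. 2 * g e)"
  proof (rule sum.cong[OF refl])
    fix e assume e: "e \<in> edges G"
    then obtain a b where ab: "e = {a, b}" "a \<noteq> b" "a \<in> verts G" "b \<in> verts G" "b \<in> nbr G a"
      by (rule edge_cases[OF assms])
    then have "{p \<in> P. {fst p, snd p} = e} = {(a, b), (b, a)}"
      by (auto simp: P_def doubleton_eq_iff nbr_sym[of a G b])
    then show "(\<Sum>p\<in>{p \<in> P. {fst p, snd p} = e}. g {fst p, snd p}) = 2 * g e"
      using ab by (simp add: insert_commute)
  qed
  finally show ?thesis by (simp add: sum_distrib_left)
qed

lemma sum_degrees:
  assumes "simple_graph G"
  shows "(\<Sum>v\<in>verts G. real (card (nbr G v))) = 2 * real (card (edges G))"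
  using sum_nbr_eq_sum_edges[OF assms, of "\<lambda>_. 1"] by simp

lemma sum_adj:
  assumes "simple_graph G"
  shows "(\<Sum>u\<in>verts G. adj G v u * x u) = (\<Sum>u\<in>nbr G v. x u)"
proof -
  have "(\<Sum>u\<in>verts G. adj G v u * x u) = (\<Sum>u\<in>verts G. if u \<in> nbr G v then x u else 0)"
    by (intro sum.cong) (auto simp: adj_def nbr_def)
  also have "\<dots> = (\<Sum>u\<in>verts G \<inter> nbr G v. x u)"
    using simple_graphD(1)[OF assms] by (simp add: sum.inter_restrict)
  also have "verts G \<inter> nbr G v = nbr G v" using nbr_subset[OF assms] by blast
  finally show ?thesis .
qed

lemma adj_sym: "adj G u v = adj G v u"
  by (simp add: adj_def insert_commute)

lemma adj_nonneg: "adj G u v \<ge> 0"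
  by (simp add: adj_def)

lemma qform_adj_nbr:
  assumes "simple_graph G"
  shows "qform (adj G) (verts G) x = (\<Sum>v\<in>verts G. x v * (\<Sum>u\<in>nbr G v. x u))"
proof -
  have "qform (adj G) (verts G) x = (\<Sum>v\<in>verts G. x v * (\<Sum>u\<in>verts G. adj G v u * x u))"
    by (simp add: qform_def sum_distrib_left algebra_simps)
  then show ?thesis by (simp only: sum_adj[OF assms])
qed

lemma qform_adj:
  assumes "simple_graph G"
  shows "qform (adj G) (verts G) x = 2 * (\<Sum>e\<in>edges G. \<Prod>v\<in>e. x v)"
proof -
  have "qform (adj G) (verts G) x = (\<Sum>v\<in>verts G. \<Sum>u\<in>nbr G v. \<Prod>w\<in>{v, u}. x w)"
    unfolding qform_adj_nbr[OF assms] sum_distrib_left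
  proof (intro sum.cong refl)
    fix v u assume "u \<in> nbr G v"
    then have "v \<noteq> u" using not_in_nbr_self[OF assms] by metis
    then show "x v * x u = (\<Prod>w\<in>{v, u}. x w)" by simp
  qed
  then show ?thesis by (simp only: sum_nbr_eq_sum_edges[OF assms])
qed

section \<open>The spectral radius as a largest Rayleigh quotient\<close>

abbreviation rho :: "nat graph \<Rightarrow> real" where
  "rho G \<equiv> spectral_radius (adjacency_matrix G)"

lemma adjacency_matrix_entry:
  assumes "simple_graph G" "i < card (verts G)" "j < card (verts G)"
  shows "adjacency_matrix G $$ (i, j) =
    complex_of_real (adj G (sorted_list_of_set (verts G) ! i) (sorted_list_of_set (verts G) ! j))"
  using assms by (simp add: adjacency_matrix_def Let_def adj_def)

text \<open>The spectral radius of a nonnegative symmetric matrix is its largest Rayleigh quotient: a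
  maximizer is a real eigenvector, and the entrywise modulus of any complex eigenvector bounds the
  modulus of its eigenvalue by a Rayleigh quotient.\<close>

lemma rho_Rayleigh:
  assumes sg: "simple_graph G" and "verts G \<noteq> {}"
  obtains x where "\<And>v. x v \<ge> 0" "(\<Sum>v\<in>verts G. (x v)\<^sup>2) = 1"
    "qform (adj G) (verts G) x = rho G"
    "\<And>y. qform (adj G) (verts G) y \<le> rho G * (\<Sum>v\<in>verts G. (y v)\<^sup>2)"
proof -
  define V where "V = verts G"
  define n where "n = card V"
  define vs where "vs = sorted_list_of_set V"
  define A where "A = adjacency_matrix G"
  have fV: "finite V" "V \<noteq> {}" using assms simple_graphD(1) by (auto simp: V_def)
  have n: "n > 0" using fV by (simp add: n_def card_gt_0_iff)
  have len: "length vs = n" by (simp add: vs_def n_def)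
  have bij: "bij_betw ((!) vs) {..<n} V"
    by (rule bij_betw_nth) (use fV in \<open>auto simp: vs_def n_def\<close>)
  have A: "A \<in> carrier_mat n n" by (simp add: A_def adjacency_matrix_def Let_def n_def V_def)
  have entry: "A $$ (i, j) = complex_of_real (adj G (vs ! i) (vs ! j))" if "i < n" "j < n" for i j
    using adjacency_matrix_entry[OF sg] that by (simp add: A_def n_def V_def vs_def)
  have re: "(\<Sum>v\<in>V. f v) = (\<Sum>i<n. f (vs ! i))" for f :: "nat \<Rightarrow> real"
    using sum.reindex_bij_betw[OF bij, of f] by simp
  obtain x where x: "\<And>v. x v \<ge> 0" "(\<Sum>v\<in>V. (x v)\<^sup>2) = 1"
    "\<And>y. qform (adj G) V y \<le> qform (adj G) V x * (\<Sum>v\<in>V. (y v)\<^sup>2)"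
    by (rule qform_maximizer_exists[OF fV adj_nonneg]) (rule that)
  define l where "l = qform (adj G) V x"
  have l0: "l \<ge> 0" unfolding l_def qform_def by (intro sum_nonneg mult_nonneg_nonneg adj_nonneg x(1))
  have ev: "(\<Sum>u\<in>V. adj G v u * x u) = l * x v" if "v \<in> V" for v
    by (rule qform_maximizer_eigenvector[OF fV(1) that adj_sym])
       (simp_all add: l_def x(3) x(2))
  define w where "w = vec n (\<lambda>i. complex_of_real (x (vs ! i)))"
  have "eigenvector A w (complex_of_real l)"
    unfolding eigenvector_def
  proof (intro conjI)
    show "w \<in> carrier_vec (dim_row A)" using A by (simp add: w_def)
    show "w \<noteq> 0\<^sub>v (dim_row A)"
    proof
      assume "w = 0\<^sub>v (dim_row A)"
      then have "w $ i = 0" if "i < n" for i using A that by simp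
      then have "(\<Sum>v\<in>V. (x v)\<^sup>2) = 0" unfolding re by (intro sum.neutral) (auto simp: w_def)
      then show False using x by simp
    qed
    show "A *\<^sub>v w = complex_of_real l \<cdot>\<^sub>v w"
    proof (rule eq_vecI)
      show "dim_vec (A *\<^sub>v w) = dim_vec (complex_of_real l \<cdot>\<^sub>v w)" using A by (simp add: w_def)
      fix i assume "i < dim_vec (complex_of_real l \<cdot>\<^sub>v w)"
      then have i: "i < n" by (simp add: w_def)
      have "(A *\<^sub>v w) $ i = (\<Sum>j<n. A $$ (i, j) * w $ j)"
        using i A by (simp add: scalar_prod_def w_def lessThan_atLeast0)
      also have "\<dots> = (\<Sum>j<n. complex_of_real (adj G (vs ! i) (vs ! j) * x (vs ! j)))"
        using i by (intro sum.cong refl) (simp add: entry w_def)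
      also have "\<dots> = complex_of_real (\<Sum>u\<in>V. adj G (vs ! i) u * x u)" unfolding re by simp
      also have "\<dots> = complex_of_real (l * x (vs ! i))"
        using ev[of "vs ! i"] bij_betw_apply[OF bij, of i] i by simp
      finally show "(A *\<^sub>v w) $ i = (complex_of_real l \<cdot>\<^sub>v w) $ i" using i by (simp add: w_def)
    qed
  qed
  then have "complex_of_real l \<in> spectrum A" by (auto simp: spectrum_def eigenvalue_def)
  then have "cmod (complex_of_real l) \<in> cmod ` spectrum A" by blast
  then have le: "l \<le> spectral_radius A" using spectral_radius_mem_max(2)[OF A n] l0 by fastforce
  obtain \<mu> where "\<mu> \<in> spectrum A" and mu: "spectral_radius A = cmod \<mu>"
    using spectral_radius_mem_max(1)[OF A n] by auto
  then obtain z where z: "eigenvector A z \<mu>" by (auto simp: spectrum_def eigenvalue_def)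
  then have zc: "z \<in> carrier_vec n" and z0: "z \<noteq> 0\<^sub>v n" and Az: "A *\<^sub>v z = \<mu> \<cdot>\<^sub>v z"
    using A by (auto simp: eigenvector_def)
  define y where "y v = cmod (z $ the_inv_into {..<n} ((!) vs) v)" for v
  have y: "y (vs ! i) = cmod (z $ i)" if "i < n" for i
    unfolding y_def using the_inv_into_f_f[of "(!) vs" "{..<n}" i] bij that by (simp add: bij_betw_def)
  have row: "cmod \<mu> * y v \<le> (\<Sum>u\<in>V. adj G v u * y u)" if v: "v \<in> V" for v
  proof -
    obtain i where i: "i < n" "v = vs ! i" using bij v by (auto simp: bij_betw_def)
    have "\<mu> * z $ i = (A *\<^sub>v z) $ i" using i zc Az by simp
    also have "\<dots> = (\<Sum>j<n. A $$ (i, j) * z $ j)"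
      using i A zc by (simp add: scalar_prod_def lessThan_atLeast0)
    finally have "cmod \<mu> * cmod (z $ i) = cmod (\<Sum>j<n. A $$ (i, j) * z $ j)"
      by (metis norm_mult)
    also have "\<dots> \<le> (\<Sum>j<n. cmod (A $$ (i, j) * z $ j))" by (rule norm_sum)
    also have "\<dots> = (\<Sum>j<n. adj G (vs ! i) (vs ! j) * y (vs ! j))"
      using i by (intro sum.cong refl) (simp add: entry norm_mult y adj_nonneg)
    finally show ?thesis using i by (simp add: re y)
  qed
  have ypos: "(\<Sum>v\<in>V. (y v)\<^sup>2) > 0"
  proof -
    have "\<exists>i<n. z $ i \<noteq> 0" using zc z0 by (metis carrier_vecD eq_vecI index_zero_vec(1,2))
    then obtain i where "i < n" "z $ i \<noteq> 0" by blast
    then have "vs ! i \<in> V" "(y (vs ! i))\<^sup>2 > 0" using bij y by (auto simp: bij_betw_def)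
    then show ?thesis using fV by (intro sum_pos2[where i = "vs ! i"]) auto
  qed
  have "cmod \<mu> * (\<Sum>v\<in>V. (y v)\<^sup>2) = (\<Sum>v\<in>V. y v * (cmod \<mu> * y v))"
    by (simp add: sum_distrib_left power2_eq_square algebra_simps)
  also have "\<dots> \<le> (\<Sum>v\<in>V. y v * (\<Sum>u\<in>V. adj G v u * y u))"
    by (intro sum_mono mult_left_mono row) (auto simp: y_def)
  also have "\<dots> = qform (adj G) V y" by (simp add: qform_def sum_distrib_left algebra_simps)
  also have "\<dots> \<le> l * (\<Sum>v\<in>V. (y v)\<^sup>2)" unfolding l_def by (rule x(3))
  finally have "cmod \<mu> \<le> l" using ypos by simp
  then have "rho G = l" using le mu by (simp add: A_def)
  then show ?thesis using that[of x] x by (simp add: l_def V_def)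
qed

lemma qform_le_rho:
  assumes "simple_graph G"
  shows "qform (adj G) (verts G) y \<le> rho G * (\<Sum>v\<in>verts G. (y v)\<^sup>2)"
proof (cases "verts G = {}")
  case True then show ?thesis by (simp add: qform_def)
next
  case False
  show ?thesis by (rule rho_Rayleigh[OF assms False]) blast
qed

text \<open>Zero entries are allowed, since on a disconnected graph a maximiser may vanish on whole
  components. The largest entry is 1, not the norm, so that entries can be compared with absolute
  thresholds.\<close>

definition perron :: "nat graph \<Rightarrow> (nat \<Rightarrow> real) \<Rightarrow> bool" where
  "perron G x \<longleftrightarrow> (\<forall>v. 0 \<le> x v) \<and> (\<forall>v\<in>verts G. x v \<le> 1) \<and> (\<exists>v\<in>verts G. x v = 1) \<and>
     (\<forall>v\<in>verts G. (\<Sum>u\<in>nbr G v. x u) = rho G * x v)"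

lemma perron_exists:
  assumes sg: "simple_graph G" and "verts G \<noteq> {}"
  obtains x where "perron G x"
proof -
  obtain x where x: "\<And>v. x v \<ge> 0" "(\<Sum>v\<in>verts G. (x v)\<^sup>2) = 1"
    "qform (adj G) (verts G) x = rho G"
    "\<And>y. qform (adj G) (verts G) y \<le> rho G * (\<Sum>v\<in>verts G. (y v)\<^sup>2)"
    by (rule rho_Rayleigh[OF assms]) (rule that)
  have fV: "finite (verts G)" using sg simple_graphD(1) by auto
  define m where "m = Max (x ` verts G)"
  have mem: "m \<in> x ` verts G" unfolding m_def using fV assms(2) by (intro Max_in) auto
  have mx: "x v \<le> m" if "v \<in> verts G" for v unfolding m_def using fV that by (intro Max_ge) auto
  have "\<exists>v\<in>verts G. x v \<noteq> 0"
  proof (rule ccontr)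
    assume "\<not> ?thesis"
    then have "(\<Sum>v\<in>verts G. (x v)\<^sup>2) = 0" by (intro sum.neutral) auto
    then show False using x(2) by simp
  qed
  then obtain v where "v \<in> verts G" "x v > 0" using x(1) by (auto simp: less_le)
  then have m: "m > 0" using mx[of v] by simp
  have ev: "(\<Sum>u\<in>nbr G v. x u) = rho G * x v" if "v \<in> verts G" for v
    unfolding sum_adj[OF sg, symmetric]
    by (rule qform_maximizer_eigenvector[OF fV that adj_sym x(4)]) (simp add: x)
  have "perron G (\<lambda>v. x v / m)"
    unfolding perron_def using m x(1) mx mem ev
    by (auto simp: divide_le_eq sum_divide_distrib[symmetric])
  then show ?thesis by (rule that)
qed

section \<open>Dominant vertices of a sparse graph with large spectral radius\<close>

definition common :: "'a graph \<Rightarrow> 'a set \<Rightarrow> 'a set" where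
  "common G S = {z \<in> verts G. S \<subseteq> nbr G z}"

definition rewire :: "'a graph \<Rightarrow> 'a \<Rightarrow> 'a set \<Rightarrow> 'a graph" where
  "rewire G v L = Graph (verts G) ({e \<in> edges G. v \<notin> e} \<union> (\<lambda>w. {v, w}) ` L)"

lemma simple_rewire:
  assumes "simple_graph G" "v \<in> verts G - L" "L \<subseteq> verts G"
  shows "simple_graph (rewire G v L)"
  using assms by (auto simp: simple_graph_def rewire_def card_2_iff)

lemma simple_induced:
  assumes "simple_graph G" "S \<subseteq> verts G"
  shows "simple_graph (induced G S)"
  using assms finite_subset[OF assms(2)] by (auto simp: simple_graph_def induced_def)

text \<open>This isolates what the spectral argument uses: \<open>sparse\<close> holds with one
  constant for vertex sets of every size, and \<open>no_K\<close> excludes the complete bipartite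
  graph with parts \<open>k + 1\<close> and \<open>t\<close>.\<close>

locale sparse_perron =
  fixes G :: "nat graph" and x :: "nat \<Rightarrow> real" and n k t :: nat and C :: real
  assumes sg: "simple_graph G" and card_V: "card (verts G) = n"
    and pf: "perron G x"
    and k: "k \<ge> 1" and nk: "2 * k \<le> n" and t: "t \<ge> 1"
    and rho_nonneg: "rho G \<ge> 0"
    and rho_ge: "real k * (real n - real k) \<le> (rho G)\<^sup>2"
    and C: "C \<ge> 1"
    and sparse: "\<And>S. S \<subseteq> verts G \<Longrightarrow> real (card {e \<in> edges G. e \<subseteq> S}) \<le> C * real (card S)"
    and no_K: "\<And>S. S \<subseteq> verts G \<Longrightarrow> card S = k + 1 \<Longrightarrow> card (common G S) < t"
begin

abbreviation "V \<equiv> verts G"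
abbreviation "N \<equiv> nbr G"
abbreviation "l \<equiv> rho G"

lemma fV: "finite V" using sg by (rule simple_graphD(1))

lemma fN: "finite (N v)" using sg by (rule finite_nbr)

lemma NV: "N v \<subseteq> V" using sg by (rule nbr_subset)

lemma x_nonneg: "0 \<le> x v" using pf by (simp add: perron_def)

lemma x_le_1: "v \<in> V \<Longrightarrow> x v \<le> 1" using pf by (simp add: perron_def)

lemma eigen: "v \<in> V \<Longrightarrow> (\<Sum>u\<in>N v. x u) = l * x v" using pf by (simp add: perron_def)

lemma n_pos: "0 < real n" using k nk by simp

lemma half_n_le: "real k * real n / 2 \<le> l\<^sup>2"
proof -
  have "real n / 2 \<le> real n - real k" using nk by linarith
  then have "real k * (real n / 2) \<le> real k * (real n - real k)" by (intro mult_left_mono) auto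
  then show ?thesis using rho_ge by simp
qed

lemma walk2: 
  assumes "v \<in> V"
  shows "l\<^sup>2 * x v = (\<Sum>u\<in>N v. \<Sum>w\<in>N u. x w)"
proof -
  have "(\<Sum>u\<in>N v. \<Sum>w\<in>N u. x w) = (\<Sum>u\<in>N v. l * x u)"
    using NV by (intro sum.cong refl eigen) blast
  then show ?thesis using eigen[OF assms] by (simp add: sum_distrib_left[symmetric] power2_eq_square)
qed

text \<open>Every pair counted on the left is adjacent inside \<open>A \<union> S\<close>, so the
  degree sum of the graph induced there bounds the left side even when \<open>A\<close> and
  \<open>S\<close> overlap.\<close>

lemma edges_between:
  assumes "A \<subseteq> V" "S \<subseteq> V"
  shows "(\<Sum>u\<in>A. real (card (N u \<inter> S))) \<le> 2 * C * (real (card A) + real (card S))"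
proof -
  define H where "H = induced G (A \<union> S)"
  have sH: "simple_graph H" unfolding H_def using assms sg by (intro simple_induced) auto
  have VH: "verts H = A \<union> S" by (simp add: H_def induced_def)
  have fAS: "finite (A \<union> S)" using assms fV finite_subset by blast
  have "(\<Sum>u\<in>A. real (card (N u \<inter> S))) \<le> (\<Sum>u\<in>A. real (card (nbr H u)))"
    by (intro sum_mono of_nat_mono card_mono finite_nbr sH) (auto simp: nbr_def H_def induced_def)
  also have "\<dots> \<le> (\<Sum>u\<in>verts H. real (card (nbr H u)))"
    using fAS by (intro sum_mono2) (auto simp: VH)
  also have "\<dots> = 2 * real (card {e \<in> edges G. e \<subseteq> A \<union> S})"
    unfolding sum_degrees[OF sH] by (simp add: H_def induced_def)
  also have "\<dots> \<le> 2 * (C * real (card (A \<union> S)))" using sparse[of "A \<union> S"] assms by simp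
  also have "\<dots> \<le> 2 * (C * (real (card A) + real (card S)))"
    using C card_Un_le[of A S] by (intro mult_left_mono) auto
  finally show ?thesis by simp
qed

lemma degree_total: "(\<Sum>v\<in>V. real (card (N v))) \<le> 2 * C * real n"
proof -
  have "{e \<in> edges G. e \<subseteq> V} = edges G" using sg simple_graphD(2) by blast
  then show ?thesis using sum_degrees[OF sg] sparse[of V] card_V by simp
qed

lemma degree_sum_le: "A \<subseteq> V \<Longrightarrow> (\<Sum>v\<in>A. real (card (N v))) \<le> 2 * C * real n"
  using degree_total sum_mono2[OF fV, of A "\<lambda>v. real (card (N v))"] by force

text \<open>Walks of length two that end at an entry below \<open>\<alpha>\<close> number at most
  the sum of all degrees.\<close>

lemma walk_bound:
  assumes "v \<in> V" "\<alpha> \<ge> 0"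
  shows "l\<^sup>2 * x v \<le> (\<Sum>u\<in>N v. \<Sum>w\<in>N u \<inter> {w \<in> V. x w \<ge> \<alpha>}. x w) + 2 * C * \<alpha> * real n"
proof -
  let ?S = "{w \<in> V. x w \<ge> \<alpha>}"
  have "(\<Sum>w\<in>N u. x w) \<le> (\<Sum>w\<in>N u \<inter> ?S. x w) + \<alpha> * real (card (N u))" for u
  proof -
    have "(\<Sum>w\<in>N u. x w) = (\<Sum>w\<in>N u \<inter> ?S. x w) + (\<Sum>w\<in>N u - ?S. x w)"
      by (rule sum.Int_Diff[OF fN])
    also have "(\<Sum>w\<in>N u - ?S. x w) \<le> (\<Sum>w\<in>N u - ?S. \<alpha>)"
    proof (rule sum_mono)
      fix w assume w: "w \<in> N u - ?S"
      then have "w \<in> V" using NV[of u] by blast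
      then show "x w \<le> \<alpha>" using w by simp
    qed
    also have "\<dots> \<le> \<alpha> * real (card (N u))"
      using assms(2) fN card_mono[of "N u" "N u - ?S"] by (simp add: mult.commute mult_left_mono)
    finally show ?thesis by simp
  qed
  then have "l\<^sup>2 * x v \<le> (\<Sum>u\<in>N v. (\<Sum>w\<in>N u \<inter> ?S. x w) + \<alpha> * real (card (N u)))"
    unfolding walk2[OF assms(1)] by (intro sum_mono) auto
  also have "\<dots> = (\<Sum>u\<in>N v. \<Sum>w\<in>N u \<inter> ?S. x w) + \<alpha> * (\<Sum>u\<in>N v. real (card (N u)))"
    by (simp add: sum.distrib sum_distrib_left)
  also have "\<alpha> * (\<Sum>u\<in>N v. real (card (N u))) \<le> \<alpha> * (2 * C * real n)"
    using degree_sum_le[OF NV] assms(2) by (intro mult_left_mono)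
  finally show ?thesis by (simp add: mult_ac)
qed

text \<open>First round of a bootstrap in three rounds. As entries are at most 1, an entry of at
  least \<open>\<alpha>\<close> forces degree at least \<open>\<alpha> * l\<close>; this leaves only
  \<open>n / l\<close> vertices up to a constant, which is of order at most sqrt n.\<close>

lemma card_level_set:
  assumes "\<alpha> > 0"
  shows "real (card {v \<in> V. x v \<ge> \<alpha>}) * (\<alpha> * l) \<le> 2 * C * real n"
proof -
  let ?S = "{v \<in> V. x v \<ge> \<alpha>}"
  have "real (card ?S) * (\<alpha> * l) = (\<Sum>v\<in>?S. \<alpha> * l)" by simp
  also have "\<dots> \<le> (\<Sum>v\<in>?S. real (card (N v)))"
  proof (rule sum_mono)
    fix v assume v: "v \<in> ?S"
    have "\<alpha> * l \<le> l * x v" using v rho_nonneg by (simp add: mult.commute mult_right_mono)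
    also have "\<dots> = (\<Sum>u\<in>N v. x u)" using v eigen by simp
    also have "\<dots> \<le> (\<Sum>u\<in>N v. 1)" using NV x_le_1 by (intro sum_mono) blast
    finally show "\<alpha> * l \<le> real (card (N v))" by simp
  qed
  also have "\<dots> \<le> 2 * C * real n" by (rule degree_sum_le) auto
  finally show ?thesis .
qed

text \<open>Second round: few edges run between the neighbours of \<open>v\<close> and the small
  level set of the first round, so a large entry at \<open>v\<close> can only come from a degree
  linear in \<open>n\<close>.\<close>

lemma degree_level_set:
  assumes v: "v \<in> V" "x v \<ge> \<eta>" and \<eta>: "\<eta> > 0" and big: "512 * C ^ 3 \<le> l * \<eta>\<^sup>2"
  shows "\<eta> * real n / (8 * C) \<le> real (card (N v))"
proof -
  \<comment> \<open>With this \<open>\<alpha>\<close> the tail \<open>2 * C * \<alpha> * n\<close>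
    of \<open>walk_bound\<close> equals \<open>\<eta> * n / 8\<close>. The constant 512 in
    \<open>big\<close> bounds the contribution of the level set by another
    \<open>\<eta> * n / 8\<close>, which leaves half of \<open>\<eta> * n / 2\<close> for the
    degree.\<close>
  define \<alpha> where "\<alpha> = \<eta> / (16 * C)"
  have \<alpha>: "\<alpha> > 0" using \<eta> C by (simp add: \<alpha>_def)
  let ?S = "{v \<in> V. x v \<ge> \<alpha>}"
  have "(\<Sum>u\<in>N v. \<Sum>w\<in>N u \<inter> ?S. x w) \<le> (\<Sum>u\<in>N v. real (card (N u \<inter> ?S)))"
  proof (rule sum_mono)
    fix u
    have "(\<Sum>w\<in>N u \<inter> ?S. x w) \<le> (\<Sum>w\<in>N u \<inter> ?S. 1)" using x_le_1 by (intro sum_mono) blast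
    then show "(\<Sum>w\<in>N u \<inter> ?S. x w) \<le> real (card (N u \<inter> ?S))" by simp
  qed
  also have "\<dots> \<le> 2 * C * (real (card (N v)) + real (card ?S))"
    by (rule edges_between[OF NV]) auto
  finally have 1: "l\<^sup>2 * x v \<le> 2 * C * real (card (N v)) + 2 * C * real (card ?S) + \<eta> * real n / 8"
    using walk_bound[OF v(1) less_imp_le[OF \<alpha>]] C by (simp add: \<alpha>_def field_simps)
  have lpos: "l > 0"
  proof (rule ccontr)
    assume "\<not> l > 0"
    then have "l = 0" using rho_nonneg by simp
    then show False using big C by simp
  qed
  have "2 * C * real (card ?S) * (512 * C ^ 3) \<le> 2 * C * real (card ?S) * (l * \<eta>\<^sup>2)"
    using big C by (intro mult_left_mono) auto
  also have "\<dots> = 32 * C\<^sup>2 * \<eta> * (real (card ?S) * (\<alpha> * l))"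
    using C by (simp add: \<alpha>_def field_simps power2_eq_square)
  also have "\<dots> \<le> 32 * C\<^sup>2 * \<eta> * (2 * C * real n)"
    using card_level_set[OF \<alpha>] C \<eta> by (intro mult_left_mono) auto
  also have "\<dots> = (\<eta> * real n / 8) * (512 * C ^ 3)" by (simp add: power2_eq_square power3_eq_cube)
  finally have 2: "2 * C * real (card ?S) \<le> \<eta> * real n / 8"
    by (rule mult_right_le_imp_le) (use C in simp)
  have "real n / 2 \<le> l\<^sup>2"
    using half_n_le k mult_right_mono[of 1 "real k" "real n / 2"] by simp
  then have "real n / 2 * \<eta> \<le> l\<^sup>2 * x v" using v(2) \<eta> by (intro mult_mono) auto
  then have "\<eta> * real n / 4 \<le> 2 * C * real (card (N v))" using 1 2 by (simp add: field_simps)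
  then show ?thesis using C by (simp add: field_simps)
qed

text \<open>Third round: each such vertex now has linear degree, while all degrees together are
  linear in \<open>n\<close>.\<close>

lemma card_level_set_bounded:
  assumes \<eta>: "\<eta> > 0" and big: "512 * C ^ 3 \<le> l * \<eta>\<^sup>2"
  shows "real (card {v \<in> V. x v \<ge> \<eta>}) * \<eta> \<le> 16 * C\<^sup>2"
proof -
  let ?S = "{v \<in> V. x v \<ge> \<eta>}"
  have "real (card ?S) * (\<eta> * real n / (8 * C)) = (\<Sum>v\<in>?S. \<eta> * real n / (8 * C))" by simp
  also have "\<dots> \<le> (\<Sum>v\<in>?S. real (card (N v)))"
    using degree_level_set[OF _ _ assms] by (intro sum_mono) auto
  also have "\<dots> \<le> 2 * C * real n" by (rule degree_sum_le) auto
  finally show ?thesis using n_pos C by (simp add: field_simps power2_eq_square)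
qed

lemma card_not_common:
  assumes S: "S \<subseteq> V" and deg: "\<And>v. v \<in> S \<Longrightarrow> (1 - \<gamma>) * real n \<le> real (card (N v))"
  shows "real (card (V - common G S)) \<le> real (card S) * (\<gamma> * real n)"
proof -
  have fS: "finite S" using S fV finite_subset by blast
  have "V - common G S \<subseteq> (\<Union>v\<in>S. V - N v)" by (auto simp: common_def nbr_sym)
  then have "card (V - common G S) \<le> card (\<Union>v\<in>S. V - N v)"
    using fS fV by (intro card_mono) auto
  also have "\<dots> \<le> (\<Sum>v\<in>S. card (V - N v))" by (rule card_UN_le[OF fS])
  finally have "real (card (V - common G S)) \<le> (\<Sum>v\<in>S. real (card (V - N v)))"
    by (metis of_nat_le_iff of_nat_sum)
  also have "\<dots> \<le> (\<Sum>v\<in>S. \<gamma> * real n)"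
  proof (rule sum_mono)
    fix v assume v: "v \<in> S"
    have "card (V - N v) = n - card (N v)" using NV fN card_V by (simp add: card_Diff_subset)
    moreover have "card (N v) \<le> n" using NV fV card_V card_mono by metis
    ultimately show "real (card (V - N v)) \<le> \<gamma> * real n"
      using deg[OF v] by (simp add: of_nat_diff algebra_simps)
  qed
  finally show ?thesis by simp
qed

text \<open>All but boundedly many vertices have at most \<open>k\<close> neighbours in a bounded set, because
  \<open>k + 1\<close> vertices have fewer than \<open>t\<close> common neighbours.\<close>

lemma card_many_nbrs:
  assumes L: "L \<subseteq> V" and m: "card L \<le> m"
  shows "card {z \<in> V. card (N z \<inter> L) > k} \<le> 2 ^ m * t"
proof -
  have fL: "finite L" using L fV finite_subset by blast
  let ?P = "{S. S \<subseteq> L \<and> card S = k + 1}"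
  have fP: "finite ?P" using fL by simp
  have "{z \<in> V. card (N z \<inter> L) > k} \<subseteq> (\<Union>S\<in>?P. common G S)"
  proof
    fix z assume z: "z \<in> {z \<in> V. card (N z \<inter> L) > k}"
    then have "k + 1 \<le> card (N z \<inter> L)" by simp
    then obtain S where "S \<subseteq> N z \<inter> L" "card S = k + 1" by (rule obtain_subset_with_card_n)
    then show "z \<in> (\<Union>S\<in>?P. common G S)" using z by (auto simp: common_def)
  qed
  then have "card {z \<in> V. card (N z \<inter> L) > k} \<le> card (\<Union>S\<in>?P. common G S)"
    using fP fV by (intro card_mono) (auto simp: common_def)
  also have "\<dots> \<le> (\<Sum>S\<in>?P. card (common G S))" by (rule card_UN_le[OF fP])
  also have "\<dots> \<le> (\<Sum>S\<in>?P. t)" 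
  proof (rule sum_mono)
    fix S assume "S \<in> ?P"
    then have "S \<subseteq> V" "card S = k + 1" using L by auto
    then show "card (common G S) \<le> t" using no_K[of S] by simp
  qed
  also have "\<dots> = card ?P * t" by simp
  also have "\<dots> \<le> card (Pow L) * t" using fL by (intro mult_right_mono card_mono) auto
  also have "\<dots> \<le> 2 ^ m * t" using fL m by (simp add: card_Pow power_increasing)
  finally show ?thesis .
qed

text \<open>At most \<open>2 ^ m * t\<close> middle vertices have more than \<open>k\<close>
  neighbours in \<open>L\<close>, and each of them contributes at most \<open>m\<close>; for the
  others \<open>\<kappa>\<close> applies.\<close>

lemma sum_level_nbrs:
  assumes L: "L \<subseteq> V" and m: "card L \<le> m" and v: "v \<in> V"
    and bd: "\<And>z. z \<in> V \<Longrightarrow> card (N z \<inter> L) \<le> k \<Longrightarrow> (\<Sum>w\<in>N z \<inter> L. x w) \<le> \<kappa>" and \<kappa>: "\<kappa> \<ge> 0"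
  shows "(\<Sum>z\<in>N v. \<Sum>w\<in>N z \<inter> L. x w) \<le> \<kappa> * real (card (N v)) + real (2 ^ m * t * m)"
proof -
  let ?Z = "{z \<in> V. card (N z \<inter> L) > k}"
  have fL: "finite L" using L fV finite_subset by blast
  have bd2: "(\<Sum>w\<in>N z \<inter> L. x w) \<le> real m" for z
  proof -
    have "(\<Sum>w\<in>N z \<inter> L. x w) \<le> (\<Sum>w\<in>N z \<inter> L. 1)" using x_le_1 L by (intro sum_mono) blast
    also have "\<dots> \<le> real m" using card_mono[OF fL, of "N z \<inter> L"] m by simp
    finally show ?thesis .
  qed
  have "(\<Sum>z\<in>N v. \<Sum>w\<in>N z \<inter> L. x w) =
      (\<Sum>z\<in>N v \<inter> ?Z. \<Sum>w\<in>N z \<inter> L. x w) + (\<Sum>z\<in>N v - ?Z. \<Sum>w\<in>N z \<inter> L. x w)"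
    by (rule sum.Int_Diff[OF fN])
  also have "(\<Sum>z\<in>N v \<inter> ?Z. \<Sum>w\<in>N z \<inter> L. x w) \<le> (\<Sum>z\<in>N v \<inter> ?Z. real m)"
    using bd2 by (intro sum_mono)
  also have "\<dots> = real (card (N v \<inter> ?Z) * m)" by simp
  also have "\<dots> \<le> real (2 ^ m * t * m)"
  proof -
    have "card (N v \<inter> ?Z) \<le> card ?Z" using fV by (intro card_mono) auto
    then have "card (N v \<inter> ?Z) \<le> 2 ^ m * t" using card_many_nbrs[OF L m] by linarith
    then show ?thesis by (intro of_nat_mono mult_right_mono) auto
  qed
  also have "(\<Sum>z\<in>N v - ?Z. \<Sum>w\<in>N z \<inter> L. x w) \<le> (\<Sum>z\<in>N v - ?Z. \<kappa>)"
  proof (rule sum_mono)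
    fix z assume z: "z \<in> N v - ?Z"
    then have "z \<in> V" using NV[of v] by blast
    then show "(\<Sum>w\<in>N z \<inter> L. x w) \<le> \<kappa>" using z bd by auto
  qed
  also have "\<dots> \<le> \<kappa> * real (card (N v))"
    using \<kappa> fN card_mono[of "N v" "N v - ?Z"] by (simp add: mult.commute mult_left_mono)
  finally show ?thesis by simp
qed

end

lemma sum_star:
  fixes x :: "'a \<Rightarrow> real"
  assumes "v \<notin> A"
  shows "(\<Sum>e\<in>(\<lambda>w. {v, w}) ` A. \<Prod>u\<in>e. x u) = x v * (\<Sum>w\<in>A. x w)"
proof -
  have "inj_on (\<lambda>w. {v, w}) A" by (auto simp: inj_on_def doubleton_eq_iff)
  then have "(\<Sum>e\<in>(\<lambda>w. {v, w}) ` A. \<Prod>u\<in>e. x u) = (\<Sum>w\<in>A. \<Prod>u\<in>{v, w}. x u)"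
    by (simp add: sum.reindex)
  also have "\<dots> = (\<Sum>w\<in>A. x v * x w)" using assms by (intro sum.cong refl prod.insert_if[THEN trans]) auto
  finally show ?thesis by (simp add: sum_distrib_left)
qed

context sparse_perron begin

text \<open>\<open>L\<close> is the set of entries of at least \<open>1 - \<theta>\<close>, found
  inside the bounded level set \<open>S\<close> at the lower threshold \<open>\<eta>\<close>. A
  middle vertex typically sees at most \<open>k\<close> vertices of \<open>S\<close>, so
  \<open>l\<^sup>2 \<ge> k * (n - k)\<close> is nearly tight at any entry close to 1.\<close>

lemma dominant_set:
  fixes m :: nat
  assumes \<eta>: "\<eta> > 0" and big: "512 * C ^ 3 \<le> l * \<eta>\<^sup>2" and m: "16 * C\<^sup>2 \<le> real m * \<eta>"
    and \<theta>: "\<theta> > 0" "4 * real (k + 1) * \<theta> \<le> 1" and \<eta>\<theta>: "4 * C * \<eta> \<le> \<theta>"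
    and n: "2 * (real k ^ 2 + real (2 ^ m * t * m) + real (k * t)) \<le> \<theta> * real n"
  obtains L where "L \<subseteq> V" "card L = k" "\<And>v. v \<in> L \<Longrightarrow> x v \<ge> 1 - \<theta>"
    "\<And>v. v \<in> L \<Longrightarrow> (1 - 2 * \<theta>) * real n \<le> real (card (N v))"
    "\<And>v. v \<in> V - L \<Longrightarrow> x v \<le> 6 * real k * \<theta>"
proof -
  define S where "S = {v \<in> V. x v \<ge> \<eta>}"
  define L where "L = {v \<in> V. x v \<ge> 1 - \<theta>}"
  define M where "M = real (2 ^ m * t * m)"
  have M: "M \<ge> 0" unfolding M_def by (rule of_nat_0_le_iff)
  note n' = n[folded M_def]
  have kt: "real (k * t) \<ge> 1" using k t mult_le_mono[of 1 k 1 t] by linarith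
  have k1: "real k \<ge> 1" using k by simp
  have \<theta>8: "\<theta> \<le> 1/8"
  proof -
    have "8 * \<theta> \<le> 4 * real (k + 1) * \<theta>" using k1 \<theta>(1) by (intro mult_right_mono) auto
    then show ?thesis using \<theta>(2) by simp
  qed
  have \<eta>4: "\<eta> \<le> \<theta> / 4"
  proof -
    have "4 * 1 * \<eta> \<le> 4 * C * \<eta>" using C \<eta> by (intro mult_right_mono mult_left_mono) auto
    then show ?thesis using \<eta>\<theta> by simp
  qed
  have SV: "S \<subseteq> V" by (auto simp: S_def)
  have LV: "L \<subseteq> V" by (auto simp: L_def)
  have LS: "L \<subseteq> S" using \<eta>4 \<theta>8 by (auto simp: S_def L_def)
  have fS: "finite S" using SV fV finite_subset by blast
  have fL: "finite L" using LS fS finite_subset by blast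
  have cS: "card S \<le> m"
  proof -
    have "real (card S) * \<eta> \<le> real m * \<eta>" using card_level_set_bounded[OF \<eta> big] m by (simp add: S_def)
    then show ?thesis using \<eta> by simp
  qed
  have tail: "2 * C * \<eta> * real n \<le> \<theta> / 2 * real n"
    using \<eta>\<theta> by (intro mult_right_mono) auto
  \<comment> \<open>Used twice: with \<open>\<kappa> = k\<close> at every vertex, and with
    \<open>\<kappa> = k - \<theta>\<close> to refute that \<open>L\<close> has fewer than
    \<open>k\<close> elements.\<close>
  have bound: "l\<^sup>2 * x v \<le> \<kappa> * real (card (N v)) + M + \<theta> / 2 * real n"
    if "v \<in> V" "\<And>z. z \<in> V \<Longrightarrow> card (N z \<inter> S) \<le> k \<Longrightarrow> (\<Sum>w\<in>N z \<inter> S. x w) \<le> \<kappa>" "\<kappa> \<ge> 0" for v \<kappa>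
    using walk_bound[OF that(1), of \<eta>] \<eta> sum_level_nbrs[OF SV cS that(1) that(2,3)] tail
    by (simp add: S_def M_def)
  have card_bound: "(\<Sum>w\<in>N z \<inter> S. x w) \<le> real (card (N z \<inter> S))" for z
  proof -
    have "(\<Sum>w\<in>N z \<inter> S. x w) \<le> (\<Sum>w\<in>N z \<inter> S. 1)" using x_le_1 SV by (intro sum_mono) blast
    then show ?thesis by simp
  qed
  have boundk: "l\<^sup>2 * x v \<le> real k * real (card (N v)) + M + \<theta> / 2 * real n" if "v \<in> V" for v
  proof (rule bound[OF that])
    fix z assume "card (N z \<inter> S) \<le> k"
    then show "(\<Sum>w\<in>N z \<inter> S. x w) \<le> real k" using card_bound[of z] by linarith
  qed simp
  have degL: "(1 - 2 * \<theta>) * real n \<le> real (card (N v))" if v: "v \<in> L" for v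
  proof -
    have "real k * (real n - real k) * (1 - \<theta>) \<le> l\<^sup>2 * x v"
      using rho_ge v \<theta>8 by (intro mult_mono) (auto simp: L_def)
    also have "\<dots> \<le> real k * real (card (N v)) + M + \<theta> / 2 * real n" using v LV boundk by blast
    finally have 1: "real k * (real n - real k) * (1 - \<theta>) \<le> real k * real (card (N v)) + M + \<theta> / 2 * real n" .
    have "real k * (real n - real k) * (1 - \<theta>) = real k * (1 - \<theta>) * real n - real k ^ 2 * (1 - \<theta>)"
      by (simp add: algebra_simps power2_eq_square)
    moreover have "real k ^ 2 * (1 - \<theta>) \<le> real k ^ 2" using \<theta> \<theta>8 by (intro mult_left_le) auto
    moreover have "1 * (\<theta> * real n) \<le> real k * (\<theta> * real n)"
      using k1 \<theta>(1) by (intro mult_right_mono) auto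
    ultimately have "real k * ((1 - 2 * \<theta>) * real n) \<le> real k * real (card (N v))"
      using 1 n' kt by (simp add: algebra_simps)
    then show ?thesis using k1 by simp
  qed
  have n2t: "2 * real t \<le> real n"
  proof -
    have "t \<le> k * t" using k by simp
    then have "real t \<le> real (k * t)" by (rule of_nat_mono)
    then have "2 * real t \<le> \<theta> * real n" using n' M by (smt (verit) zero_le_power2)
    also have "\<dots> \<le> 1 * real n" using \<theta>8 by (intro mult_right_mono) auto
    finally show ?thesis by simp
  qed
  \<comment> \<open>A set of \<open>k + 1\<close> vertices of degree at least
    \<open>(1 - 2 * \<theta>) * n\<close> would have half of all vertices as common neighbours,
    against \<open>no_K\<close>.\<close>
  have "card L \<le> k"
  proof (rule ccontr)
    assume "\<not> card L \<le> k"
    then have "k + 1 \<le> card L" by simp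
    then obtain S' where S': "S' \<subseteq> L" "card S' = k + 1" by (rule obtain_subset_with_card_n)
    then have S'V: "S' \<subseteq> V" using LV by blast
    have "real (card (V - common G S')) \<le> real (k + 1) * (2 * \<theta> * real n)"
      using card_not_common[OF S'V, of "2 * \<theta>"] degL S' by auto
    also have "\<dots> \<le> real n / 2" using \<theta>(2) n_pos
      mult_right_mono[of "4 * real (k + 1) * \<theta>" 1 "real n"] by (simp add: algebra_simps)
    finally have "real n / 2 \<le> real (card (common G S'))"
      using fV card_V card_Diff_subset[of "common G S'" V] card_mono[OF fV, of "common G S'"]
      by (auto simp: common_def of_nat_diff)
    then show False using no_K[OF S'V S'(2)] n2t by linarith
  qed
  \<comment> \<open>If \<open>L\<close> were too small, any \<open>k\<close> vertices of
    \<open>S\<close> would include an entry of at most \<open>1 - \<theta>\<close>. At a vertex with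
    entry 1 the resulting loss of \<open>\<theta> * n\<close> exceeds all error terms.\<close>
  moreover have "card L \<ge> k"
  proof (rule ccontr)
    assume "\<not> card L \<ge> k"
    then have Lk: "card L \<le> k - 1" by simp
    obtain u where u: "u \<in> V" "x u = 1" using pf by (auto simp: perron_def)
    have "l\<^sup>2 * x u \<le> (real k - \<theta>) * real (card (N u)) + M + \<theta> / 2 * real n"
    proof (rule bound[OF u(1)])
      fix z assume z: "z \<in> V" "card (N z \<inter> S) \<le> k"
      show "(\<Sum>w\<in>N z \<inter> S. x w) \<le> real k - \<theta>"
      proof (cases "card (N z \<inter> S) = k")
        case False
        then have "real (card (N z \<inter> S)) \<le> real k - 1" using z(2) by linarith
        then show ?thesis using card_bound[of z] \<theta>8 by linarith
      next
        case True
        have fNS: "finite (N z \<inter> S)" using fS by blast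
        have "\<not> N z \<inter> S \<subseteq> L"
        proof
          assume "N z \<inter> S \<subseteq> L"
          then have "card (N z \<inter> S) \<le> card L" using fL by (rule card_mono[rotated])
          then show False using Lk True k by linarith
        qed
        then obtain w0 where w0: "w0 \<in> N z \<inter> S" "w0 \<notin> L" by blast
        then have "x w0 \<le> 1 - \<theta>" using SV by (auto simp: L_def)
        moreover have "(\<Sum>w\<in>N z \<inter> S - {w0}. x w) \<le> (\<Sum>w\<in>N z \<inter> S - {w0}. 1)"
          using x_le_1 SV by (intro sum_mono) blast
        moreover have "(\<Sum>w\<in>N z \<inter> S - {w0}. 1) = real k - 1"
          using True fNS w0 k by (simp add: card_Diff_singleton of_nat_diff)
        moreover have "(\<Sum>w\<in>N z \<inter> S. x w) = x w0 + (\<Sum>w\<in>N z \<inter> S - {w0}. x w)"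
          by (rule sum.remove[OF fNS w0(1)])
        ultimately show ?thesis by linarith
      qed
    qed (use k1 \<theta>8 in linarith)
    also have "(real k - \<theta>) * real (card (N u)) \<le> (real k - \<theta>) * real n"
      using k1 \<theta>8 card_mono[OF fV NV[of u]] card_V by (intro mult_left_mono) auto
    finally have "real k * (real n - real k) \<le> (real k - \<theta>) * real n + M + \<theta> / 2 * real n"
      using rho_ge u(2) by simp
    then show False using n' kt by (simp add: algebra_simps power2_eq_square)
  qed
  ultimately have cL: "card L = k" by simp
  \<comment> \<open>Vertex \<open>v\<close> has fewer than \<open>t\<close> neighbours among the
    common neighbours of \<open>L\<close>, and these are almost all vertices. So its degree is at
    most \<open>t + 2 * k * \<theta> * n\<close>, and \<open>boundk\<close> makes its entry
    small.\<close>
  have small: "x v \<le> 6 * real k * \<theta>" if v: "v \<in> V - L" for v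
  proof -
    have vL: "v \<notin> L" "v \<in> V" using v by auto
    have "N v \<subseteq> common G (insert v L) \<union> (V - common G L)"
      using NV[of v] by (auto simp: common_def nbr_sym)
    then have "card (N v) \<le> card (common G (insert v L) \<union> (V - common G L))"
      using fV by (intro card_mono) (auto simp: common_def)
    also have "\<dots> \<le> card (common G (insert v L)) + card (V - common G L)" by (rule card_Un_le)
    also have "card (common G (insert v L)) < t"
      using vL LV fL cL by (intro no_K) auto
    finally have "card (N v) \<le> t + card (V - common G L)" by simp
    then have "real (card (N v)) \<le> real t + real (card (V - common G L))" by linarith
    also have "real (card (V - common G L)) \<le> real k * (2 * \<theta> * real n)"
      using card_not_common[OF LV, of "2 * \<theta>"] degL cL by simp
    finally have "real k * real (card (N v)) \<le> real k * (real t + real k * (2 * \<theta> * real n))"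
      by (intro mult_left_mono) auto
    then have 1: "l\<^sup>2 * x v \<le> real (k * t) + 2 * real k ^ 2 * \<theta> * real n + M + \<theta> / 2 * real n"
      using boundk[OF vL(2)] by (simp add: algebra_simps power2_eq_square)
    have "real (k * t) + M \<le> \<theta> / 2 * real n" using n' by (smt (verit) field_sum_of_halves zero_le_power2 times_divide_eq_left)
    moreover have "\<theta> * real n \<le> real k ^ 2 * \<theta> * real n"
      using k1 \<theta>(1) n_pos by simp
    ultimately have 2: "l\<^sup>2 * x v \<le> 3 * real k ^ 2 * \<theta> * real n" using 1 by (simp add: algebra_simps)
    have "real k * real n / 2 * x v \<le> l\<^sup>2 * x v" using half_n_le x_nonneg by (intro mult_right_mono)
    also note 2
    also have "3 * real k ^ 2 * \<theta> * real n = real k * real n / 2 * (6 * real k * \<theta>)"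
      by (simp add: power2_eq_square)
    finally have "real k * real n / 2 * x v \<le> real k * real n / 2 * (6 * real k * \<theta>)" .
    then show ?thesis by (rule mult_left_le_imp_le) (use k1 n_pos in simp)
  qed
  show ?thesis
    by (rule that[OF LV cL _ degL small]) (auto simp: L_def)
qed

text \<open>By Cauchy-Schwarz over the ordered adjacent pairs in \<open>E\<close>, of which there
  are at most \<open>4 * C * card E\<close>, Rayleigh quotients on \<open>E\<close> are at most the
  square root of this number. If every vertex violated the bound, weighting by \<open>x v\<close>
  and summing would exceed it.\<close>

lemma light_vertex_exists:
  assumes "E \<subseteq> V" "E \<noteq> {}"
  obtains v where "v \<in> E" "(\<Sum>u\<in>N v \<inter> E. x u) \<le> sqrt (4 * C * real (card E)) * x v"
proof -
  define s where "s = sqrt (4 * C * real (card E))"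
  have fE: "finite E" using assms fV finite_subset by blast
  have s0: "s \<ge> 0" using C by (simp add: s_def)
  have "\<exists>v\<in>E. (\<Sum>u\<in>N v \<inter> E. x u) \<le> s * x v"
  proof (rule ccontr)
    assume "\<not> ?thesis"
    then have gt: "(\<Sum>u\<in>N v \<inter> E. x u) > s * x v" if "v \<in> E" for v using that by force
    define P where "P = (SIGMA v:E. N v \<inter> E)"
    have fP: "finite P" unfolding P_def using fE by auto
    have Psub: "P \<subseteq> E \<times> E" by (auto simp: P_def)
    obtain v0 where v0: "v0 \<in> E" using assms(2) by auto
    \<comment> \<open>A positive entry makes the summed inequality strict; were \<open>x\<close>
      zero on \<open>E\<close>, the assumed violation would fail at \<open>v0\<close>.\<close>
    obtain u0 where u0: "u0 \<in> E" "x u0 > 0"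
    proof (rule ccontr)
      assume "\<not> thesis"
      then have "x u = 0" if "u \<in> E" for u using x_nonneg[of u] \<open>\<And>u0. u0 \<in> E \<Longrightarrow> 0 < x u0 \<Longrightarrow> thesis\<close> that
        by (metis less_eq_real_def)
      then have "(\<Sum>u\<in>N v0 \<inter> E. x u) = 0" by (intro sum.neutral) auto
      then show False using gt[OF v0] s0 x_nonneg[of v0] by (metis mult_nonneg_nonneg not_le)
    qed
    have "s * (\<Sum>v\<in>E. (x v)\<^sup>2) = (\<Sum>v\<in>E. x v * (s * x v))"
      by (simp add: sum_distrib_left power2_eq_square mult_ac)
    also have "\<dots> < (\<Sum>v\<in>E. x v * (\<Sum>u\<in>N v \<inter> E. x u))"
    proof (rule sum_strict_mono_ex1[OF fE])
      show "\<forall>v\<in>E. x v * (s * x v) \<le> x v * (\<Sum>u\<in>N v \<inter> E. x u)"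
        using gt x_nonneg by (auto intro!: mult_left_mono simp: less_imp_le)
      show "\<exists>v\<in>E. x v * (s * x v) < x v * (\<Sum>u\<in>N v \<inter> E. x u)"
        using gt u0 by (intro bexI[of _ u0] mult_strict_left_mono) auto
    qed
    also have "\<dots> = (\<Sum>v\<in>E. \<Sum>u\<in>N v \<inter> E. x v * x u)" by (simp add: sum_distrib_left)
    also have "\<dots> = (\<Sum>p\<in>P. 1 * (x (fst p) * x (snd p)))"
      unfolding P_def using fE by (subst sum.Sigma) (auto simp: case_prod_beta)
    finally have lt: "s * (\<Sum>v\<in>E. (x v)\<^sup>2) < (\<Sum>p\<in>P. 1 * (x (fst p) * x (snd p)))" .
    have sq0: "0 \<le> s * (\<Sum>v\<in>E. (x v)\<^sup>2)" using s0 by (intro mult_nonneg_nonneg sum_nonneg) auto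
    have "(s * (\<Sum>v\<in>E. (x v)\<^sup>2))\<^sup>2 < (\<Sum>p\<in>P. 1 * (x (fst p) * x (snd p)))\<^sup>2"
      using lt sq0 by (intro power_strict_mono) auto
    also have "\<dots> \<le> (\<Sum>p\<in>P. 1\<^sup>2) * (\<Sum>p\<in>P. (x (fst p) * x (snd p))\<^sup>2)"
      by (rule Cauchy_Schwarz_ineq_sum)
    also have "\<dots> \<le> s\<^sup>2 * (\<Sum>v\<in>E. (x v)\<^sup>2)\<^sup>2"
    proof (rule mult_mono)
      have "(\<Sum>p\<in>P. 1\<^sup>2) = (\<Sum>v\<in>E. real (card (N v \<inter> E)))"
        unfolding P_def using fE by (simp add: card_SigmaI)
      also have "\<dots> \<le> 2 * C * (real (card E) + real (card E))" by (rule edges_between[OF assms(1) assms(1)])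
      also have "\<dots> = s\<^sup>2" using C by (simp add: s_def)
      finally show "(\<Sum>p\<in>P. 1\<^sup>2) \<le> s\<^sup>2" .
      have "(\<Sum>p\<in>P. (x (fst p) * x (snd p))\<^sup>2) \<le> (\<Sum>p\<in>E \<times> E. (x (fst p) * x (snd p))\<^sup>2)"
        using fE Psub by (intro sum_mono2) auto
      also have "\<dots> = (\<Sum>v\<in>E. (x v)\<^sup>2)\<^sup>2"
        by (simp add: power2_eq_square[of "\<Sum>v\<in>E. (x v)\<^sup>2"] sum_product sum.cartesian_product
            case_prod_beta power_mult_distrib)
      finally show "(\<Sum>p\<in>P. (x (fst p) * x (snd p))\<^sup>2) \<le> (\<Sum>v\<in>E. (x v)\<^sup>2)\<^sup>2" .
    qed (auto intro: sum_nonneg)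
    finally show False by (simp add: power_mult_distrib)
  qed
  then show ?thesis using that by (auto simp: s_def)
qed

lemma qform_perron: "qform (adj G) V x = l * (\<Sum>u\<in>V. (x u)\<^sup>2)"
proof -
  have "qform (adj G) V x = (\<Sum>v\<in>V. x v * (l * x v))"
    unfolding qform_adj_nbr[OF sg] by (intro sum.cong refl) (simp add: eigen)
  then show ?thesis by (simp add: sum_distrib_left power2_eq_square mult_ac)
qed

lemma edges_at: "{e \<in> edges G. v \<in> e} = (\<lambda>w. {v, w}) ` N v"
proof
  show "{e \<in> edges G. v \<in> e} \<subseteq> (\<lambda>w. {v, w}) ` N v"
  proof
    fix e assume e: "e \<in> {e \<in> edges G. v \<in> e}"
    then obtain a b where "e = {a, b}" "b \<in> N a" using edge_cases[OF sg, of e] by blast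
    then show "e \<in> (\<lambda>w. {v, w}) ` N v" using e nbr_sym[of a G b] by auto
  qed
qed (auto simp: nbr_def)

text \<open>If \<open>v\<close> could trade its neighbourhood for a heavier set \<open>L\<close> without increasing the spectral
  radius, then \<open>x\<close> would also maximise the Rayleigh quotient of the new graph, and the two
  eigenvalue equations at \<open>v\<close> would clash. This needs no positivity of \<open>x v\<close>.\<close>

lemma rewire_weight:
  assumes v: "v \<in> V - L" and L: "L \<subseteq> V" and opt: "rho (rewire G v L) \<le> l"
  shows "(\<Sum>w\<in>L. x w) \<le> (\<Sum>u\<in>N v. x u)"
proof (rule ccontr)
  assume "\<not> ?thesis"
  then have lt: "(\<Sum>u\<in>N v. x u) < (\<Sum>w\<in>L. x w)" by simp
  let ?G = "rewire G v L"
  have sG: "simple_graph ?G" by (rule simple_rewire[OF sg v L])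
  have VG: "verts ?G = V" by (simp add: rewire_def)
  have fL: "finite L" using L fV finite_subset by blast
  have fE: "finite (edges G)" using sg by (rule finite_edges)
  have vL: "v \<notin> L" using v by blast
  have nb: "nbr ?G v = L" using v by (auto simp: rewire_def nbr_def doubleton_eq_iff)
  have "(\<Sum>e\<in>edges ?G. \<Prod>u\<in>e. x u) = (\<Sum>e\<in>{e \<in> edges G. v \<notin> e}. \<Prod>u\<in>e. x u) + x v * (\<Sum>w\<in>L. x w)"
    unfolding rewire_def graph.sel
    using fE fL sum_star[OF vL, of x] by (subst sum.union_disjoint) auto
  moreover have "(\<Sum>e\<in>edges G. \<Prod>u\<in>e. x u) =
      (\<Sum>e\<in>{e \<in> edges G. v \<notin> e}. \<Prod>u\<in>e. x u) + x v * (\<Sum>u\<in>N v. x u)"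
  proof -
    have "edges G = {e \<in> edges G. v \<notin> e} \<union> (\<lambda>w. {v, w}) ` N v" using edges_at[of v] by blast
    then have "(\<Sum>e\<in>edges G. \<Prod>u\<in>e. x u) =
       (\<Sum>e\<in>{e \<in> edges G. v \<notin> e} \<union> (\<lambda>w. {v, w}) ` N v. \<Prod>u\<in>e. x u)" by simp
    also have "\<dots> = (\<Sum>e\<in>{e \<in> edges G. v \<notin> e}. \<Prod>u\<in>e. x u) + (\<Sum>e\<in>(\<lambda>w. {v, w}) ` N v. \<Prod>u\<in>e. x u)"
      using fE fN by (intro sum.union_disjoint) auto
    finally show ?thesis using sum_star[OF not_in_nbr_self[OF sg, of v]] by simp
  qed
  moreover have "x v * (\<Sum>u\<in>N v. x u) \<le> x v * (\<Sum>w\<in>L. x w)"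
    using lt x_nonneg by (intro mult_left_mono) auto
  ultimately have "qform (adj ?G) V x \<ge> qform (adj G) V x"
    using qform_adj[OF sG, of x] qform_adj[OF sg, of x] by (simp add: VG)
  moreover have "qform (adj ?G) V y \<le> l * (\<Sum>u\<in>V. (y u)\<^sup>2)" for y
    using qform_le_rho[OF sG, of y] mult_right_mono[OF opt, of "\<Sum>u\<in>V. (y u)\<^sup>2"]
    by (simp add: VG sum_nonneg)
  ultimately have "(\<Sum>u\<in>V. adj ?G v u * x u) = l * x v"
    using v qform_perron by (intro qform_maximizer_eigenvector[OF fV _ adj_sym]) auto
  then have "(\<Sum>w\<in>L. x w) = l * x v" using sum_adj[OF sG, of v x] by (simp add: VG nb)
  then show False using lt eigen v by simp
qed

text \<open>A vertex not joined to all of \<open>L\<close> misses an entry near 1 there, yet by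
  \<open>rewire_weight\<close> its neighbours weigh at least as much as \<open>L\<close>. Fewer than
  \<open>t\<close> of its neighbours are outside \<open>L\<close> and joined to all of
  \<open>L\<close>, and these have small entries. The deficit would thus have to come from other
  vertices that are not fully joined; for a light one among them this is impossible.\<close>

lemma dominant_set_joined:
  assumes L: "L \<subseteq> V" "card L = k" and xL: "\<And>v. v \<in> L \<Longrightarrow> x v \<ge> 1 - \<theta>"
    and deg: "\<And>v. v \<in> L \<Longrightarrow> (1 - 2 * \<theta>) * real n \<le> real (card (N v))"
    and small: "\<And>v. v \<in> V - L \<Longrightarrow> x v \<le> 6 * real k * \<theta>"
    and \<theta>: "\<theta> > 0" "256 * C * real k ^ 3 * \<theta> \<le> 1" "14 * real (k * t) * \<theta> \<le> 1"
    and opt: "\<And>v. v \<in> V - L \<Longrightarrow> \<not> L \<subseteq> N v \<Longrightarrow> rho (rewire G v L) \<le> l"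
    and v: "v \<in> V - L"
  shows "L \<subseteq> N v"
proof (rule ccontr)
  assume nv: "\<not> L \<subseteq> N v"
  define E where "E = {v \<in> V - L. \<not> L \<subseteq> N v}"
  have EV: "E \<subseteq> V" by (auto simp: E_def)
  have fL: "finite L" using L fV finite_subset by blast
  have k1: "real k \<ge> 1" using k by simp
  obtain u where u: "u \<in> E" "(\<Sum>w\<in>N u \<inter> E. x w) \<le> sqrt (4 * C * real (card E)) * x u"
    using light_vertex_exists[OF EV] v nv by (auto simp: E_def)
  have uV: "u \<in> V" "u \<notin> L" "\<not> L \<subseteq> N u" using u(1) by (auto simp: E_def)
  have "E \<subseteq> V - common G L" by (auto simp: E_def common_def)
  then have "real (card E) \<le> real (card (V - common G L))" using fV by (intro of_nat_mono card_mono) auto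
  also have "\<dots> \<le> real k * (2 * \<theta> * real n)" using card_not_common[OF L(1) deg] L(2) by simp
  finally have "4 * C * real (card E) \<le> 4 * C * (real k * (2 * \<theta> * real n))"
    using C by (intro mult_left_mono) auto
  also have "\<dots> = 16 * C * \<theta> * (real k * real n / 2)" by simp
  also have "\<dots> \<le> 16 * C * \<theta> * l\<^sup>2" using half_n_le C \<theta>(1) by (intro mult_left_mono) auto
  \<comment> \<open>This is where the constant 256 in the condition on \<open>\<theta>\<close> comes
    from: \<open>16 * C * \<theta>\<close> has to be at most
    \<open>1 / (16 * k\<^sup>2)\<close>.\<close>
  also have "\<dots> \<le> (l / (4 * real k))\<^sup>2"
  proof -
    have "256 * C * real k ^ 2 * \<theta> \<le> 256 * C * real k ^ 3 * \<theta>"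
      using C k1 \<theta>(1) by (intro mult_right_mono mult_left_mono power_increasing) auto
    then have "256 * C * real k ^ 2 * \<theta> * l\<^sup>2 \<le> 1 * l\<^sup>2" using \<theta>(2) by (intro mult_right_mono) auto
    then show ?thesis using k1 by (simp add: power_divide power_mult_distrib field_simps)
  qed
  finally have "sqrt (4 * C * real (card E)) \<le> sqrt ((l / (4 * real k))\<^sup>2)" by (rule real_sqrt_le_mono)
  then have sq: "sqrt (4 * C * real (card E)) \<le> l / (4 * real k)" using rho_nonneg k1 by simp
  define s where "s = (\<Sum>w\<in>L. x w)"
  have "s \<le> (\<Sum>w\<in>L. 1)" unfolding s_def using x_le_1 L(1) by (intro sum_mono) blast
  then have sk: "s \<le> real k" using L(2) by simp
  have s_le: "s \<le> l * x u"
    using rewire_weight[OF _ L(1) opt] eigen uV by (simp add: s_def)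
  obtain w0 where w0: "w0 \<in> L" "w0 \<notin> N u" using uV(3) by blast
  have pL: "(\<Sum>w\<in>N u \<inter> L. x w) \<le> s - (1 - \<theta>)"
  proof -
    have "(\<Sum>w\<in>N u \<inter> L. x w) \<le> (\<Sum>w\<in>L - {w0}. x w)"
      using w0 fL x_nonneg by (intro sum_mono2) auto
    also have "\<dots> = s - x w0" unfolding s_def using sum.remove[OF fL w0(1), of x] by simp
    finally show ?thesis using xL[OF w0(1)] by simp
  qed
  have pE: "(\<Sum>w\<in>N u \<inter> E. x w) \<le> l / (4 * real k) * x u"
    using u(2) mult_right_mono[OF sq x_nonneg[of u]] by simp
  have pR: "(\<Sum>w\<in>N u - L - E. x w) \<le> 6 * real (k * t) * \<theta>"
  proof -
    have sub: "N u - L - E \<subseteq> common G (insert u L)"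
      using NV[of u] by (auto simp: E_def common_def nbr_sym[of u])
    have "card (N u - L - E) \<le> card (common G (insert u L))"
      using sub fV by (intro card_mono) (auto simp: common_def)
    also have "\<dots> < t" using uV L fL by (intro no_K) auto
    finally have c: "card (N u - L - E) \<le> t" by simp
    have "(\<Sum>w\<in>N u - L - E. x w) \<le> (\<Sum>w\<in>N u - L - E. 6 * real k * \<theta>)"
      using small NV[of u] by (intro sum_mono) blast
    also have "\<dots> = real (card (N u - L - E)) * (6 * real k * \<theta>)" by simp
    also have "\<dots> \<le> real t * (6 * real k * \<theta>)" using c \<theta>(1) by (intro mult_right_mono) auto
    finally show ?thesis by (simp add: mult_ac)
  qed
  have "(\<Sum>w\<in>N u. x w) = (\<Sum>w\<in>N u \<inter> L. x w) + (\<Sum>w\<in>N u - L. x w)"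
    by (rule sum.Int_Diff[OF fN])
  also have "(\<Sum>w\<in>N u - L. x w) = (\<Sum>w\<in>(N u - L) \<inter> E. x w) + (\<Sum>w\<in>N u - L - E. x w)"
    by (rule sum.Int_Diff) (simp add: fN)
  also have "(N u - L) \<inter> E = N u \<inter> E" by (auto simp: E_def)
  finally have main: "l * x u \<le> s - (1 - \<theta>) + l / (4 * real k) * x u + 6 * real (k * t) * \<theta>"
    using pL pE pR eigen uV(1) by simp
  have "1 * \<theta> \<le> real (k * t) * \<theta>"
    using k t \<theta>(1) mult_le_mono[of 1 k 1 t] by (intro mult_right_mono) linarith+
  \<comment> \<open>The error \<open>\<theta> + 6 * k * t * \<theta>\<close> is at most
    \<open>7 * k * t * \<theta>\<close>, hence at most 1/2 by the condition with constant
    14.\<close>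
  then have m2: "l * x u - l * x u / (4 * real k) \<le> s - 1 / 2" using main \<theta>(3) by simp
  have "s * (1 - 1 / (4 * real k)) \<le> l * x u * (1 - 1 / (4 * real k))"
    using s_le k1 by (intro mult_right_mono) (auto simp: field_simps)
  then have "s - s / (4 * real k) \<le> s - 1 / 2" using m2 by (simp add: algebra_simps)
  moreover have "s / (4 * real k) \<le> 1 / 4" using sk k1 by (simp add: field_simps)
  ultimately show False by simp
qed

end

section \<open>Joins and forbidden families\<close>

definition map_graph :: "('a \<Rightarrow> 'b) \<Rightarrow> 'a graph \<Rightarrow> 'b graph" where
  "map_graph f G = Graph (f ` verts G) ((`) f ` edges G)"

lemma simple_map_graph:
  assumes "simple_graph G" "inj_on f (verts G)"
  shows "simple_graph (map_graph f G)"
  unfolding simple_graph_def map_graph_def graph.sel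
proof (intro conjI subsetI)
  show "finite (f ` verts G)" using assms(1) by (simp add: simple_graphD(1))
  fix e assume "e \<in> (`) f ` edges G"
  then obtain e' where e': "e' \<in> edges G" "e = f ` e'" by auto
  then have "e' \<subseteq> verts G" "card e' = 2" using simple_graphD[OF assms(1)] by auto
  then show "e \<in> {e. e \<subseteq> f ` verts G \<and> card e = 2}"
    using e' inj_on_subset[OF assms(2), of e'] by (auto simp: card_image)
qed

lemma inj_on_image_edges:
  assumes "simple_graph G" "inj_on f (verts G)"
  shows "inj_on ((`) f) (edges G)"
proof (rule inj_onI)
  fix a b assume "a \<in> edges G" "b \<in> edges G" "f ` a = f ` b"
  then show "a = b" using assms inj_on_image_eq_iff simple_graphD(2) by metis
qed

lemma contains_trans:
  assumes "contains G H" "contains H K" "\<And>e. e \<in> edges K \<Longrightarrow> e \<subseteq> verts K"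
  shows "contains G K"
proof -
  obtain f where f: "inj_on f (verts H)" "f ` verts H \<subseteq> verts G" "\<forall>e\<in>edges H. f ` e \<in> edges G"
    using assms(1) by (auto simp: contains_def)
  obtain g where g: "inj_on g (verts K)" "g ` verts K \<subseteq> verts H" "\<forall>e\<in>edges K. g ` e \<in> edges H"
    using assms(2) by (auto simp: contains_def)
  have "inj_on (f \<circ> g) (verts K)" using f g by (meson comp_inj_on inj_on_subset)
  moreover have "(f \<circ> g) ` verts K \<subseteq> verts G" using f g by fastforce
  moreover have "(f \<circ> g) ` e \<in> edges G" if "e \<in> edges K" for e
    using f g that by (metis image_comp)
  ultimately show ?thesis unfolding contains_def by blast
qed

lemma contains_map_graph:
  assumes "simple_graph G" "inj_on f (verts G)"
  shows "contains G (map_graph f G)"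
proof -
  let ?g = "the_inv_into (verts G) f"
  have "?g ` (f ` e) = e" if "e \<subseteq> verts G" for e
    using that assms(2) by (force simp: image_image the_inv_into_f_f subset_iff)
  then show ?thesis
    unfolding contains_def map_graph_def graph.sel
    using assms inj_on_the_inv_into[of f "verts G"] simple_graphD(2)[OF assms(1)]
    by (intro exI[of _ ?g]) (auto simp: the_inv_into_f_f)
qed

lemma contains_mono:
  assumes "contains G H" "verts G \<subseteq> verts G'" "edges G \<subseteq> edges G'"
  shows "contains G' H"
  using assms unfolding contains_def by (meson subset_eq subset_trans)

lemma free_of_contains:
  assumes "free_of \<F> G" "contains G H" "\<And>F. F \<in> \<F> \<Longrightarrow> simple_graph F"
  shows "free_of \<F> H"
  using assms contains_trans simple_graphD(2) unfolding free_of_def by metis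

lemma card_edges_le_square:
  assumes "simple_graph G"
  shows "card (edges G) \<le> card (verts G) * card (verts G)"
proof -
  have "edges G \<subseteq> (\<lambda>(u, v). {u, v}) ` (verts G \<times> verts G)"
  proof
    fix e assume "e \<in> edges G"
    then obtain u v where "e = {u, v}" "u \<in> verts G" "v \<in> verts G" by (rule edge_cases[OF assms])
    then show "e \<in> (\<lambda>(u, v). {u, v}) ` (verts G \<times> verts G)" by auto
  qed
  then have "card (edges G) \<le> card ((\<lambda>(u, v). {u, v}) ` (verts G \<times> verts G))"
    using simple_graphD(1)[OF assms] by (intro card_mono) auto
  also have "\<dots> \<le> card (verts G \<times> verts G)"
    using simple_graphD(1)[OF assms] by (intro card_image_le) auto
  finally show ?thesis by (simp add: card_cartesian_product)
qed

lemma finite_edge_counts: "A \<subseteq> free_graphs n \<F> \<Longrightarrow> finite ((\<lambda>G. card (edges G)) ` A)"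
  by (rule finite_subset[of _ "{..n * n}"]) (auto simp: free_graphs_def dest!: card_edges_le_square)

lemma card_edges_le_ex_num: "G \<in> free_graphs n \<F> \<Longrightarrow> card (edges G) \<le> ex_num n \<F>"
  unfolding ex_num_def by (intro Max_ge finite_edge_counts) auto

lemma card_edges_le_ex_containing:
  "G \<in> free_graphs n \<F> \<Longrightarrow> contains G H \<Longrightarrow> card (edges G) \<le> ex_containing H n \<F>"
  unfolding ex_containing_def by (intro Max_ge finite_edge_counts) auto

lemma ex_containing_attained:
  assumes "G \<in> free_graphs n \<F>" "contains G H"
  obtains G' where "G' \<in> free_graphs n \<F>" "contains G' H" "card (edges G') = ex_containing H n \<F>"
proof -
  have "ex_containing H n \<F> \<in> (\<lambda>G. card (edges G)) ` {G \<in> free_graphs n \<F>. contains G H}"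
    unfolding ex_containing_def using assms by (intro Max_in finite_edge_counts) auto
  then show ?thesis using that by auto
qed

definition cross :: "'a set \<Rightarrow> 'a set \<Rightarrow> 'a set set" where
  "cross L R = {{u, v} | u v. u \<in> L \<and> v \<in> R}"

definition joined :: "'a graph \<Rightarrow> 'a set \<Rightarrow> bool" where
  "joined G L \<longleftrightarrow> L \<subseteq> verts G \<and> cross L (verts G - L) \<subseteq> edges G"

lemma joined_edge: "joined G L \<Longrightarrow> u \<in> L \<Longrightarrow> v \<in> verts G \<Longrightarrow> v \<notin> L \<Longrightarrow> {u, v} \<in> edges G"
  unfolding joined_def cross_def by blast

definition core_edges :: "'a graph \<Rightarrow> 'a set \<Rightarrow> 'a set set" where
  "core_edges G L = {e \<in> edges G. e \<subseteq> L}"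

definition rest_edges :: "'a graph \<Rightarrow> 'a set \<Rightarrow> 'a set set" where
  "rest_edges G L = {e \<in> edges G. e \<inter> L = {}}"

definition join_on :: "'a set \<Rightarrow> 'a set \<Rightarrow> 'a set set \<Rightarrow> 'a set set \<Rightarrow> 'a graph" where
  "join_on V L A B = Graph V (A \<union> cross L (V - L) \<union> B)"

lemma edges_joined:
  assumes "simple_graph G" "joined G L"
  shows "edges G = core_edges G L \<union> cross L (verts G - L) \<union> rest_edges G L"
proof
  show "edges G \<subseteq> core_edges G L \<union> cross L (verts G - L) \<union> rest_edges G L"
  proof
    fix e assume e: "e \<in> edges G"
    then obtain u v where uv: "e = {u, v}" "u \<in> verts G" "v \<in> verts G" by (rule edge_cases[OF assms(1)])
    then show "e \<in> core_edges G L \<union> cross L (verts G - L) \<union> rest_edges G L"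
      using e by (auto simp: core_edges_def rest_edges_def cross_def insert_commute)
  qed
qed (use assms(2) in \<open>auto simp: joined_def core_edges_def rest_edges_def\<close>)

lemma join_on_joined:
  assumes "simple_graph G" "joined G L"
  shows "join_on (verts G) L (core_edges G L) (rest_edges G L) = G"
  using edges_joined[OF assms] by (cases G) (simp add: join_on_def)

lemma joined_join_on: "L \<subseteq> V \<Longrightarrow> joined (join_on V L A B) L"
  by (auto simp: joined_def join_on_def)

lemma card_cross:
  assumes "finite L" "finite R" "L \<inter> R = {}"
  shows "card (cross L R) = card L * card R" "finite (cross L R)"
proof -
  have eq: "cross L R = (\<lambda>(u, v). {u, v}) ` (L \<times> R)" by (auto simp: cross_def)
  have "inj_on (\<lambda>(u, v). {u, v}) (L \<times> R)" using assms(3) by (auto simp: inj_on_def doubleton_eq_iff)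
  then show "card (cross L R) = card L * card R"
    unfolding eq by (simp add: card_image card_cartesian_product)
  show "finite (cross L R)" unfolding eq using assms by auto
qed

lemma sum_join_on:
  fixes g :: "'a set \<Rightarrow> 'b :: comm_monoid_add"
  assumes "finite V" "L \<subseteq> V" "A \<subseteq> Pow L" "B \<subseteq> Pow (V - L)" "{} \<notin> A"
  shows "(\<Sum>e\<in>edges (join_on V L A B). g e) =
    (\<Sum>e\<in>A. g e) + (\<Sum>e\<in>cross L (V - L). g e) + (\<Sum>e\<in>B. g e)"
proof -
  have fL: "finite L" using assms finite_subset by blast
  have fin: "finite A" "finite B" "finite (cross L (V - L))"
    using assms(1,3,4) fL finite_subset[of A "Pow L"] finite_subset[of B "Pow (V - L)"] card_cross(2)[of L "V - L"]
    by auto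
  have 1: "A \<inter> cross L (V - L) = {}" using assms(3) by (fastforce simp: cross_def)
  have 2: "cross L (V - L) \<inter> B = {}" using assms(4) by (fastforce simp: cross_def)
  have 3: "A \<inter> B = {}"
  proof (rule ccontr)
    assume "A \<inter> B \<noteq> {}"
    then obtain e where "e \<in> A" "e \<in> B" by blast
    then have "e = {}" using assms(3,4) by blast
    then show False using \<open>e \<in> A\<close> assms(5) by blast
  qed
  show ?thesis
    unfolding join_on_def graph.sel using fin 1 2 3
    by (subst sum.union_disjoint, auto)+
qed

lemma sum_joined:
  fixes g :: "'a set \<Rightarrow> 'b :: comm_monoid_add"
  assumes "simple_graph G" "joined G L"
  shows "(\<Sum>e\<in>edges G. g e) =
    (\<Sum>e\<in>core_edges G L. g e) + (\<Sum>e\<in>cross L (verts G - L). g e) + (\<Sum>e\<in>rest_edges G L. g e)"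
proof -
  have "(\<Sum>e\<in>edges (join_on (verts G) L (core_edges G L) (rest_edges G L)). g e) =
    (\<Sum>e\<in>core_edges G L. g e) + (\<Sum>e\<in>cross L (verts G - L). g e) + (\<Sum>e\<in>rest_edges G L. g e)"
  proof (rule sum_join_on)
    show "rest_edges G L \<subseteq> Pow (verts G - L)"
      using simple_graphD(2)[OF assms(1)] by (auto simp: rest_edges_def)
    show "{} \<notin> core_edges G L" using simple_graphD(3)[OF assms(1)] by (force simp: core_edges_def)
  qed (use assms simple_graphD(1) in \<open>auto simp: joined_def core_edges_def\<close>)
  then show ?thesis by (simp add: join_on_joined[OF assms])
qed

lemma card_edges_joined:
  assumes "simple_graph G" "joined G L" "card (verts G) = n" "card L = k"
  shows "card (edges G) = card (core_edges G L) + k * (n - k) + card (rest_edges G L)"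
proof -
  have fL: "finite L" "L \<subseteq> verts G" using assms simple_graphD(1) finite_subset by (auto simp: joined_def)
  have "card (cross L (verts G - L)) = k * (n - k)"
    using fL assms simple_graphD(1)[OF assms(1)] by (subst card_cross) (auto simp: card_Diff_subset)
  then show ?thesis using sum_joined[OF assms(1,2), of "\<lambda>_. 1 :: nat"] by simp
qed

text \<open>The complement of a covering is independent, so only the part on \<open>S\<close> has to
  be embedded with care; the remaining vertices may go anywhere in \<open>W\<close>.\<close>

lemma contains_by_covering:
  assumes A: "simple_graph A" "covering A S"
    and f: "inj_on f S" "f ` S \<subseteq> L" "\<And>e. e \<in> edges A \<Longrightarrow> e \<subseteq> S \<Longrightarrow> f ` e \<in> edges G"
    and L: "L \<subseteq> verts G" "W \<subseteq> verts G" "L \<inter> W = {}" "finite W" "card (verts A - S) \<le> card W"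
    and full: "\<And>u w. u \<in> L \<Longrightarrow> w \<in> W \<Longrightarrow> {u, w} \<in> edges G"
  shows "contains G A"
proof -
  have "finite (verts A - S)" using A simple_graphD(1) by blast
  then obtain g where g: "inj_on g (verts A - S)" "g ` (verts A - S) \<subseteq> W"
    using card_le_inj[of "verts A - S" W] L by blast
  define h where "h a = (if a \<in> S then f a else g a)" for a
  have hS: "h a = f a" "h a \<in> L" if "a \<in> S" for a using that f by (auto simp: h_def)
  have hR: "h a = g a" "h a \<in> W" if "a \<in> verts A" "a \<notin> S" for a using that g by (auto simp: h_def)
  have "inj_on h (verts A)"
  proof (rule inj_onI)
    fix a b assume ab: "a \<in> verts A" "b \<in> verts A" "h a = h b"
    show "a = b"
    proof (cases "a \<in> S"; cases "b \<in> S")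
      assume "a \<in> S" "b \<in> S"
      then show ?thesis using ab f(1) hS by (metis inj_onD)
    next
      assume "a \<notin> S" "b \<notin> S"
      then show ?thesis using ab g(1) hR by (metis DiffI inj_onD)
    next
      assume "a \<in> S" "b \<notin> S"
      then show ?thesis using ab hS(2)[of a] hR(2)[of b] L(3) by auto
    next
      assume "a \<notin> S" "b \<in> S"
      then show ?thesis using ab hS(2)[of b] hR(2)[of a] L(3) by auto
    qed
  qed
  moreover have "h ` verts A \<subseteq> verts G" using hS hR L(1,2) by blast
  moreover have "h ` e \<in> edges G" if e: "e \<in> edges A" for e
  proof (cases "e \<subseteq> S")
    case True
    then have "h ` e = f ` e" using hS by (intro image_cong) auto
    then show ?thesis using f(3) e True by simp
  next
    case False
    obtain a b where ab: "e = {a, b}" "a \<in> verts A" "b \<in> verts A" using e by (rule edge_cases[OF A(1)])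
    have "e \<inter> S \<noteq> {}" using A(2) e by (auto simp: covering_def)
    then consider "a \<in> S" "b \<notin> S" | "b \<in> S" "a \<notin> S" using False ab by blast
    then show ?thesis
    proof cases
      case 1 then show ?thesis using full[OF hS(2)[of a] hR(2)[of b]] ab by simp
    next
      case 2 then show ?thesis using full[OF hS(2)[of b] hR(2)[of a]] ab by (simp add: insert_commute)
    qed
  qed
  ultimately show ?thesis unfolding contains_def by blast
qed

lemma complete_bipartite_graph_eq_join:
  "complete_bipartite_graph s m = graph_join (edgeless_graph s) (edgeless_graph m)"
  by (auto simp: complete_bipartite_graph_def graph_join_def edgeless_graph_def)

lemma joined_contains_join:
  assumes G: "simple_graph G" "joined G L" "card (verts G - L) = m"
    and \<phi>: "inj_on \<phi> (verts T)" "\<phi> ` verts T \<subseteq> L" "\<And>e. e \<in> edges T \<Longrightarrow> \<phi> ` e \<in> edges G"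
  shows "contains G (graph_join T (edgeless_graph m))"
proof -
  have "finite (verts G - L)" using G simple_graphD(1) by blast
  then obtain h where h: "bij_betw h {..<m} (verts G - L)"
    using ex_bij_betw_nat_finite[of "verts G - L"] G(3) by (auto simp: lessThan_atLeast0)
  then have hR: "h i \<in> verts G" "h i \<notin> L" if "i < m" for i using that by (auto simp: bij_betw_def)
  have LV: "L \<subseteq> verts G" using G(2) by (simp add: joined_def)
  define f where "f = case_sum \<phi> h"
  have "inj_on f (verts T <+> {..<m})"
  proof (rule inj_onI)
    fix a b assume ab: "a \<in> verts T <+> {..<m}" "b \<in> verts T <+> {..<m}" "f a = f b"
    show "a = b"
    proof (cases a; cases b)
      fix u v assume "a = Inl u" "b = Inl v"
      then show ?thesis using ab \<phi>(1) by (auto simp: f_def dest: inj_onD)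
    next
      fix u v assume "a = Inr u" "b = Inr v"
      then show ?thesis using ab h by (auto simp: f_def bij_betw_def dest: inj_onD)
    next
      fix u v assume "a = Inl u" "b = Inr v"
      then show ?thesis using ab \<phi>(2) hR(2)[of v] by (auto simp: f_def)
    next
      fix u v assume "a = Inr u" "b = Inl v"
      then show ?thesis using ab \<phi>(2) hR(2)[of u] by (auto simp: f_def)
    qed
  qed
  moreover have "f ` (verts T <+> {..<m}) \<subseteq> verts G"
    using subset_trans[OF \<phi>(2) LV] hR by (auto simp: f_def)
  moreover have "f ` e \<in> edges G" if e: "e \<in> edges (graph_join T (edgeless_graph m))" for e
  proof -
    from e consider e' where "e = Inl ` e'" "e' \<in> edges T"
      | u v where "e = {Inl u, Inr v}" "u \<in> verts T" "v < m"
      by (auto simp: graph_join_def edgeless_graph_def)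
    then show ?thesis
    proof cases
      case 1
      then have "f ` e = \<phi> ` e'" by (auto simp: f_def image_image)
      then show ?thesis using 1 \<phi>(3) by simp
    next
      case 2
      then have "f ` e = {\<phi> u, h v}" by (simp add: f_def)
      moreover have "{\<phi> u, h v} \<in> edges G"
        using joined_edge[OF G(2)] \<phi>(2) 2 hR[of v] by blast
      ultimately show ?thesis by simp
    qed
  qed
  ultimately show ?thesis
    unfolding contains_def by (intro exI[of _ f]) (auto simp: graph_join_def edgeless_graph_def)
qed

text \<open>The join has exactly as many vertices as \<open>G\<close>, so an embedding is onto: each
  vertex outside the image of \<open>T\<close> comes from the edgeless side and is adjacent to that
  whole image.\<close>

lemma contains_join_joined:
  assumes G: "simple_graph G" "card (verts G) = k + m" and T: "simple_graph T" "card (verts T) = k"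
    and "contains G (graph_join T (edgeless_graph m))"
  obtains L \<phi> where "joined G L" "card L = k" "bij_betw \<phi> (verts T) L"
    "\<And>e. e \<in> edges T \<Longrightarrow> \<phi> ` e \<in> edges G"
proof -
  obtain f where f: "inj_on f (verts T <+> {..<m})" "f ` (verts T <+> {..<m}) \<subseteq> verts G"
    and fe: "\<And>e. e \<in> edges (graph_join T (edgeless_graph m)) \<Longrightarrow> f ` e \<in> edges G"
    using assms(5) by (auto simp: contains_def graph_join_def edgeless_graph_def)
  have fV: "finite (verts G)" "finite (verts T)" using G T simple_graphD(1) by auto
  define L where "L = f ` Inl ` verts T"
  have "card (f ` (verts T <+> {..<m})) = card (verts G)"
    using f(1) fV G(2) T(2) by (simp add: card_image card_Plus)
  then have onto: "f ` (verts T <+> {..<m}) = verts G"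
    using f(2) fV by (intro card_subset_eq) auto
  have "bij_betw (f \<circ> Inl) (verts T) L"
    unfolding bij_betw_def L_def using f(1) by (auto simp: inj_on_def)
  moreover have "(f \<circ> Inl) ` e \<in> edges G" if "e \<in> edges T" for e
    using fe[of "Inl ` e"] that by (auto simp: graph_join_def image_comp)
  moreover have "joined G L"
    unfolding joined_def
  proof (intro conjI subsetI)
    show "v \<in> verts G" if "v \<in> L" for v using that f(2) by (auto simp: L_def)
    fix e assume "e \<in> cross L (verts G - L)"
    then obtain u v where uv: "e = {u, v}" "u \<in> L" "v \<in> verts G" "v \<notin> L" by (auto simp: cross_def)
    then obtain a where a: "a \<in> verts T" "u = f (Inl a)" by (auto simp: L_def)
    have "v \<in> f ` (verts T <+> {..<m})" using uv onto by simp
    then obtain i where i: "i < m" "v = f (Inr i)" using uv(4) by (auto simp: L_def)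
    have "{Inl a, Inr i} \<in> edges (graph_join T (edgeless_graph m))"
      using a i by (auto simp: graph_join_def edgeless_graph_def)
    then show "e \<in> edges G" using fe[of "{Inl a, Inr i}"] uv a i by simp
  qed
  moreover have "card L = k" using bij_betw_same_card[OF calculation(1)] T(2) by simp
  ultimately show ?thesis using that by blast
qed

lemma rewire_free:
  assumes G: "simple_graph G" "free_of \<F> G" and L: "L \<subseteq> verts G" "v \<in> verts G - L" "\<not> L \<subseteq> nbr G v"
    and t: "t < card (common G L)" "\<And>A. A \<in> \<F> \<Longrightarrow> simple_graph A \<and> card (verts A) \<le> t"
  shows "free_of \<F> (rewire G v L)"
  unfolding free_of_def
proof (intro ballI notI)
  fix A assume A: "A \<in> \<F>" and c: "contains (rewire G v L) A"
  then have sA: "simple_graph A" "card (verts A) \<le> t" using t(2) by auto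
  obtain f where f: "inj_on f (verts A)" "f ` verts A \<subseteq> verts G"
    "\<And>e. e \<in> edges A \<Longrightarrow> f ` e \<in> edges (rewire G v L)"
    using c by (auto simp: contains_def rewire_def)
  have "card (f ` verts A) < card (common G L)"
    using card_image_le[of "verts A" f] sA simple_graphD(1) t(1) by (metis le_less_trans le_trans)
  then have "\<not> common G L \<subseteq> f ` verts A"
    using sA simple_graphD(1) by (metis card_mono finite_imageI not_le)
  then obtain v' where v': "v' \<in> common G L" "v' \<notin> f ` verts A" by blast
  define h where "h a = (if f a = v then v' else f a)" for a
  have "inj_on h (verts A)"
    using f(1) v'(2) by (auto simp: inj_on_def h_def)
  moreover have "h ` verts A \<subseteq> verts G" using f(2) v'(1) by (auto simp: h_def common_def)
  moreover have "h ` e \<in> edges G" if e: "e \<in> edges A" for e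
  proof -
    have "f ` e \<in> edges (rewire G v L)" using f(3) e .
    then consider "f ` e \<in> edges G" "v \<notin> f ` e" | w where "w \<in> L" "f ` e = {v, w}"
      by (auto simp: rewire_def)
    then show ?thesis
    proof cases
      case 1
      then have "h ` e = f ` e" by (intro image_cong) (auto simp: h_def)
      then show ?thesis using 1 by simp
    next
      case 2
      have "w \<noteq> v" using 2 L by auto
      have "h ` e = (\<lambda>z. if z = v then v' else z) ` (f ` e)" by (auto simp: h_def)
      then have "h ` e = {v', w}" using 2 \<open>w \<noteq> v\<close> by auto
      moreover have "w \<in> nbr G v'" using v'(1) 2 by (auto simp: common_def)
      ultimately show ?thesis by (simp add: nbr_def)
    qed
  qed
  ultimately have "contains G A" unfolding contains_def by blast
  then show False using G(2) A by (auto simp: free_of_def)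
qed

section \<open>Freeness of joins for a degenerate family\<close>

locale degenerate_family =
  fixes \<F> :: "nat graph set" and k t :: nat
  assumes simple_F: "\<And>A. A \<in> \<F> \<Longrightarrow> simple_graph A"
    and size_F: "\<And>A. A \<in> \<F> \<Longrightarrow> card (verts A) \<le> t"
    and beta'_F: "beta'_fam \<F> = enat (k + 1)"
    and k: "k \<ge> 1" and t: "t \<ge> 1"
begin

lemma independent_covering_ge:
  assumes "A \<in> \<F>" "independent_covering A S"
  shows "k + 1 \<le> card S"
proof -
  have "beta'_fam \<F> \<le> beta' A" unfolding beta'_fam_def by (rule INF_lower[OF assms(1)])
  also have "\<dots> \<le> enat (card S)" unfolding beta'_def using assms(2) by (intro INF_lower) simp
  finally show ?thesis by (simp add: beta'_F)
qed

lemma independent_covering_exists: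
  obtains A S where "A \<in> \<F>" "independent_covering A S" "card S = k + 1"
proof -
  have "(INF A\<in>\<F>. beta' A) < enat (k + 2)" using beta'_F by (simp add: beta'_fam_def)
  then obtain A where A: "A \<in> \<F>" "beta' A < enat (k + 2)" by (auto simp: INF_less_iff)
  then obtain S where "independent_covering A S" "card S < k + 2"
    by (auto simp: beta'_def INF_less_iff)
  then show ?thesis using that[OF A(1)] independent_covering_ge[OF A(1)] by force
qed

text \<open>A member that attains \<open>\<beta>'\<close> has an independent covering of size
  \<open>k + 1\<close>, so it embeds into the complete bipartite graph with parts
  \<open>k + 1\<close> and \<open>t\<close>.\<close>

lemma no_K:
  assumes G: "simple_graph G" "free_of \<F> G" and S: "S \<subseteq> verts G" "card S = k + 1"
  shows "card (common G S) < t"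
proof (rule ccontr)
  assume "\<not> ?thesis"
  then have ge: "t \<le> card (common G S)" by simp
  obtain A S0 where A: "A \<in> \<F>" "independent_covering A S0" "card S0 = k + 1"
    by (rule independent_covering_exists)
  have fA: "finite (verts A)" using simple_F[OF A(1)] simple_graphD(1) by blast
  have S0: "S0 \<subseteq> verts A" using A(2) by (auto simp: independent_covering_def covering_def)
  obtain f where f: "bij_betw f S0 S"
    using finite_same_card_bij[of S0 S] S0 fA A(3) S finite_subset simple_graphD(1)[OF G(1)] by metis
  have "contains G A"
  proof (rule contains_by_covering[where f = f and S = S0 and L = S and W = "common G S"])
    show "covering A S0" using A(2) by (simp add: independent_covering_def)
    show "inj_on f S0" "f ` S0 \<subseteq> S" using f by (auto simp: bij_betw_def)
    show "f ` e \<in> edges G" if "e \<in> edges A" "e \<subseteq> S0" for e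
      using that A(2) by (auto simp: independent_covering_def)
    show "S \<inter> common G S = {}" using not_in_nbr_self[OF G(1)] by (auto simp: common_def)
    show "finite (common G S)" using simple_graphD(1)[OF G(1)] by (simp add: common_def)
    show "card (verts A - S0) \<le> card (common G S)"
      using card_mono[OF fA, of "verts A - S0"] size_F[OF A(1)] ge by fastforce
    show "{u, w} \<in> edges G" if "u \<in> S" "w \<in> common G S" for u w
      using that by (auto simp: common_def nbr_def insert_commute)
  qed (use S A simple_F in \<open>auto simp: common_def\<close>)
  then show False using G(2) A(1) by (auto simp: free_of_def)
qed

text \<open>A copy of \<open>F[S]\<close> in the core extends to a copy of \<open>F\<close>, since
  the vertices off the covering \<open>S\<close> can be taken from the fully joined outside.\<close>

lemma core_free:
  assumes G: "simple_graph G" "free_of \<F> G" "joined G L" and t': "t \<le> card (verts G - L)"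
  shows "free_of (M_fam \<F>) (induced G L)"
  unfolding free_of_def
proof (intro ballI notI)
  fix B assume "B \<in> M_fam \<F>" and c: "contains (induced G L) B"
  then obtain A S where A: "B = induced A S" "A \<in> \<F>" "covering A S" by (auto simp: M_fam_def)
  have fA: "finite (verts A)" using simple_F[OF A(2)] simple_graphD(1) by blast
  obtain f where f: "inj_on f S" "f ` S \<subseteq> L" "\<And>e. e \<in> edges A \<Longrightarrow> e \<subseteq> S \<Longrightarrow> f ` e \<in> edges G"
    using c A(1) by (auto simp: contains_def induced_def)
  have "contains G A"
  proof (rule contains_by_covering[OF simple_F[OF A(2)] A(3) f, where W = "verts G - L"])
    show "L \<subseteq> verts G" using G(3) by (simp add: joined_def)
    show "card (verts A - S) \<le> card (verts G - L)"
      using card_mono[OF fA, of "verts A - S"] size_F[OF A(2)] t' by fastforce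
    show "finite (verts G - L)" using simple_graphD(1)[OF G(1)] by simp
    show "{u, w} \<in> edges G" if "u \<in> L" "w \<in> verts G - L" for u w
      using joined_edge[OF G(3)] that by blast
  qed auto
  then show False using G(2) A(2) by (auto simp: free_of_def)
qed

text \<open>The outside spans no edges, so the part of a copy that falls into \<open>L\<close> is a
  covering; having at most \<open>k\<close> vertices, it induces a member of \<open>M_fam\<close> in
  the core.\<close>

lemma join_free:
  assumes L: "finite L" "card L \<le> k" and E: "\<And>e. e \<in> E \<Longrightarrow> e \<subseteq> L \<and> e \<noteq> {}"
    and M: "free_of (M_fam \<F>) (Graph L E)"
  shows "free_of \<F> (join_on V L E {})"
  unfolding free_of_def
proof (intro ballI notI)
  fix A assume A: "A \<in> \<F>" and c: "contains (join_on V L E {}) A"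
  then obtain f where f: "inj_on f (verts A)" "\<And>e. e \<in> edges A \<Longrightarrow> f ` e \<in> E \<union> cross L (V - L)"
    by (auto simp: contains_def join_on_def)
  define S where "S = {a \<in> verts A. f a \<in> L}"
  have "e \<inter> S \<noteq> {}" if e: "e \<in> edges A" for e
  proof -
    have "f ` e \<inter> L \<noteq> {}" using f(2)[OF e] E by (auto simp: cross_def)
    then show ?thesis using simple_graphD(2)[OF simple_F[OF A] e] by (auto simp: S_def)
  qed
  then have cov: "covering A S" by (auto simp: covering_def S_def)
  have injS: "inj_on f S" using f(1) by (rule inj_on_subset) (auto simp: S_def)
  have "card S \<le> card L" by (rule card_inj_on_le[OF injS _ L(1)]) (auto simp: S_def)
  then have "enat (card S) < beta'_fam \<F>" using L(2) by (simp add: beta'_F)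
  then have "induced A S \<in> M_fam \<F>" using A cov by (auto simp: M_fam_def)
  moreover have "contains (Graph L E) (induced A S)"
    unfolding contains_def induced_def graph.sel
  proof (intro exI[of _ f] conjI ballI)
    show "f ` S \<subseteq> L" by (auto simp: S_def)
    fix e assume e: "e \<in> {e \<in> edges A. e \<subseteq> S}"
    then have "f ` e \<subseteq> L" by (auto simp: S_def)
    moreover have "f ` e \<in> E \<union> cross L (V - L)" using f(2) e by blast
    ultimately show "f ` e \<in> E" by (auto simp: cross_def)
  qed (rule injS)
  ultimately show False using M by (auto simp: free_of_def)
qed

text \<open>A covering that induces no edge is independent and so has at least \<open>k + 1\<close>
  vertices, too many for \<open>M_fam\<close>. With \<open>join_free\<close> this admits the
  complete bipartite graph with parts \<open>k\<close> and \<open>n - k\<close>.\<close>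

lemma edgeless_free: "free_of (M_fam \<F>) (Graph L {})"
  unfolding free_of_def
proof (intro ballI notI)
  fix B assume "B \<in> M_fam \<F>" and c: "contains (Graph L {}) B"
  then obtain A S where A: "B = induced A S" "A \<in> \<F>" "covering A S" "card S < k + 1"
    by (auto simp: M_fam_def beta'_F)
  have "independent_covering A S" using c A by (auto simp: contains_def induced_def independent_covering_def)
  then show False using independent_covering_ge[OF A(2)] A(4) by force
qed

text \<open>When \<open>\<beta>'(\<F>) = \<beta>(\<F>)\<close> the family \<open>\<M>(\<F>)\<close> is empty, so on \<open>\<beta>'(\<F>) - 1\<close> vertices forbidding
  it is as vacuous as forbidding a complete graph on \<open>\<beta>'(\<F>)\<close> vertices.\<close>

lemma H_free_iff_M_free:
  assumes "finite (verts T)" "card (verts T) = k"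
  shows "free_of (H_fam \<F>) T \<longleftrightarrow> free_of (M_fam \<F>) T"
proof (cases "beta'_fam \<F> = beta_fam \<F>")
  case True
  have "M_fam \<F> = {}"
  proof (rule ccontr)
    assume "M_fam \<F> \<noteq> {}"
    then obtain A S where A: "A \<in> \<F>" "covering A S" "enat (card S) < beta'_fam \<F>"
      by (auto simp: M_fam_def)
    have "beta_fam \<F> \<le> beta A" unfolding beta_fam_def by (rule INF_lower[OF A(1)])
    also have "\<dots> \<le> enat (card S)" unfolding beta_def using A(2) by (intro INF_lower) simp
    finally show False using A(3) True by simp
  qed
  moreover have "\<not> contains T (complete_graph (k + 1))"
  proof
    assume "contains T (complete_graph (k + 1))"
    then obtain f where "inj_on f {..<k + 1}" "f ` {..<k + 1} \<subseteq> verts T"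
      by (auto simp: contains_def complete_graph_def)
    then have "card {..<k + 1} \<le> card (verts T)" using assms(1) card_inj_on_le by blast
    then show False using assms(2) by simp
  qed
  moreover have "H_fam \<F> = {complete_graph (k + 1)}"
    using True by (simp add: H_fam_def beta'_nat_def) (simp flip: True add: beta'_F)
  ultimately show ?thesis by (simp add: free_of_def)
qed (simp add: H_fam_def)

end

section \<open>Packings\<close>

definition copies :: "'a graph \<Rightarrow> nat \<Rightarrow> (nat \<times> 'a) graph" where
  "copies Q m = Graph ({..<m} \<times> verts Q) ((\<lambda>(i, e). {i} \<times> e) ` ({..<m} \<times> edges Q))"

lemma simple_copies:
  assumes "simple_graph Q"
  shows "simple_graph (copies Q m)"
  using assms by (auto simp: simple_graph_def copies_def card_cartesian_product)

lemma card_edges_copies: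
  assumes "simple_graph Q"
  shows "card (edges (copies Q m)) = m * card (edges Q)"
proof -
  have "inj_on (\<lambda>(i, e). {i} \<times> e) ({..<m} \<times> edges Q)"
  proof (rule inj_onI, clarify)
    fix i e j e' assume e: "e \<in> edges Q" "e' \<in> edges Q" "{i} \<times> e = {j} \<times> e'"
    have "e \<noteq> {}" "e' \<noteq> {}" using simple_graphD(3)[OF assms] e by force+
    then show "i = j \<and> e = e'" using e(3) by (auto simp: times_eq_iff)
  qed
  then show ?thesis by (simp add: copies_def card_image card_cartesian_product)
qed

lemma contains_copiesD:
  assumes "contains B (copies Q m)"
  obtains f where "inj_on f ({..<m} \<times> verts Q)" "f ` ({..<m} \<times> verts Q) \<subseteq> verts B"
    "\<And>i e. i < m \<Longrightarrow> e \<in> edges Q \<Longrightarrow> f ` ({i} \<times> e) \<in> edges B"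
  using assms by (force simp: contains_def copies_def)

lemma contains_copiesI:
  assumes "inj_on f ({..<m} \<times> verts Q)" "f ` ({..<m} \<times> verts Q) \<subseteq> verts B"
    "\<And>i e. i < m \<Longrightarrow> e \<in> edges Q \<Longrightarrow> f ` ({i} \<times> e) \<in> edges B"
  shows "contains B (copies Q m)"
  unfolding contains_def copies_def graph.sel using assms by (intro exI[of _ f]) auto

lemma contains_listI:
  assumes "distinct vs" "length vs = q" "set vs \<subseteq> verts B" "\<And>e. e \<in> E \<Longrightarrow> (!) vs ` e \<in> edges B"
  shows "contains B (Graph {..<q} E)"
  unfolding contains_def graph.sel
  using assms by (intro exI[of _ "(!) vs"]) (auto intro!: inj_on_nth dest: nth_mem)

text \<open>Take for \<open>X\<close> the vertices of a largest packing: a copy avoiding them would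
  enlarge it.\<close>

lemma greedy_packing:
  assumes B: "simple_graph B" and Q: "simple_graph Q" and "\<not> contains B (copies Q m)"
  shows "\<exists>X\<subseteq>verts B. card X \<le> m * card (verts Q) \<and> \<not> contains (induced B (verts B - X)) Q"
  using assms(3)
proof (induction m)
  case 0
  have "contains B (copies Q 0)" by (rule contains_copiesI) auto
  then show ?case using 0 by simp
next
  case (Suc m)
  show ?case
  proof (cases "contains B (copies Q m)")
    case False
    then show ?thesis using Suc.IH by (metis add_leD2 mult_Suc le_add2 le_trans)
  next
    case True
    then obtain f where f: "inj_on f ({..<m} \<times> verts Q)" "f ` ({..<m} \<times> verts Q) \<subseteq> verts B"
      "\<And>i e. i < m \<Longrightarrow> e \<in> edges Q \<Longrightarrow> f ` ({i} \<times> e) \<in> edges B" using contains_copiesD by metis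
    let ?X = "f ` ({..<m} \<times> verts Q)"
    have "card ?X \<le> Suc m * card (verts Q)"
      using f(1) by (simp add: card_image card_cartesian_product)
    moreover have "\<not> contains (induced B (verts B - ?X)) Q"
    proof
      assume "contains (induced B (verts B - ?X)) Q"
      then obtain g where g: "inj_on g (verts Q)" "g ` verts Q \<subseteq> verts B - ?X"
        "\<And>e. e \<in> edges Q \<Longrightarrow> g ` e \<in> edges B" by (auto simp: contains_def induced_def)
      define h where "h p = (if fst p < m then f p else g (snd p))" for p
      have hf: "h (i, a) = f (i, a)" "h (i, a) \<in> ?X" if "i < m" "a \<in> verts Q" for i a
        using that by (auto simp: h_def)
      have hg: "h (i, a) = g a" "h (i, a) \<in> verts B - ?X" if "\<not> i < m" "a \<in> verts Q" for i a
        using that g(2) by (auto simp: h_def)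
      have "contains B (copies Q (Suc m))"
      proof (rule contains_copiesI)
        show "inj_on h ({..<Suc m} \<times> verts Q)"
        proof (rule inj_onI, clarify)
          fix i a j b assume ij: "i < Suc m" "a \<in> verts Q" "j < Suc m" "b \<in> verts Q" and eq: "h (i, a) = h (j, b)"
          consider "i < m" "j < m" | "\<not> i < m" "\<not> j < m" | "i < m" "\<not> j < m" | "\<not> i < m" "j < m" by blast
          then show "i = j \<and> a = b"
          proof cases
            case 1 then show ?thesis using f(1) eq ij hf(1) by (auto dest: inj_onD)
          next
            case 2 then show ?thesis using g(1) eq ij hg(1) by (auto dest: inj_onD)
          next
            case 3 then show ?thesis using hf(2)[of i a] hg(2)[of j b] eq ij by auto
          next
            case 4 then show ?thesis using hf(2)[of j b] hg(2)[of i a] eq ij by auto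
          qed
        qed
        show "h ` ({..<Suc m} \<times> verts Q) \<subseteq> verts B"
        proof
          fix v assume "v \<in> h ` ({..<Suc m} \<times> verts Q)"
          then obtain i a where ia: "v = h (i, a)" "a \<in> verts Q" by auto
          then show "v \<in> verts B" using hf(2)[of i a] hg(2)[of i a] f(2) by (cases "i < m") auto
        qed
        fix i e assume i: "i < Suc m" and e: "e \<in> edges Q"
        show "h ` ({i} \<times> e) \<in> edges B"
        proof (cases "i < m")
          case True
          then have "h ` ({i} \<times> e) = f ` ({i} \<times> e)" by (intro image_cong) (auto simp: h_def)
          then show ?thesis using f(3) True e by simp
        next
          case False
          then have "h ` ({i} \<times> e) = g ` e" by (force simp: h_def)
          then show ?thesis using g(3) e by simp
        qed
      qed
      then show False using Suc.prems by simp
    qed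
    ultimately show ?thesis using f(2) by blast
  qed
qed

section \<open>Patterns on at most four vertices\<close>

definition "single_edge = Graph {..<2} {{0, 1 :: nat}}"
definition "path3 = Graph {..<3} {{0, 1}, {1, 2 :: nat}}"
definition "path4 = Graph {..<4} {{0, 1}, {1, 2}, {2, 3 :: nat}}"
definition "claw = Graph {..<4} {{0, 1}, {0, 2}, {0, 3 :: nat}}"
definition "tri3 = Graph {..<3} {{0, 1}, {1, 2}, {0, 2 :: nat}}"

lemmas pattern_defs = single_edge_def path3_def path4_def claw_def tri3_def

lemma simple_patterns:
  "simple_graph single_edge" "simple_graph path3" "simple_graph path4" "simple_graph claw"
  "simple_graph tri3"
  by (auto simp: simple_graph_def pattern_defs)

lemma card_edges_patterns:
  "card (edges single_edge) = 1" "card (edges path3) = 2" "card (edges path4) = 3"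
  "card (edges claw) = 3" "card (edges tri3) = 3"
  by (auto simp: pattern_defs doubleton_eq_iff card_insert_if)

lemma contains_path3I:
  assumes "simple_graph B" "a \<in> nbr B b" "c \<in> nbr B b" "a \<noteq> c"
  shows "contains B path3"
  unfolding path3_def
proof (rule contains_listI[where vs = "[a, b, c]"])
  show "distinct [a, b, c]" using assms not_in_nbr_self[OF assms(1)] by auto
  show "set [a, b, c] \<subseteq> verts B" using assms nbr_subset[OF assms(1)] nbr_sym[of a B b] by auto
qed (use assms in \<open>auto simp: nbr_def insert_commute\<close>)

lemma contains_K3I:
  assumes "simple_graph B" "a \<in> nbr B b" "c \<in> nbr B b" "c \<in> nbr B a"
  shows "contains B tri3"
  unfolding tri3_def
proof (rule contains_listI[where vs = "[a, b, c]"])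
  show "distinct [a, b, c]" using assms not_in_nbr_self[OF assms(1)] by auto
  show "set [a, b, c] \<subseteq> verts B" using assms nbr_subset[OF assms(1)] nbr_sym[of a B b] by auto
qed (use assms in \<open>auto simp: nbr_def insert_commute\<close>)

lemma contains_path4I:
  assumes "simple_graph B" "b \<in> nbr B a" "c \<in> nbr B b" "d \<in> nbr B c" "a \<noteq> c" "b \<noteq> d" "a \<noteq> d"
  shows "contains B path4"
  unfolding path4_def
proof (rule contains_listI[where vs = "[a, b, c, d]"])
  show "distinct [a, b, c, d]" using assms not_in_nbr_self[OF assms(1)] by auto
  show "set [a, b, c, d] \<subseteq> verts B" using assms nbr_subset[OF assms(1)] nbr_sym[of b B a] by auto
qed (use assms in \<open>auto simp: nbr_def insert_commute numeral_3_eq_3\<close>)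

lemma contains_clawI:
  assumes "simple_graph B" "{b, c, d} \<subseteq> nbr B a" "b \<noteq> c" "c \<noteq> d" "b \<noteq> d"
  shows "contains B claw"
  unfolding claw_def
proof (rule contains_listI[where vs = "[a, b, c, d]"])
  show "distinct [a, b, c, d]" using assms not_in_nbr_self[OF assms(1)] by auto
  show "set [a, b, c, d] \<subseteq> verts B" using assms nbr_subset[OF assms(1)] nbr_sym[of b B a] by auto
qed (use assms in \<open>auto simp: nbr_def insert_commute numeral_3_eq_3\<close>)

text \<open>Two distinct edges with a common vertex would form a path on three vertices, so the
  edges are pairwise disjoint and each is a copy of its own.\<close>

lemma matching_packing:
  assumes B: "simple_graph B" and no: "\<not> contains B path3"
  shows "contains B (copies single_edge (card (edges B)))"
proof -
  obtain h where h: "bij_betw h {..<card (edges B)} (edges B)"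
    using ex_bij_betw_nat_finite[OF finite_edges[OF B]] by (auto simp: lessThan_atLeast0)
  have "\<forall>e\<in>edges B. \<exists>p. e = {fst p, snd p} \<and> fst p \<noteq> snd p"
    using edge_cases[OF B] by (metis fst_conv snd_conv)
  then obtain p where p: "\<And>e. e \<in> edges B \<Longrightarrow> e = {fst (p e), snd (p e)} \<and> fst (p e) \<noteq> snd (p e)"
    by metis
  have disj: "e = e'" if e: "e \<in> edges B" "e' \<in> edges B" "a \<in> e" "a \<in> e'" for e e' a
  proof (rule ccontr)
    assume ne: "e \<noteq> e'"
    obtain b where b: "e = {a, b}" using p[OF e(1)] e(3) by (metis insert_commute insertE singletonD)
    obtain c where c: "e' = {a, c}" using p[OF e(2)] e(4) by (metis insert_commute insertE singletonD)
    have "b \<in> nbr B a" "c \<in> nbr B a" using e b c by (auto simp: nbr_def)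
    moreover have "b \<noteq> c" using ne b c by auto
    ultimately show False using contains_path3I[OF B] no by blast
  qed
  define f where "f q = (if snd q = (0 :: nat) then fst (p (h (fst q))) else snd (p (h (fst q))))" for q
  have he: "h i \<in> edges B" if "i < card (edges B)" for i using h that by (auto simp: bij_betw_def)
  have fe: "f (i, a) \<in> h i" if "i < card (edges B)" for i a
  proof -
    have "h i = {fst (p (h i)), snd (p (h i))}" using p[OF he[OF that]] by blast
    then show ?thesis unfolding f_def by (metis fst_conv snd_conv insertCI)
  qed
  have two: "verts single_edge = {0, 1}" by (auto simp: single_edge_def)
  show ?thesis
  proof (rule contains_copiesI[where f = f])
    show "inj_on f ({..<card (edges B)} \<times> verts single_edge)"
    proof (rule inj_onI, clarify)
      fix i a j b assume ij: "i < card (edges B)" "j < card (edges B)" "f (i, a) = f (j, b)"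
        and ab: "a \<in> verts single_edge" "b \<in> verts single_edge"
      have "h i = h j" using disj[OF he[OF ij(1)] he[OF ij(2)] fe[OF ij(1), of a]] fe[OF ij(2), of b] ij(3) by simp
      then have "i = j" using h ij by (auto simp: bij_betw_def dest: inj_onD)
      then show "i = j \<and> a = b" using ij(3) p[OF he[OF ij(1)]] ab by (auto simp: f_def two split: if_splits)
    qed
    show "f ` ({..<card (edges B)} \<times> verts single_edge) \<subseteq> verts B"
    proof clarify
      fix i a assume "i < card (edges B)"
      then show "f (i, a) \<in> verts B" using fe[of i a] he[of i] simple_graphD(2)[OF B, of "h i"] by blast
    qed
    fix i e assume i: "i < card (edges B)" and "e \<in> edges single_edge"
    then have "f ` ({i} \<times> e) = {fst (p (h i)), snd (p (h i))}" by (auto simp: single_edge_def f_def)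
    then show "f ` ({i} \<times> e) \<in> edges B" using p[OF he[OF i]] he[OF i] by metis
  qed
qed

text \<open>Without \<open>K\<^sub>3\<close>, \<open>P\<^sub>4\<close> and \<open>K\<^sub>1\<^sub>,\<^sub>3\<close> every component is an isolated vertex, an edge or a path on
  three vertices; the paths are counted by their middle vertices.\<close>

lemma cherry_packing:
  assumes B: "simple_graph B" and no: "\<not> contains B tri3" "\<not> contains B path4" "\<not> contains B claw"
  obtains m where "contains B (copies path3 m)" "2 * card (edges B) \<le> card (verts B) + m"
proof -
  have fB: "finite (verts B)" using B simple_graphD(1) by blast
  define D where "D = {v \<in> verts B. card (nbr B v) \<ge> 2}"
  have deg: "card (nbr B v) \<le> 2" for v
  proof (rule ccontr)
    assume "\<not> ?thesis"
    then have "3 \<le> card (nbr B v)" by simp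
    then obtain S where S: "S \<subseteq> nbr B v" "card S = 3" by (rule obtain_subset_with_card_n)
    then obtain a b c where "S = {a, b, c}" "a \<noteq> b" "b \<noteq> c" "a \<noteq> c" by (auto simp: card_3_iff)
    then show False using contains_clawI[OF B, of a b c v] S(1) no(3) by blast
  qed
  have "2 * real (card (edges B)) = (\<Sum>v\<in>verts B. real (card (nbr B v)))" using sum_degrees[OF B] by simp
  also have "\<dots> \<le> (\<Sum>v\<in>verts B. 1 + (if v \<in> D then 1 else 0))"
  proof (rule sum_mono)
    fix v assume "v \<in> verts B"
    then show "real (card (nbr B v)) \<le> 1 + (if v \<in> D then 1 else 0)"
      using deg[of v] by (cases "card (nbr B v) \<ge> 2") (auto simp: D_def)
  qed
  also have "\<dots> = real (card (verts B)) + real (card (verts B \<inter> D))"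
    using fB by (simp add: sum.distrib sum.If_cases)
  also have "verts B \<inter> D = D" by (auto simp: D_def)
  finally have le: "2 * card (edges B) \<le> card (verts B) + card D" by linarith
  have "\<forall>v\<in>D. \<exists>p. fst p \<in> nbr B v \<and> snd p \<in> nbr B v \<and> fst p \<noteq> snd p"
  proof
    fix v assume "v \<in> D"
    then have "2 \<le> card (nbr B v)" by (simp add: D_def)
    then obtain S where S: "S \<subseteq> nbr B v" "card S = 2" by (rule obtain_subset_with_card_n)
    then obtain a b where "S = {a, b}" "a \<noteq> b" by (auto simp: card_2_iff)
    then show "\<exists>p. fst p \<in> nbr B v \<and> snd p \<in> nbr B v \<and> fst p \<noteq> snd p"
      using S(1) by (intro exI[of _ "(a, b)"]) auto
  qed
  then obtain p where p: "\<And>v. v \<in> D \<Longrightarrow> fst (p v) \<in> nbr B v \<and> snd (p v) \<in> nbr B v \<and> fst (p v) \<noteq> snd (p v)"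
    by metis
  \<comment> \<open>Two adjacent vertices of degree at least 2 would close a triangle or extend to a
    path on four vertices.\<close>
  have cherry: "u \<notin> D" if v: "v \<in> D" and u: "u \<in> nbr B v" for u v
  proof
    assume "u \<in> D"
    obtain w where w: "w \<in> nbr B v" "w \<noteq> u" using p[OF v] by metis
    obtain y where y: "y \<in> nbr B u" "y \<noteq> v" using p[OF \<open>u \<in> D\<close>] by metis
    show False
    proof (cases "y = w")
      case True
      then show False using contains_K3I[OF B u w(1)] y no(1) by blast
    next
      case False
      have "v \<in> nbr B w" using w(1) by (simp add: nbr_sym)
      then show False using contains_path4I[OF B _ u y(1)] w y False no(2) by blast
    qed
  qed
  \<comment> \<open>Two middle vertices with a common leaf \<open>u\<close> would give the path
    \<open>w\<close>, \<open>v\<close>, \<open>u\<close>, \<open>v'\<close>.\<close>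
  have disj: "v = v'" if v: "v \<in> D" "v' \<in> D" and u: "u \<in> nbr B v" "u \<in> nbr B v'" for u v v'
  proof (rule ccontr)
    assume ne: "v \<noteq> v'"
    obtain w where w: "w \<in> nbr B v" "w \<noteq> u" using p[OF v(1)] by metis
    have "w \<noteq> v'" using cherry[OF v(1) w(1)] v(2) by blast
    moreover have "v \<in> nbr B w" "v' \<in> nbr B u" using w u by (auto simp: nbr_sym)
    ultimately show False using contains_path4I[OF B _ u(1), of w v'] w(2) ne no(2) by blast
  qed
  obtain h where h: "bij_betw h {..<card D} D"
    using ex_bij_betw_nat_finite[of D] fB by (auto simp: lessThan_atLeast0 D_def)
  have hD: "h i \<in> D" if "i < card D" for i using h that by (auto simp: bij_betw_def)
  define f where "f q = (if snd q = (0 :: nat) then fst (p (h (fst q)))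
    else if snd q = 1 then h (fst q) else snd (p (h (fst q))))" for q
  have three: "verts path3 = {0, 1, 2}" by (auto simp: path3_def)
  have fN: "f (i, a) = h i \<or> f (i, a) \<in> nbr B (h i)" if "i < card D" for i a
    using p[OF hD[OF that]] by (auto simp: f_def)
  have "contains B (copies path3 (card D))"
  proof (rule contains_copiesI[where f = f])
    show "inj_on f ({..<card D} \<times> verts path3)"
    proof (rule inj_onI, clarify)
      fix i a j b assume ij: "i < card D" "j < card D" "f (i, a) = f (j, b)"
        and ab: "a \<in> verts path3" "b \<in> verts path3"
      have "h i = h j"
        using fN[OF ij(1), of a] fN[OF ij(2), of b] ij(3) disj[OF hD[OF ij(1)] hD[OF ij(2)]]
          cherry[OF hD[OF ij(1)]] cherry[OF hD[OF ij(2)]] hD[OF ij(1)] hD[OF ij(2)] by metis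
      then have eq: "i = j" using h ij by (auto simp: bij_betw_def dest: inj_onD)
      have "fst (p (h i)) \<noteq> h i" "snd (p (h i)) \<noteq> h i" "fst (p (h i)) \<noteq> snd (p (h i))"
        using p[OF hD[OF ij(1)]] not_in_nbr_self[OF B] by metis+
      then show "i = j \<and> a = b" using ij(3) eq ab by (auto simp: f_def three split: if_splits)
    qed
    show "f ` ({..<card D} \<times> verts path3) \<subseteq> verts B"
    proof clarify
      fix i a assume i: "i < card D"
      show "f (i, a) \<in> verts B"
        using fN[OF i, of a] hD[OF i] nbr_subset[OF B, of "h i"] by (auto simp: D_def)
    qed
    fix i e assume i: "i < card D" and "e \<in> edges path3"
    then have "f ` ({i} \<times> e) = {h i, fst (p (h i))} \<or> f ` ({i} \<times> e) = {h i, snd (p (h i))}"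
      by (auto simp: path3_def f_def)
    then show "f ` ({i} \<times> e) \<in> edges B" using p[OF hD[OF i]] by (auto simp: nbr_def)
  qed
  then show ?thesis using that le by blast
qed

text \<open>A copy of a member of \<open>\<F>\<close> meets at most \<open>t\<close> of the copies of \<open>Q\<close>, so it survives when those
  copies are moved onto \<open>t\<close> disjoint copies of \<open>Q\<close> in \<open>G\<close>.\<close>

lemma replicate_free:
  assumes G: "simple_graph G" "free_of \<F> G" "joined G L"
    and F: "\<And>A. A \<in> \<F> \<Longrightarrow> simple_graph A \<and> card (verts A) \<le> t"
    and Q: "contains (induced G (verts G - L)) (copies Q t)"
    and B: "simple_graph B" "verts B = verts G - L" "contains (copies Q m) B"
  shows "free_of \<F> (join_on (verts G) L (core_edges G L) (edges B))"
  unfolding free_of_def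
proof (intro ballI notI)
  fix A assume A: "A \<in> \<F>" and c: "contains (join_on (verts G) L (core_edges G L) (edges B)) A"
  have sA: "simple_graph A" "card (verts A) \<le> t" using F[OF A] by auto
  have fA: "finite (verts A)" using sA simple_graphD(1) by blast
  obtain f where f: "inj_on f (verts A)" "f ` verts A \<subseteq> verts G"
    "\<And>e. e \<in> edges A \<Longrightarrow> f ` e \<in> core_edges G L \<union> cross L (verts G - L) \<union> edges B"
    using c by (auto simp: contains_def join_on_def)
  obtain \<psi> where \<psi>0: "inj_on \<psi> ({..<t} \<times> verts Q)"
    "\<psi> ` ({..<t} \<times> verts Q) \<subseteq> verts (induced G (verts G - L))"
    "\<And>i e. i < t \<Longrightarrow> e \<in> edges Q \<Longrightarrow> \<psi> ` ({i} \<times> e) \<in> edges (induced G (verts G - L))"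
    using contains_copiesD[OF Q] by metis
  have \<psi>: "inj_on \<psi> ({..<t} \<times> verts Q)" "\<psi> ` ({..<t} \<times> verts Q) \<subseteq> verts G - L"
    "\<And>i e. i < t \<Longrightarrow> e \<in> edges Q \<Longrightarrow> \<psi> ` ({i} \<times> e) \<in> edges G"
    using \<psi>0 by (auto simp: induced_def)
  obtain g where g: "inj_on g (verts B)" "g ` verts B \<subseteq> {..<m} \<times> verts Q"
    "\<And>e. e \<in> edges B \<Longrightarrow> g ` e \<in> (\<lambda>(i, e). {i} \<times> e) ` ({..<m} \<times> edges Q)"
    using B(3) by (auto simp: contains_def copies_def)
  define I where "I = (\<lambda>a. fst (g (f a))) ` {a \<in> verts A. f a \<notin> L}"
  have fin: "finite {a \<in> verts A. f a \<notin> L}" using fA by simp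
  have "card I \<le> card {a \<in> verts A. f a \<notin> L}" unfolding I_def by (rule card_image_le[OF fin])
  also have "\<dots> \<le> card (verts A)" using fA by (intro card_mono) auto
  finally have "card I \<le> card {..<t}" using sA by simp
  moreover have "finite I" using fin by (simp add: I_def)
  ultimately obtain \<sigma> where \<sigma>: "inj_on \<sigma> I" "\<sigma> ` I \<subseteq> {..<t}"
    using card_le_inj[of I "{..<t}"] by blast
  define h where "h a = (if f a \<in> L then f a else \<psi> (\<sigma> (fst (g (f a))), snd (g (f a))))" for a
  have B_of: "f a \<in> verts B" if "a \<in> verts A" "f a \<notin> L" for a using that f(2) B(2) by auto
  have idx: "(\<sigma> (fst (g (f a))), snd (g (f a))) \<in> {..<t} \<times> verts Q" "fst (g (f a)) \<in> I"
    if "a \<in> verts A" "f a \<notin> L" for a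
  proof -
    show I: "fst (g (f a)) \<in> I" using that by (auto simp: I_def)
    have "g (f a) \<in> {..<m} \<times> verts Q" using g(2) B_of[OF that] by blast
    then show "(\<sigma> (fst (g (f a))), snd (g (f a))) \<in> {..<t} \<times> verts Q" using I \<sigma>(2) by auto
  qed
  have hL: "h a = f a" if "f a \<in> L" for a using that by (simp add: h_def)
  have hR: "h a = \<psi> (\<sigma> (fst (g (f a))), snd (g (f a)))" "h a \<in> verts G - L" if "a \<in> verts A" "f a \<notin> L" for a
    using that idx[OF that] \<psi>(2) by (auto simp: h_def)
  have "inj_on h (verts A)"
  proof (rule inj_onI)
    fix a b assume ab: "a \<in> verts A" "b \<in> verts A" "h a = h b"
    show "a = b"
    proof (cases "f a \<in> L"; cases "f b \<in> L")
      assume "f a \<in> L" "f b \<in> L"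
      then show ?thesis using ab f(1) by (auto simp: hL dest: inj_onD)
    next
      assume "f a \<in> L" "f b \<notin> L"
      then show ?thesis using ab hR(2)[of b] by (simp add: hL)
    next
      assume "f a \<notin> L" "f b \<in> L"
      then show ?thesis using ab hR(2)[of a] by (simp add: hL)
    next
      assume n: "f a \<notin> L" "f b \<notin> L"
      have "(\<sigma> (fst (g (f a))), snd (g (f a))) = (\<sigma> (fst (g (f b))), snd (g (f b)))"
        using \<psi>(1) idx(1)[OF ab(1) n(1)] idx(1)[OF ab(2) n(2)] hR(1) ab n by (metis inj_onD)
      then have "\<sigma> (fst (g (f a))) = \<sigma> (fst (g (f b)))" "snd (g (f a)) = snd (g (f b))" by auto
      then have "g (f a) = g (f b)"
        using \<sigma>(1) idx(2)[OF ab(1) n(1)] idx(2)[OF ab(2) n(2)] by (metis inj_onD prod_eqI)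
      then have "f a = f b" using g(1) B_of[OF ab(1) n(1)] B_of[OF ab(2) n(2)] by (metis inj_onD)
      then show ?thesis using f(1) ab by (metis inj_onD)
    qed
  qed
  moreover have "h ` verts A \<subseteq> verts G"
  proof
    fix y assume "y \<in> h ` verts A"
    then obtain a where "a \<in> verts A" "y = h a" by auto
    then show "y \<in> verts G" using hR(2)[of a] f(2) by (cases "f a \<in> L") (auto simp: hL)
  qed
  moreover have "h ` e \<in> edges G" if e: "e \<in> edges A" for e
  proof -
    have eA: "e \<subseteq> verts A" using simple_graphD(2)[OF sA(1) e] .
    consider "f ` e \<in> core_edges G L" | "f ` e \<in> cross L (verts G - L)" | "f ` e \<in> edges B"
      using f(3)[OF e] by blast
    then show ?thesis
    proof cases
      case 1
      then have "h ` e = f ` e" by (intro image_cong) (auto simp: core_edges_def intro: hL)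
      then show ?thesis using 1 by (simp add: core_edges_def)
    next
      case 2
      then obtain u v where uv: "f ` e = {u, v}" "u \<in> L" "v \<in> verts G - L" by (auto simp: cross_def)
      obtain a b where ab: "e = {a, b}" using e by (rule edge_cases[OF sA(1)])
      then have "\<exists>a b. e = {a, b} \<and> f a = u \<and> f b = v"
        using uv by (auto simp: doubleton_eq_iff)
      then obtain a b where ab: "e = {a, b}" "f a = u" "f b = v" by blast
      then have "h a = u" "h b \<in> verts G - L" using uv hL hR(2)[of b] eA by auto
      then have "{h a, h b} \<in> edges G" using joined_edge[OF G(3)] uv(2) by blast
      then show ?thesis using ab by simp
    next
      case 3
      then have fe: "f ` e \<subseteq> verts B" using simple_graphD(2)[OF B(1)] by blast
      obtain i e' where ie: "i < m" "e' \<in> edges Q" "g ` f ` e = {i} \<times> e'" using g(3)[OF 3] by auto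
      have nL: "f a \<notin> L" if "a \<in> e" for a using fe B(2) that by auto
      obtain a where a: "a \<in> e" using simple_graphD(3)[OF sA(1) e] by (metis card.empty equals0I zero_neq_numeral)
      have "fst (g (f a)) = i"
      proof -
        have "g (f a) \<in> {i} \<times> e'" using ie(3) a by blast
        then show ?thesis by auto
      qed
      then have "i \<in> I" using idx(2)[of a] nL[OF a] eA a by auto
      then have it: "\<sigma> i < t" using \<sigma>(2) by auto
      have "h ` e = (\<lambda>q. \<psi> (\<sigma> (fst q), snd q)) ` (g ` f ` e)"
        unfolding image_image using nL by (intro image_cong) (auto simp: h_def)
      also have "\<dots> = \<psi> ` ({\<sigma> i} \<times> e')" unfolding ie(3) by (force simp: image_image)
      finally show ?thesis using \<psi>(3)[OF it ie(2)] by simp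
    qed
  qed
  ultimately have "contains G A" unfolding contains_def by blast
  then show False using G(2) A by (auto simp: free_of_def)
qed

text \<open>The last conclusion feeds \<open>replicate_free\<close>, which wants all of
  \<open>B\<close>, isolated vertices included, inside a disjoint union of copies. Each leftover
  vertex of \<open>R\<close> is therefore sent to the vertex \<open>q0\<close> of a fresh copy of
  its own, so \<open>m'\<close> may exceed \<open>m\<close>.\<close>

lemma place_copies:
  assumes Q: "simple_graph Q" "verts Q \<noteq> {}" and R: "finite R" "m * card (verts Q) \<le> card R"
  obtains B m' where "simple_graph B" "verts B = R" "contains B (copies Q m)"
    "card (edges B) = m * card (edges Q)" "contains (copies Q m') B"
proof -
  let ?D = "{..<m} \<times> verts Q"
  have fQ: "finite (verts Q)" using Q simple_graphD(1) by blast
  obtain \<iota> where \<iota>: "inj_on \<iota> ?D" "\<iota> ` ?D \<subseteq> R"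
    using card_le_inj[of ?D R] R fQ by (auto simp: card_cartesian_product)
  have sc: "simple_graph (copies Q m)" by (rule simple_copies[OF Q(1)])
  have \<iota>': "inj_on \<iota> (verts (copies Q m))" using \<iota>(1) by (simp add: copies_def)
  let ?M = "map_graph \<iota> (copies Q m)"
  have sM: "simple_graph ?M" by (rule simple_map_graph[OF sc \<iota>'])
  have VM: "verts ?M = \<iota> ` ?D" by (simp add: map_graph_def copies_def)
  define B where "B = Graph R (edges ?M)"
  have "e \<subseteq> R \<and> card e = 2" if "e \<in> edges ?M" for e
    using simple_graphD(2,3)[OF sM that] VM \<iota>(2) by blast
  then have "simple_graph B" using R(1) by (auto simp: simple_graph_def B_def)
  moreover have "contains B (copies Q m)"
    unfolding contains_def using \<iota> by (intro exI[of _ \<iota>]) (auto simp: B_def map_graph_def copies_def)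
  moreover have "card (edges B) = m * card (edges Q)"
    using card_image[OF inj_on_image_edges[OF sc \<iota>']] card_edges_copies[OF Q(1), of m]
    by (simp add: B_def map_graph_def)
  moreover have "contains (copies Q (m + card R)) B"
  proof -
    obtain c where c: "bij_betw c R {..<card R}"
      using ex_bij_betw_finite_nat[OF R(1)] by (auto simp: lessThan_atLeast0)
    obtain q0 where q0: "q0 \<in> verts Q" using Q(2) by blast
    let ?inv = "the_inv_into ?D \<iota>"
    define g where "g r = (if r \<in> \<iota> ` ?D then ?inv r else (m + c r, q0))" for r
    have gi: "g (\<iota> d) = d" if "d \<in> ?D" for d using that \<iota>(1) by (auto simp: g_def the_inv_into_f_f)
    have gn: "g r = (m + c r, q0)" if "r \<notin> \<iota> ` ?D" for r using that by (simp add: g_def)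
    have gin: "g r \<in> ?D" if "r \<in> \<iota> ` ?D" for r using that gi by force
    show ?thesis
      unfolding contains_def
    proof (intro exI[of _ g] conjI ballI)
      show "inj_on g (verts B)"
      proof (rule inj_onI)
        fix r s assume rs: "r \<in> verts B" "s \<in> verts B" "g r = g s"
        consider "r \<in> \<iota> ` ?D" "s \<in> \<iota> ` ?D" | "r \<notin> \<iota> ` ?D" "s \<notin> \<iota> ` ?D"
          | "r \<in> \<iota> ` ?D" "s \<notin> \<iota> ` ?D" | "r \<notin> \<iota> ` ?D" "s \<in> \<iota> ` ?D" by blast
        then show "r = s"
        proof cases
          case 1
          then obtain d d' where "r = \<iota> d" "d \<in> ?D" "s = \<iota> d'" "d' \<in> ?D" by blast
          then show ?thesis using rs(3) gi by metis
        next
          case 2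
          then have "c r = c s" using rs(3) by (simp add: gn)
          then show ?thesis using c rs by (auto simp: bij_betw_def B_def dest: inj_onD)
        next
          case 3 then show ?thesis using rs(3) gin[of r] gn[of s] by auto
        next
          case 4 then show ?thesis using rs(3) gin[of s] gn[of r] by auto
        qed
      qed
      show "g ` verts B \<subseteq> verts (copies Q (m + card R))"
      proof
        fix y assume "y \<in> g ` verts B"
        then obtain r where r: "r \<in> R" "y = g r" by (auto simp: B_def)
        show "y \<in> verts (copies Q (m + card R))"
        proof (cases "r \<in> \<iota> ` ?D")
          case True then show ?thesis using gin[OF True] r by (auto simp: copies_def)
        next
          case False
          have "c r < card R" using c r by (auto simp: bij_betw_def)
          then show ?thesis using gn[OF False] r q0 by (simp add: copies_def)
        qed
      qed
      fix e assume "e \<in> edges B"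
      then obtain i e' where ie: "i < m" "e' \<in> edges Q" "e = \<iota> ` ({i} \<times> e')"
        by (auto simp: B_def map_graph_def copies_def)
      have "g ` e = {i} \<times> e'"
      proof -
        have "{i} \<times> e' \<subseteq> ?D" using ie simple_graphD(2)[OF Q(1)] by auto
        then have "(\<lambda>d. g (\<iota> d)) ` ({i} \<times> e') = id ` ({i} \<times> e')" using gi by (intro image_cong) auto
        then show ?thesis using ie(3) by (simp add: image_image)
      qed
      then show "g ` e \<in> edges (copies Q (m + card R))" using ie by (auto simp: copies_def)
    qed
  qed
  ultimately show ?thesis using that[of B] by (auto simp: B_def)
qed

text \<open>A bijection that carries one packing onto the other preserves its
  \<open>m * card (edges Q)\<close> edges, so only edges of \<open>B\<close> outside the packing can
  be lost.\<close>

lemma align_packings: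
  assumes B: "simple_graph B" "contains B (copies Q m)" and B': "simple_graph B'" "contains B' (copies Q m)"
    and Q: "simple_graph Q" and card: "card (verts B) = card (verts B')"
  obtains \<pi> where "bij_betw \<pi> (verts B') (verts B)"
    "card (edges B - (`) \<pi> ` edges B') + m * card (edges Q) \<le> card (edges B)"
proof -
  let ?D = "{..<m} \<times> verts Q"
  have fin: "finite (verts B)" "finite (verts B')" using B B' simple_graphD(1) by auto
  obtain f where f: "inj_on f ?D" "f ` ?D \<subseteq> verts B" "\<And>i e. i < m \<Longrightarrow> e \<in> edges Q \<Longrightarrow> f ` ({i} \<times> e) \<in> edges B"
    using contains_copiesD[OF B(2)] by metis
  obtain g where g: "inj_on g ?D" "g ` ?D \<subseteq> verts B'" "\<And>i e. i < m \<Longrightarrow> e \<in> edges Q \<Longrightarrow> g ` ({i} \<times> e) \<in> edges B'"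
    using contains_copiesD[OF B'(2)] by metis
  have "card (verts B' - g ` ?D) = card (verts B - f ` ?D)"
    using f(1,2) g(1,2) fin card finite_subset[OF f(2)] finite_subset[OF g(2)]
    by (simp add: card_Diff_subset card_image)
  then obtain h where h: "bij_betw h (verts B' - g ` ?D) (verts B - f ` ?D)"
    using finite_same_card_bij[of "verts B' - g ` ?D" "verts B - f ` ?D"] fin by auto
  define \<pi> where "\<pi> v = (if v \<in> g ` ?D then f (the_inv_into ?D g v) else h v)" for v
  have \<pi>g: "\<pi> (g d) = f d" if "d \<in> ?D" for d using that g(1) by (auto simp: \<pi>_def the_inv_into_f_f)
  have b1: "bij_betw \<pi> (g ` ?D) (f ` ?D)"
  proof -
    have "bij_betw (f \<circ> the_inv_into ?D g) (g ` ?D) (f ` ?D)"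
      using f(1) g(1) bij_betw_the_inv_into[of g ?D "g ` ?D"]
      by (intro bij_betw_trans[of _ _ ?D]) (auto simp: bij_betw_def)
    then show ?thesis by (rule bij_betw_cong[THEN iffD1, rotated]) (auto simp: \<pi>_def)
  qed
  have b2: "bij_betw \<pi> (verts B' - g ` ?D) (verts B - f ` ?D)"
    using h by (rule bij_betw_cong[THEN iffD1, rotated]) (auto simp: \<pi>_def)
  have "bij_betw \<pi> (g ` ?D \<union> (verts B' - g ` ?D)) (f ` ?D \<union> (verts B - f ` ?D))"
    by (rule bij_betw_combine[OF b1 b2]) auto
  then have b: "bij_betw \<pi> (verts B') (verts B)" using f(2) g(2) by (simp add: Un_absorb1)
  have sc: "simple_graph (copies Q m)" by (rule simple_copies[OF Q])
  have f': "inj_on f (verts (copies Q m))" using f(1) by (simp add: copies_def)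
  let ?P = "(`) f ` edges (copies Q m)"
  have cP: "card ?P = m * card (edges Q)"
    using card_image[OF inj_on_image_edges[OF sc f']] card_edges_copies[OF Q, of m] by simp
  have PB: "?P \<subseteq> edges B" using f(3) by (auto simp: copies_def)
  have PB': "?P \<subseteq> (`) \<pi> ` edges B'"
  proof
    fix e assume "e \<in> ?P"
    then obtain i e' where ie: "i < m" "e' \<in> edges Q" "e = f ` ({i} \<times> e')" by (auto simp: copies_def)
    have "{i} \<times> e' \<subseteq> ?D" using ie simple_graphD(2)[OF Q] by auto
    then have "\<pi> ` (g ` ({i} \<times> e')) = e" unfolding image_image ie(3) using \<pi>g by (intro image_cong) auto
    then show "e \<in> (`) \<pi> ` edges B'" using g(3)[OF ie(1,2)] by blast
  qed
  have "card (edges B - (`) \<pi> ` edges B') \<le> card (edges B - ?P)"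
    using PB' finite_edges[OF B(1)] by (intro card_mono) auto
  also have "\<dots> = card (edges B) - m * card (edges Q)"
    using cP PB finite_subset[OF PB finite_edges[OF B(1)]] by (simp add: card_Diff_subset)
  also have "m * card (edges Q) \<le> card (edges B)" using card_mono[OF finite_edges[OF B(1)] PB] cP by simp
  ultimately show ?thesis using that[OF b] card_mono[OF finite_edges[OF B(1)] PB] cP by linarith
qed

lemma edges_induced_rest:
  "simple_graph G \<Longrightarrow> edges (induced G (verts G - L)) = rest_edges G L"
  using simple_graphD(2) by (fastforce simp: induced_def rest_edges_def)

text \<open>All edges between core and rest are present, so the two sides can be relabelled by
  unrelated bijections. This lets a competitor be laid over \<open>G\<close> with core and rest
  aligned separately.\<close>

lemma transport_joined:
  assumes G: "G \<in> free_graphs n \<F>" "joined G L" and F: "\<And>A. A \<in> \<F> \<Longrightarrow> simple_graph A"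
    and \<tau>: "bij_betw \<tau> L L'" and \<pi>: "bij_betw \<pi> (verts G - L) R'" and LR: "L' \<inter> R' = {}"
  obtains G' where "G' \<in> free_graphs n \<F>" "verts G' = L' \<union> R'" "joined G' L'"
    "core_edges G' L' = (`) \<tau> ` core_edges G L" "rest_edges G' L' = (`) \<pi> ` rest_edges G L"
proof -
  define \<phi> where "\<phi> v = (if v \<in> L then \<tau> v else \<pi> v)" for v
  have sG: "simple_graph G" and cG: "card (verts G) = n" and free: "free_of \<F> G"
    using G(1) by (auto simp: free_graphs_def)
  have LV: "L \<subseteq> verts G" using G(2) by (simp add: joined_def)
  have b1: "bij_betw \<phi> L L'" using \<tau> by (rule bij_betw_cong[THEN iffD1, rotated]) (simp add: \<phi>_def)
  have b2: "bij_betw \<phi> (verts G - L) R'"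
    using \<pi> by (rule bij_betw_cong[THEN iffD1, rotated]) (simp add: \<phi>_def)
  have "bij_betw \<phi> (L \<union> (verts G - L)) (L' \<union> R')" by (rule bij_betw_combine[OF b1 b2 LR])
  then have b: "bij_betw \<phi> (verts G) (L' \<union> R')" using LV by (simp add: Un_absorb1)
  then have inj: "inj_on \<phi> (verts G)" by (simp add: bij_betw_def)
  let ?G = "map_graph \<phi> G"
  have V': "verts ?G = L' \<union> R'" using b by (simp add: map_graph_def bij_betw_def)
  have inL: "\<phi> v \<in> L' \<longleftrightarrow> v \<in> L" if "v \<in> verts G" for v
  proof
    assume "\<phi> v \<in> L'"
    show "v \<in> L"
    proof (rule ccontr)
      assume "v \<notin> L"
      then have "\<phi> v \<in> R'" using b2 that by (auto simp: bij_betw_def)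
      then show False using \<open>\<phi> v \<in> L'\<close> LR by blast
    qed
  qed (use b1 in \<open>auto simp: bij_betw_def\<close>)
  have "?G \<in> free_graphs n \<F>"
    using simple_map_graph[OF sG inj] free_of_contains[OF free contains_map_graph[OF sG inj] F] cG
      card_image[OF inj] by (simp add: free_graphs_def map_graph_def)
  moreover have "joined ?G L'"
    unfolding joined_def
  proof (intro conjI subsetI)
    show "v \<in> verts ?G" if "v \<in> L'" for v using that V' by blast
    fix e assume "e \<in> cross L' (verts ?G - L')"
    then obtain u v where uv: "e = {u, v}" "u \<in> L'" "v \<in> verts ?G" "v \<notin> L'" by (auto simp: cross_def)
    obtain a where a: "a \<in> L" "u = \<phi> a" using uv(2) b1 by (auto simp: bij_betw_def)
    obtain c where c: "c \<in> verts G" "v = \<phi> c" using uv(3) by (auto simp: map_graph_def)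
    have "{a, c} \<in> edges G" using joined_edge[OF G(2) a(1) c(1)] inL[OF c(1)] c(2) uv(4) by blast
    then have "\<phi> ` {a, c} \<in> edges ?G" unfolding map_graph_def graph.sel by (rule imageI)
    then show "e \<in> edges ?G" using uv(1) a c by simp
  qed
  moreover have "core_edges ?G L' = (`) \<tau> ` core_edges G L"
  proof -
    have "core_edges ?G L' = (`) \<phi> ` core_edges G L"
    proof (intro equalityI subsetI)
      fix e assume "e \<in> core_edges ?G L'"
      then obtain e' where e': "e' \<in> edges G" "e = \<phi> ` e'" "e \<subseteq> L'"
        by (auto simp: core_edges_def map_graph_def)
      then have "e' \<subseteq> L" using inL simple_graphD(2)[OF sG] by blast
      then show "e \<in> (`) \<phi> ` core_edges G L" using e' by (auto simp: core_edges_def)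
    next
      fix e assume "e \<in> (`) \<phi> ` core_edges G L"
      then obtain e' where e': "e' \<in> edges G" "e = \<phi> ` e'" "e' \<subseteq> L" by (auto simp: core_edges_def)
      then have "e \<subseteq> L'" using inL simple_graphD(2)[OF sG] by blast
      then show "e \<in> core_edges ?G L'" using e' by (auto simp: core_edges_def map_graph_def)
    qed
    also have "\<dots> = (`) \<tau> ` core_edges G L"
      by (intro image_cong refl) (auto simp: core_edges_def \<phi>_def)
    finally show ?thesis .
  qed
  moreover have "rest_edges ?G L' = (`) \<pi> ` rest_edges G L"
  proof -
    have "rest_edges ?G L' = (`) \<phi> ` rest_edges G L"
    proof (intro equalityI subsetI)
      fix e assume "e \<in> rest_edges ?G L'"
      then obtain e' where e': "e' \<in> edges G" "e = \<phi> ` e'" "e \<inter> L' = {}"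
        by (auto simp: rest_edges_def map_graph_def)
      then have "e' \<inter> L = {}" using inL simple_graphD(2)[OF sG] by blast
      then show "e \<in> (`) \<phi> ` rest_edges G L" using e' by (auto simp: rest_edges_def)
    next
      fix e assume "e \<in> (`) \<phi> ` rest_edges G L"
      then obtain e' where e': "e' \<in> edges G" "e = \<phi> ` e'" "e' \<inter> L = {}" by (auto simp: rest_edges_def)
      then have "e \<inter> L' = {}" using inL simple_graphD(2)[OF sG] by blast
      then show "e \<in> rest_edges ?G L'" using e' by (auto simp: rest_edges_def map_graph_def)
    qed
    also have "\<dots> = (`) \<pi> ` rest_edges G L"
      by (intro image_cong refl) (auto simp: rest_edges_def \<phi>_def)
    finally show ?thesis .
  qed
  ultimately show ?thesis using that[of ?G] V' by blast
qed

lemma contains_copies_le: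
  assumes "contains B (copies Q m)" "m' \<le> m"
  shows "contains B (copies Q m')"
proof -
  obtain f where f: "inj_on f ({..<m} \<times> verts Q)" "f ` ({..<m} \<times> verts Q) \<subseteq> verts B"
    "\<And>i e. i < m \<Longrightarrow> e \<in> edges Q \<Longrightarrow> f ` ({i} \<times> e) \<in> edges B"
    using contains_copiesD[OF assms(1)] by metis
  have sub: "{..<m'} \<times> verts Q \<subseteq> {..<m} \<times> verts Q" using assms(2) by auto
  show ?thesis
    using inj_on_subset[OF f(1) sub] image_mono[OF sub, of f] f(2,3) assms(2)
    by (intro contains_copiesI[of f]) auto
qed

lemma contains_copies_card:
  assumes "contains B (copies Q m)" "simple_graph B" "simple_graph Q"
  shows "m * card (edges Q) \<le> card (edges B)" "m * card (verts Q) \<le> card (verts B)"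
proof -
  obtain f where f: "inj_on f (verts (copies Q m))" "f ` verts (copies Q m) \<subseteq> verts B"
    "\<forall>e\<in>edges (copies Q m). f ` e \<in> edges B" using assms(1) by (auto simp: contains_def)
  have "card ((`) f ` edges (copies Q m)) \<le> card (edges B)"
    using f(3) finite_edges[OF assms(2)] by (intro card_mono) auto
  then show "m * card (edges Q) \<le> card (edges B)"
    using card_image[OF inj_on_image_edges[OF simple_copies[OF assms(3)] f(1)]]
      card_edges_copies[OF assms(3), of m] by simp
  have "card (verts (copies Q m)) \<le> card (verts B)"
    using card_inj_on_le[OF f(1,2) simple_graphD(1)[OF assms(2)]] .
  then show "m * card (verts Q) \<le> card (verts B)" by (simp add: copies_def card_cartesian_product)
qed

lemma card_edges_remove:
  assumes B: "simple_graph B" and X: "X \<subseteq> verts B" and deg: "\<And>v. v \<in> verts B \<Longrightarrow> card (nbr B v) \<le> t"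
  shows "card (edges B) \<le> card (edges (induced B (verts B - X))) + card X * t"
proof -
  have fX: "finite X" using X simple_graphD(1)[OF B] finite_subset by blast
  have "edges B \<subseteq> edges (induced B (verts B - X)) \<union> (\<Union>v\<in>X. (\<lambda>u. {v, u}) ` nbr B v)"
  proof
    fix e assume e: "e \<in> edges B"
    then obtain u v where uv: "e = {u, v}" "u \<in> verts B" "v \<in> verts B" "v \<in> nbr B u" by (rule edge_cases[OF B])
    show "e \<in> edges (induced B (verts B - X)) \<union> (\<Union>v\<in>X. (\<lambda>u. {v, u}) ` nbr B v)"
      using e uv nbr_sym[of u B v] by (auto simp: induced_def insert_commute)
  qed
  then have "card (edges B) \<le> card (edges (induced B (verts B - X)) \<union> (\<Union>v\<in>X. (\<lambda>u. {v, u}) ` nbr B v))"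
    using fX finite_edges[OF B] finite_nbr[OF B] by (intro card_mono) (auto simp: induced_def)
  also have "\<dots> \<le> card (edges (induced B (verts B - X))) + card (\<Union>v\<in>X. (\<lambda>u. {v, u}) ` nbr B v)"
    by (rule card_Un_le)
  also have "card (\<Union>v\<in>X. (\<lambda>u. {v, u}) ` nbr B v) \<le> (\<Sum>v\<in>X. card ((\<lambda>u. {v, u}) ` nbr B v))"
    by (rule card_UN_le[OF fX])
  also have "\<dots> \<le> (\<Sum>v\<in>X. t)"
  proof (rule sum_mono)
    fix v assume "v \<in> X"
    then show "card ((\<lambda>u. {v, u}) ` nbr B v) \<le> t"
      using deg[of v] X card_image_le[OF finite_nbr[OF B], of "\<lambda>u. {v, u}" v] by force
  qed
  finally show ?thesis by simp
qed

text \<open>Deleting a maximal packing of three-vertex paths leaves a matching; the at most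
  \<open>3 * t\<close> deleted vertices have degree at most \<open>t\<close>.\<close>

lemma few_path3_structure:
  assumes B: "simple_graph B" and deg: "\<And>v. v \<in> verts B \<Longrightarrow> card (nbr B v) \<le> t"
    and no: "\<not> contains B (copies path3 t)"
  obtains m where "contains B (copies single_edge m)" "card (edges B) \<le> m + 3 * t * t"
proof -
  obtain X where X: "X \<subseteq> verts B" "card X \<le> t * 3" "\<not> contains (induced B (verts B - X)) path3"
    using greedy_packing[OF B simple_patterns(2) no] by (auto simp: path3_def)
  let ?B = "induced B (verts B - X)"
  have "simple_graph ?B" by (rule simple_induced[OF B]) auto
  then have "contains ?B (copies single_edge (card (edges ?B)))" using matching_packing X(3) by blast
  then have "contains B (copies single_edge (card (edges ?B)))"
    by (rule contains_mono) (auto simp: induced_def)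
  moreover have "card (edges B) \<le> card (edges ?B) + 3 * t * t"
  proof -
    have "card X * t \<le> 3 * t * t" using X(2) by (intro mult_right_mono) auto
    then show ?thesis using card_edges_remove[OF B X(1) deg] by linarith
  qed
  ultimately show ?thesis by (rule that)
qed

text \<open>Maximal packings of the three patterns occupy at most
  \<open>3 * t + 4 * t + 4 * t\<close> vertices of degree at most \<open>t\<close>; the resulting
  \<open>11 * t * t\<close> is doubled because edges enter the conclusion twice.\<close>

lemma few_large_patterns_structure:
  assumes B: "simple_graph B" and deg: "\<And>v. v \<in> verts B \<Longrightarrow> card (nbr B v) \<le> t"
    and no: "\<not> contains B (copies tri3 t)" "\<not> contains B (copies path4 t)" "\<not> contains B (copies claw t)"
  obtains m where "contains B (copies path3 m)" "2 * card (edges B) \<le> card (verts B) + m + 22 * t * t"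
proof -
  obtain X1 where X1: "X1 \<subseteq> verts B" "card X1 \<le> t * 3" "\<not> contains (induced B (verts B - X1)) tri3"
    using greedy_packing[OF B simple_patterns(5) no(1)] by (auto simp: tri3_def)
  obtain X2 where X2: "X2 \<subseteq> verts B" "card X2 \<le> t * 4" "\<not> contains (induced B (verts B - X2)) path4"
    using greedy_packing[OF B simple_patterns(3) no(2)] by (auto simp: path4_def)
  obtain X3 where X3: "X3 \<subseteq> verts B" "card X3 \<le> t * 4" "\<not> contains (induced B (verts B - X3)) claw"
    using greedy_packing[OF B simple_patterns(4) no(3)] by (auto simp: claw_def)
  define X where "X = X1 \<union> X2 \<union> X3"
  have X: "X \<subseteq> verts B" using X1 X2 X3 by (auto simp: X_def)
  have cX: "card X \<le> 11 * t"
    using card_Un_le[of X1 X2] card_Un_le[of "X1 \<union> X2" X3] X1(2) X2(2) X3(2) by (simp add: X_def)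
  let ?B = "induced B (verts B - X)"
  have sB: "simple_graph ?B" by (rule simple_induced[OF B]) auto
  have n1: "\<not> contains ?B tri3" and n2: "\<not> contains ?B path4" and n3: "\<not> contains ?B claw"
    using X1(3) X2(3) X3(3)
      contains_mono[of ?B tri3 "induced B (verts B - X1)"]
      contains_mono[of ?B path4 "induced B (verts B - X2)"]
      contains_mono[of ?B claw "induced B (verts B - X3)"]
    by (auto simp: induced_def X_def)
  obtain m where m: "contains ?B (copies path3 m)" "2 * card (edges ?B) \<le> card (verts ?B) + m"
    using cherry_packing[OF sB n1 n2 n3] by metis
  have "contains B (copies path3 m)" using m(1) by (rule contains_mono) (auto simp: induced_def)
  moreover have "card (verts ?B) \<le> card (verts B)"
    using simple_graphD(1)[OF B] by (auto simp: induced_def intro: card_mono)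
  moreover have "card (edges B) \<le> card (edges ?B) + card X * t" by (rule card_edges_remove[OF B X deg])
  moreover have "card X * t \<le> 11 * t * t" using cX by (rule mult_right_mono) simp
  ultimately show ?thesis using m(2) by (intro that[of m]) linarith+
qed

section \<open>Comparison of an extremal graph with its competitors\<close>

locale extremal_join = fam: degenerate_family \<F> k t + sparse_perron G x n k t C
  for \<F> :: "nat graph set" and k t :: nat and G :: "nat graph" and x :: "nat \<Rightarrow> real"
    and n :: nat and C :: real +
  fixes L :: "nat set"
  assumes G_free: "G \<in> free_graphs n \<F>"
    and extremal: "\<And>G'. G' \<in> free_graphs n \<F> \<Longrightarrow> rho G' \<le> rho G"
    and L: "joined G L" "card L = k"
    and rho_gt: "real t < rho G"
begin

definition "s = (\<Sum>v\<in>L. x v)"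
text \<open>Entries outside \<open>L\<close> lie between \<open>s / l\<close> and
  \<open>s / (l - t)\<close>. So \<open>\<sigma>\<close> bounds the weight of a rest edge from below
  and \<open>(1 + \<epsilon>) * \<sigma>\<close> bounds it from above, as \<open>prod_R\<close>
  shows.\<close>

definition "\<sigma> = (s / l)\<^sup>2"
definition "\<epsilon> = (l / (l - real t))\<^sup>2 - 1"

lemma LV: "L \<subseteq> V" using L(1) by (simp add: joined_def)

lemma fL: "finite L" using LV fV finite_subset by blast

lemma card_R: "card (V - L) = n - k" using LV fL L(2) card_V by (simp add: card_Diff_subset)

lemma compare:
  assumes "G' \<in> free_graphs n \<F>" "verts G' = V"
  shows "(\<Sum>e\<in>edges G'. \<Prod>v\<in>e. x v) \<le> (\<Sum>e\<in>edges G. \<Prod>v\<in>e. x v)"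
proof -
  have sG': "simple_graph G'" using assms(1) by (simp add: free_graphs_def)
  have "qform (adj G') V x \<le> rho G' * (\<Sum>v\<in>V. (x v)\<^sup>2)"
    using qform_le_rho[OF sG', of x] assms(2) by simp
  also have "\<dots> \<le> l * (\<Sum>v\<in>V. (x v)\<^sup>2)"
    using extremal[OF assms(1)] by (intro mult_right_mono sum_nonneg) auto
  also have "\<dots> = qform (adj G) V x" by (simp add: qform_perron)
  finally show ?thesis using qform_adj[OF sG', of x] qform_adj[OF sg, of x] assms(2) by simp
qed

lemma compare_joined:
  assumes "G' \<in> free_graphs n \<F>" "verts G' = V" "joined G' L"
  shows "(\<Sum>e\<in>core_edges G' L. \<Prod>v\<in>e. x v) + (\<Sum>e\<in>rest_edges G' L. \<Prod>v\<in>e. x v)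
    \<le> (\<Sum>e\<in>core_edges G L. \<Prod>v\<in>e. x v) + (\<Sum>e\<in>rest_edges G L. \<Prod>v\<in>e. x v)"
proof -
  have sG': "simple_graph G'" using assms(1) by (simp add: free_graphs_def)
  show ?thesis
    using compare[OF assms(1,2)] sum_joined[OF sG' assms(3), of "prod x"]
      sum_joined[OF sg L(1), of "prod x"] assms(2) by simp
qed

lemma L_subset_N: "u \<in> V - L \<Longrightarrow> L \<subseteq> N u"
  using joined_edge[OF L(1)] by (auto simp: nbr_def insert_commute)

lemma eigen_R:
  assumes "u \<in> V - L"
  shows "l * x u = s + (\<Sum>w\<in>N u - L. x w)"
proof -
  have "(\<Sum>w\<in>N u. x w) = (\<Sum>w\<in>N u \<inter> L. x w) + (\<Sum>w\<in>N u - L. x w)" by (rule sum.Int_Diff[OF fN])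
  moreover have "N u \<inter> L = L" using L_subset_N[OF assms] by blast
  ultimately show ?thesis using eigen[of u] assms by (simp add: s_def)
qed

lemma s_le: "s \<le> real k"
proof -
  have "s \<le> (\<Sum>v\<in>L. 1)" unfolding s_def using x_le_1 LV by (intro sum_mono) blast
  then show ?thesis using L(2) by simp
qed

lemma l_pos: "l > 0" using rho_gt by (rule le_less_trans[rotated]) simp

lemma x_R_ge: "u \<in> V - L \<Longrightarrow> s / l \<le> x u"
  using eigen_R[of u] sum_nonneg[of "N u - L" x] x_nonneg l_pos by (simp add: divide_le_eq mult.commute)

text \<open>At the vertex where \<open>x\<close> attains its maximum \<open>M\<close> off
  \<open>L\<close>, fewer than \<open>t\<close> neighbours lie outside \<open>L\<close>, each being
  a common neighbour of \<open>k + 1\<close> vertices. The eigenvalue equation there gives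
  \<open>l * M \<le> s + t * M\<close>.\<close>

lemma x_R_le:
  assumes u: "u \<in> V - L"
  shows "x u \<le> s / (l - real t)"
proof -
  define M where "M = Max (x ` (V - L))"
  have fR: "finite (x ` (V - L))" using fV by simp
  have le: "x w \<le> M" if "w \<in> V - L" for w unfolding M_def using fR that by (intro Max_ge) auto
  have "M \<in> x ` (V - L)" unfolding M_def using fR u by (intro Max_in) auto
  then obtain w where w: "w \<in> V - L" "M = x w" by auto
  have M0: "M \<ge> 0" using w x_nonneg by simp
  have sub: "N w - L \<subseteq> common G (insert w L)"
  proof
    fix z assume z: "z \<in> N w - L"
    then have "z \<in> V - L" using NV by blast
    then show "z \<in> common G (insert w L)"
      using L_subset_N[of z] z nbr_sym[of z G w] by (auto simp: common_def)
  qed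
  have "card (N w - L) \<le> card (common G (insert w L))"
    using sub fV by (intro card_mono) (auto simp: common_def)
  also have "\<dots> < t" using w LV L(2) fL by (intro no_K) auto
  finally have c: "card (N w - L) \<le> t" by simp
  have "(\<Sum>z\<in>N w - L. x z) \<le> (\<Sum>z\<in>N w - L. M)" using le NV by (intro sum_mono) blast
  also have "\<dots> \<le> real t * M" using c M0 by (simp add: mult_right_mono)
  finally have "l * M \<le> s + real t * M" using eigen_R[OF w(1)] w(2) by simp
  then have "M \<le> s / (l - real t)" using rho_gt by (simp add: pos_le_divide_eq algebra_simps)
  then show ?thesis using le[OF u] by simp
qed

lemma s_pos: "0 < s"
proof -
  obtain u where u: "u \<in> V" "x u = 1" using pf by (auto simp: perron_def)
  have "0 \<le> s" unfolding s_def by (intro sum_nonneg x_nonneg)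
  moreover have "s \<noteq> 0"
  proof
    assume s0: "s = 0"
    show False
    proof (cases "u \<in> L")
      case True
      then have "x u \<le> s" unfolding s_def using fL x_nonneg by (intro member_le_sum) auto
      then show False using u(2) s0 by simp
    next
      case False
      then show False using x_R_le[of u] u s0 by simp
    qed
  qed
  ultimately show ?thesis by simp
qed

lemma \<sigma>_pos: "0 < \<sigma>" using s_pos l_pos by (simp add: \<sigma>_def)

lemma \<epsilon>_nonneg: "0 \<le> \<epsilon>"
proof -
  have "1 \<le> l / (l - real t)" using rho_gt by simp
  then show ?thesis by (simp add: \<epsilon>_def)
qed

lemma prod_R:
  assumes "e \<subseteq> V - L" "card e = 2"
  shows "\<sigma> \<le> (\<Prod>v\<in>e. x v)" "(\<Prod>v\<in>e. x v) \<le> (1 + \<epsilon>) * \<sigma>"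
proof -
  obtain u w where uw: "e = {u, w}" "u \<noteq> w" using assms(2) by (auto simp: card_2_iff)
  then have R: "u \<in> V - L" "w \<in> V - L" using assms(1) by auto
  have pr: "(\<Prod>v\<in>e. x v) = x u * x w" using uw by simp
  have "s / l * (s / l) \<le> x u * x w"
    using x_R_ge[OF R(1)] x_R_ge[OF R(2)] s_pos l_pos x_nonneg by (intro mult_mono) auto
  then show "\<sigma> \<le> (\<Prod>v\<in>e. x v)" by (simp add: pr \<sigma>_def power2_eq_square)
  have "x u * x w \<le> s / (l - real t) * (s / (l - real t))"
    using x_R_le[OF R(1)] x_R_le[OF R(2)] s_pos rho_gt x_nonneg by (intro mult_mono) auto
  also have "\<dots> = (1 + \<epsilon>) * \<sigma>"
    using l_pos by (simp add: \<epsilon>_def \<sigma>_def power2_eq_square)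
  finally show "(\<Prod>v\<in>e. x v) \<le> (1 + \<epsilon>) * \<sigma>" by (simp add: pr)
qed

lemma rest_edge:
  assumes "simple_graph G'" "verts G' = V" "e \<in> rest_edges G' L"
  shows "e \<subseteq> V - L" "card e = 2"
  using assms simple_graphD(2,3)[OF assms(1), of e] by (auto simp: rest_edges_def)

lemma finite_rest: "simple_graph G' \<Longrightarrow> finite (rest_edges G' L')"
  using finite_edges[of G'] by (simp add: rest_edges_def)

text \<open>Common rest edges cancel, so the spread \<open>\<epsilon>\<close> is charged only to
  edges of \<open>G\<close> that the competitor lacks. A larger core only helps the
  competitor.\<close>

lemma swap_rest:
  assumes G': "G' \<in> free_graphs n \<F>" "verts G' = V" "joined G' L"
    and core: "core_edges G L \<subseteq> core_edges G' L"
  shows "real (card (rest_edges G' L)) \<le>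
    real (card (rest_edges G L)) + \<epsilon> * real (card (rest_edges G L - rest_edges G' L))"
proof -
  let ?B = "rest_edges G L" and ?B' = "rest_edges G' L"
  have sG': "simple_graph G'" using G'(1) by (simp add: free_graphs_def)
  have fB: "finite ?B" "finite ?B'" using finite_rest sg sG' by auto
  have "(\<Sum>e\<in>core_edges G L. \<Prod>v\<in>e. x v) \<le> (\<Sum>e\<in>core_edges G' L. \<Prod>v\<in>e. x v)"
    using core finite_edges[OF sG'] by (intro sum_mono2 prod_nonneg) (auto simp: core_edges_def x_nonneg)
  then have "(\<Sum>e\<in>?B'. \<Prod>v\<in>e. x v) \<le> (\<Sum>e\<in>?B. \<Prod>v\<in>e. x v)" using compare_joined[OF G'] by simp
  moreover have "(\<Sum>e\<in>?B'. \<Prod>v\<in>e. x v) = (\<Sum>e\<in>?B' \<inter> ?B. \<Prod>v\<in>e. x v) + (\<Sum>e\<in>?B' - ?B. \<Prod>v\<in>e. x v)"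
    by (rule sum.Int_Diff[OF fB(2)])
  moreover have "(\<Sum>e\<in>?B. \<Prod>v\<in>e. x v) = (\<Sum>e\<in>?B \<inter> ?B'. \<Prod>v\<in>e. x v) + (\<Sum>e\<in>?B - ?B'. \<Prod>v\<in>e. x v)"
    by (rule sum.Int_Diff[OF fB(1)])
  moreover have "?B' \<inter> ?B = ?B \<inter> ?B'" by blast
  ultimately have le: "(\<Sum>e\<in>?B' - ?B. \<Prod>v\<in>e. x v) \<le> (\<Sum>e\<in>?B - ?B'. \<Prod>v\<in>e. x v)" by simp
  have "real (card (?B' - ?B)) * \<sigma> = (\<Sum>e\<in>?B' - ?B. \<sigma>)" by simp
  also have "\<dots> \<le> (\<Sum>e\<in>?B' - ?B. \<Prod>v\<in>e. x v)"
    using rest_edge[OF sG' G'(2)] by (intro sum_mono prod_R) auto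
  also note le
  also have "(\<Sum>e\<in>?B - ?B'. \<Prod>v\<in>e. x v) \<le> (\<Sum>e\<in>?B - ?B'. (1 + \<epsilon>) * \<sigma>)"
    using rest_edge[OF sg refl] by (intro sum_mono prod_R) auto
  also have "\<dots> = (1 + \<epsilon>) * real (card (?B - ?B')) * \<sigma>" by simp
  finally have "real (card (?B' - ?B)) \<le> (1 + \<epsilon>) * real (card (?B - ?B'))"
    using \<sigma>_pos by (rule mult_right_le_imp_le)
  moreover have "card ?B' = card (?B' \<inter> ?B) + card (?B' - ?B)" "card ?B = card (?B' \<inter> ?B) + card (?B - ?B')"
    using card_Int_Diff[OF fB(2), of ?B] card_Int_Diff[OF fB(1), of ?B'] by (simp_all add: Int_commute)
  ultimately show ?thesis by (simp add: algebra_simps)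
qed

text \<open>The competitor is placed along a packing common to both rests. If that packing misses
  boundedly many edges of \<open>G\<close>, the error term drops below 1 and integrality
  decides.\<close>

lemma rest_compare:
  assumes G': "G' \<in> free_graphs n \<F>" "joined G' L'" "card L' = k"
    and \<tau>: "bij_betw \<tau> L' L" "core_edges G L \<subseteq> (`) \<tau> ` core_edges G' L'"
    and Q: "simple_graph Q" "contains (induced G (V - L)) (copies Q m)"
      "contains (induced G' (verts G' - L')) (copies Q m)"
  shows "real (card (rest_edges G' L')) \<le> real (card (rest_edges G L))
    + \<epsilon> * (real (card (rest_edges G L)) - real (m * card (edges Q)))"
proof -
  have sG': "simple_graph G'" and cG': "card (verts G') = n" using G'(1) by (auto simp: free_graphs_def)
  have L'V: "L' \<subseteq> verts G'" using G'(2) by (simp add: joined_def)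
  have fL': "finite L'" using L'V simple_graphD(1)[OF sG'] finite_subset by blast
  have sB: "simple_graph (induced G (V - L))" by (rule simple_induced[OF sg]) auto
  have sB': "simple_graph (induced G' (verts G' - L'))" by (rule simple_induced[OF sG']) auto
  have "card (verts (induced G (V - L))) = card (verts (induced G' (verts G' - L')))"
    using card_R L'V fL' G'(3) cG' by (simp add: induced_def card_Diff_subset)
  then obtain \<pi> where \<pi>0: "bij_betw \<pi> (verts (induced G' (verts G' - L'))) (verts (induced G (V - L)))"
    "card (edges (induced G (V - L)) - (`) \<pi> ` edges (induced G' (verts G' - L'))) + m * card (edges Q)
       \<le> card (edges (induced G (V - L)))"
    using align_packings[OF sB Q(2) sB' Q(3) Q(1)] by metis
  have \<pi>: "bij_betw \<pi> (verts G' - L') (V - L)" using \<pi>0(1) by (simp add: induced_def)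
  have d: "card (rest_edges G L - (`) \<pi> ` rest_edges G' L') + m * card (edges Q) \<le> card (rest_edges G L)"
    using \<pi>0(2) by (simp add: edges_induced_rest[OF sg] edges_induced_rest[OF sG'])
  obtain H where H: "H \<in> free_graphs n \<F>" "verts H = L \<union> (V - L)" "joined H L"
    "core_edges H L = (`) \<tau> ` core_edges G' L'" "rest_edges H L = (`) \<pi> ` rest_edges G' L'"
    using transport_joined[OF G'(1,2) fam.simple_F \<tau>(1) \<pi>] by blast
  have VH: "verts H = V" using H(2) LV by blast
  have "inj_on ((`) \<pi>) (rest_edges G' L')"
    using inj_on_image_edges[OF sB', of \<pi>] \<pi>
    by (simp add: edges_induced_rest[OF sG'] bij_betw_def) (simp add: induced_def)
  then have "card (rest_edges H L) = card (rest_edges G' L')" unfolding H(5) by (rule card_image)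
  moreover have "real (card (rest_edges H L)) \<le>
    real (card (rest_edges G L)) + \<epsilon> * real (card (rest_edges G L - rest_edges H L))"
    by (rule swap_rest[OF H(1) VH H(3)]) (use \<tau>(2) H(4) in simp)
  moreover have "\<epsilon> * real (card (rest_edges G L - rest_edges H L)) \<le>
      \<epsilon> * (real (card (rest_edges G L)) - real (m * card (edges Q)))"
    using \<epsilon>_nonneg d unfolding H(5) by (intro mult_left_mono) linarith+
  ultimately show ?thesis by linarith
qed

text \<open>An extra core edge gains at least 1/2, even after discounting entries slightly below 1.
  Since \<open>\<sigma> * n \<le> 2 * k\<close>, giving up \<open>n / (8 * k)\<close> rest edges
  costs about 1/4; the error terms from \<open>k\<^sup>2\<close> and from \<open>\<epsilon>\<close>
  cost at most 1/16 each.\<close>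

lemma core_max:
  assumes G': "G' \<in> free_graphs n \<F>" "joined G' L'" "card L' = k"
    and xL: "\<And>v. v \<in> L \<Longrightarrow> x v \<ge> 1 - \<theta>" and \<theta>: "0 < \<theta>" "4 * real k ^ 2 * \<theta> \<le> 1"
    and edges: "real (card (edges G)) - real n / (8 * real k) \<le> real (card (edges G'))"
    and n: "32 * real k ^ 3 \<le> real n" and small: "32 * real k * C * \<epsilon> \<le> 1"
  shows "card (core_edges G' L') \<le> card (core_edges G L)"
proof (rule ccontr)
  define a where "a = real (card (core_edges G L))"
  define a' where "a' = real (card (core_edges G' L'))"
  define b where "b = real (card (rest_edges G L))"
  define b' where "b' = real (card (rest_edges G' L'))"
  assume "\<not> ?thesis"
  then have aa: "a + 1 \<le> a'" by (simp add: a_def a'_def)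
  have k1: "real k \<ge> 1" using k by simp
  have sG': "simple_graph G'" and cG': "card (verts G') = n" using G'(1) by (auto simp: free_graphs_def)
  have L'V: "L' \<subseteq> verts G'" using G'(2) by (simp add: joined_def)
  have fL': "finite L'" using L'V simple_graphD(1)[OF sG'] finite_subset by blast
  have "card (core_edges G' L') \<le> card L' * card L'"
    using card_edges_le_square[OF simple_induced[OF sG' L'V]] by (simp add: core_edges_def induced_def)
  then have "a' \<le> real (k * k)" unfolding a'_def G'(3) by (rule of_nat_mono)
  then have ak: "a' \<le> real k ^ 2" by (simp add: power2_eq_square)
  have "card (edges G) = card (core_edges G L) + k * (n - k) + card (rest_edges G L)"
    by (rule card_edges_joined[OF sg L(1) card_V L(2)])
  moreover have "card (edges G') = card (core_edges G' L') + k * (n - k) + card (rest_edges G' L')"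
    by (rule card_edges_joined[OF sG' G'(2) cG' G'(3)])
  ultimately have "b - b' \<le> real n / (8 * real k) + a' - a"
    using edges unfolding a_def a'_def b_def b'_def by simp
  then have bb: "b - b' \<le> real n / (8 * real k) + real k ^ 2" using ak by (simp add: a_def)
  have "{e \<in> edges G. e \<subseteq> V} = edges G" using simple_graphD(2)[OF sg] by blast
  then have "real (card (edges G)) \<le> C * real n" using sparse[of V] card_V by simp
  moreover have "card (rest_edges G L) \<le> card (edges G)"
    using finite_edges[OF sg] by (intro card_mono) (auto simp: rest_edges_def)
  ultimately have bC: "b \<le> C * real n" unfolding b_def by simp
  obtain \<tau> where \<tau>: "bij_betw \<tau> L' L" using finite_same_card_bij[OF fL' fL] G'(3) L(2) by auto
  have "card (verts G' - L') = card (V - L)"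
    using L'V fL' cG' G'(3) card_R by (simp add: card_Diff_subset)
  \<comment> \<open>Any bijection of the rests will do: even on all rest edges together the error
    \<open>\<epsilon>\<close> stays below the constant gain.\<close>
  then obtain \<pi> where \<pi>: "bij_betw \<pi> (verts G' - L') (V - L)"
    using finite_same_card_bij[of "verts G' - L'" "V - L"] simple_graphD(1)[OF sG'] fV by auto
  obtain H where H: "H \<in> free_graphs n \<F>" "verts H = L \<union> (V - L)" "joined H L"
    "core_edges H L = (`) \<tau> ` core_edges G' L'" "rest_edges H L = (`) \<pi> ` rest_edges G' L'"
    using transport_joined[OF G'(1,2) fam.simple_F \<tau> \<pi>] by blast
  have VH: "verts H = V" using H(2) LV by blast
  have sH: "simple_graph H" using H(1) by (simp add: free_graphs_def)
  have "inj_on ((`) \<tau>) (core_edges G' L')"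
    using inj_on_image_edges[OF simple_induced[OF sG' L'V], of \<tau>] \<tau>
    by (simp add: induced_def core_edges_def bij_betw_def)
  then have cH: "real (card (core_edges H L)) = a'" unfolding H(4) a'_def by (simp add: card_image)
  have "inj_on ((`) \<pi>) (rest_edges G' L')"
    using inj_on_image_edges[OF simple_induced[OF sG', of "verts G' - L'"], of \<pi>] \<pi>
    by (simp add: edges_induced_rest[OF sG'] bij_betw_def) (simp add: induced_def)
  then have rH: "real (card (rest_edges H L)) = b'" unfolding H(5) b'_def by (simp add: card_image)
  have core_pair: "\<exists>u w. e = {u, w} \<and> u \<noteq> w \<and> u \<in> L \<and> w \<in> L" if "e \<in> core_edges K L" "simple_graph K" for e K
    using that simple_graphD(3)[OF that(2), of e] by (auto simp: core_edges_def card_2_iff)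
  have \<theta>1: "\<theta> \<le> 1 / 4"
  proof -
    have "1 * \<theta> \<le> real k ^ 2 * \<theta>" using k1 \<theta>(1) by (intro mult_right_mono) auto
    then show ?thesis using \<theta>(2) by simp
  qed
  have 1: "a' * (1 - 2 * \<theta>) \<le> (\<Sum>e\<in>core_edges H L. \<Prod>v\<in>e. x v)"
  proof -
    have "a' * (1 - 2 * \<theta>) = (\<Sum>e\<in>core_edges H L. 1 - 2 * \<theta>)" by (simp add: cH[symmetric])
    also have "\<dots> \<le> (\<Sum>e\<in>core_edges H L. \<Prod>v\<in>e. x v)"
    proof (rule sum_mono)
      fix e assume "e \<in> core_edges H L"
      then obtain u w where uw: "e = {u, w}" "u \<noteq> w" "u \<in> L" "w \<in> L" using core_pair sH by blast
      have "1 - 2 * \<theta> \<le> (1 - \<theta>) * (1 - \<theta>)" by (simp add: algebra_simps)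
      also have "\<dots> \<le> x u * x w" using xL uw \<theta>1 by (intro mult_mono) (auto intro: x_nonneg)
      finally show "1 - 2 * \<theta> \<le> (\<Prod>v\<in>e. x v)" using uw by simp
    qed
    finally show ?thesis .
  qed
  have 2: "(\<Sum>e\<in>core_edges G L. \<Prod>v\<in>e. x v) \<le> a"
  proof -
    have "(\<Sum>e\<in>core_edges G L. \<Prod>v\<in>e. x v) \<le> (\<Sum>e\<in>core_edges G L. 1)"
      using LV by (intro sum_mono prod_le_1) (auto simp: core_edges_def x_nonneg intro!: x_le_1)
    then show ?thesis by (simp add: a_def)
  qed
  have 3: "b' * \<sigma> \<le> (\<Sum>e\<in>rest_edges H L. \<Prod>v\<in>e. x v)"
  proof -
    have "b' * \<sigma> = (\<Sum>e\<in>rest_edges H L. \<sigma>)" by (simp add: rH[symmetric])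
    also have "\<dots> \<le> (\<Sum>e\<in>rest_edges H L. \<Prod>v\<in>e. x v)"
      using rest_edge[OF sH VH] by (intro sum_mono prod_R) auto
    finally show ?thesis .
  qed
  have 4: "(\<Sum>e\<in>rest_edges G L. \<Prod>v\<in>e. x v) \<le> b * ((1 + \<epsilon>) * \<sigma>)"
  proof -
    have "(\<Sum>e\<in>rest_edges G L. \<Prod>v\<in>e. x v) \<le> (\<Sum>e\<in>rest_edges G L. (1 + \<epsilon>) * \<sigma>)"
      using rest_edge[OF sg refl] by (intro sum_mono prod_R) auto
    then show ?thesis by (simp add: b_def)
  qed
  have 5: "a' * (1 - 2 * \<theta>) + b' * \<sigma> \<le> a + b * ((1 + \<epsilon>) * \<sigma>)"
    using 1 2 3 4 compare_joined[OF H(1) VH H(3)] by linarith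
  have "a' * \<theta> \<le> real k ^ 2 * \<theta>" using ak \<theta>(1) by (intro mult_right_mono) auto
  then have 6: "1 / 2 \<le> \<sigma> * ((b - b') + \<epsilon> * b)" using 5 aa \<theta>(2) by (simp add: algebra_simps)
  have "\<sigma> * (real k * real n / 2) \<le> \<sigma> * l\<^sup>2" using half_n_le \<sigma>_pos by (intro mult_left_mono) auto
  also have "\<dots> = s\<^sup>2" using l_pos by (simp add: \<sigma>_def power_divide)
  also have "\<dots> \<le> real k ^ 2" using s_le s_pos by (intro power_mono) auto
  finally have \<sigma>n: "\<sigma> * real n \<le> 2 * real k" using k1 by (simp add: power2_eq_square)
  have "(b - b') + \<epsilon> * b \<le> real n / (8 * real k) + real k ^ 2 + \<epsilon> * (C * real n)"
    using bb mult_left_mono[OF bC \<epsilon>_nonneg] by simp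
  then have "\<sigma> * ((b - b') + \<epsilon> * b) \<le> \<sigma> * (real n / (8 * real k) + real k ^ 2 + \<epsilon> * (C * real n))"
    using \<sigma>_pos by (intro mult_left_mono) auto
  also have "\<dots> = \<sigma> * real n * (1 / (8 * real k) + \<epsilon> * C) + \<sigma> * real k ^ 2" by (simp add: algebra_simps)
  also have "\<dots> \<le> 2 * real k * (1 / (8 * real k) + \<epsilon> * C) + 1 / 16"
  proof (rule add_mono)
    show "\<sigma> * real n * (1 / (8 * real k) + \<epsilon> * C) \<le> 2 * real k * (1 / (8 * real k) + \<epsilon> * C)"
      using \<sigma>n C \<epsilon>_nonneg by (intro mult_right_mono) auto
    have "\<sigma> * real k ^ 2 * (32 * real k) = \<sigma> * (32 * real k ^ 3)"
      by (simp add: power2_eq_square power3_eq_cube)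
    also have "\<dots> \<le> \<sigma> * real n" using n \<sigma>_pos by (intro mult_left_mono) auto
    also have "\<dots> \<le> 1 / 16 * (32 * real k)" using \<sigma>n by simp
    finally show "\<sigma> * real k ^ 2 \<le> 1 / 16" by (rule mult_right_le_imp_le) (use k1 in simp)
  qed
  also have "\<dots> = 1 / 4 + 2 * real k * C * \<epsilon> + 1 / 16" using k1 by (simp add: field_simps)
  also have "\<dots> < 1 / 2" using small by simp
  finally show False using 6 by simp
qed

end

section \<open>Structure and comparison of the rests\<close>

context extremal_join begin

context
  fixes r c0 :: real
  assumes rest_bound: "\<And>G' L'. G' \<in> free_graphs n \<F> \<Longrightarrow> joined G' L' \<Longrightarrow> card L' = k \<Longrightarrow>
      real (card (rest_edges G' L')) \<le> r * real n + c0"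
    and n_large: "4 * (r * real n + c0) < 3 * (real n - real k - 3)"
begin

text \<open>Once \<open>t\<close> copies of \<open>Q\<close> occur, \<open>replicate_free\<close>
  permits any number, so the whole rest can be refilled with copies while the core is untouched. The
  result is again a competitor for \<open>rest_bound\<close> and
  \<open>rest_compare\<close>.\<close>

lemma replicated_graph:
  assumes G': "G' \<in> free_graphs n \<F>" "joined G' L'" "card L' = k"
    and Q: "simple_graph Q" "verts Q \<noteq> {}"
    and cp: "contains (induced G' (verts G' - L')) (copies Q t)"
    and m: "m * card (verts Q) \<le> n - k"
  obtains G'' where "G'' \<in> free_graphs n \<F>" "joined G'' L'" "verts G'' = verts G'"
    "core_edges G'' L' = core_edges G' L'" "card (rest_edges G'' L') = m * card (edges Q)"
    "contains (induced G'' (verts G'' - L')) (copies Q m)"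
proof -
  have sG': "simple_graph G'" and cG': "card (verts G') = n" and free: "free_of \<F> G'"
    using G'(1) by (auto simp: free_graphs_def)
  have L'V: "L' \<subseteq> verts G'" using G'(2) by (simp add: joined_def)
  have fL': "finite L'" using L'V simple_graphD(1)[OF sG'] finite_subset by blast
  have "m * card (verts Q) \<le> card (verts G' - L')"
    using m L'V fL' G'(3) cG' by (simp add: card_Diff_subset)
  moreover have "finite (verts G' - L')" using simple_graphD(1)[OF sG'] by simp
  ultimately obtain B m' where B: "simple_graph B" "verts B = verts G' - L'" "contains B (copies Q m)"
    "card (edges B) = m * card (edges Q)" "contains (copies Q m') B"
    using place_copies[OF Q] by metis
  let ?H = "join_on (verts G') L' (core_edges G' L') (edges B)"
  have fr: "free_of \<F> ?H"
    by (rule replicate_free[OF sG' free G'(2) _ cp B(1,2,5)]) (use fam.simple_F fam.size_F in auto)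
  have BR: "e \<subseteq> verts G' - L'" "card e = 2" if "e \<in> edges B" for e
    using simple_graphD(2,3)[OF B(1) that] B(2) by auto
  have sH: "simple_graph ?H"
    unfolding simple_graph_def
  proof (intro conjI subsetI)
    show "finite (verts ?H)" using simple_graphD(1)[OF sG'] by (simp add: join_on_def)
    fix e assume "e \<in> edges ?H"
    then have "e \<in> edges G' \<or> e \<in> edges B"
      using G'(2) by (auto simp: join_on_def joined_def core_edges_def)
    then show "e \<in> {e. e \<subseteq> verts ?H \<and> card e = 2}"
      using simple_graphD(2,3)[OF sG', of e] BR[of e] by (auto simp: join_on_def)
  qed
  have core: "core_edges ?H L' = core_edges G' L'"
  proof -
    have "\<not> e \<subseteq> L'" if "e \<in> edges B" for e using BR[OF that] by (auto simp: card_2_iff)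
    then show ?thesis by (auto simp: core_edges_def join_on_def cross_def)
  qed
  have rest: "rest_edges ?H L' = edges B"
  proof -
    have "e \<inter> L' \<noteq> {}" if "e \<in> core_edges G' L'" for e
      using that simple_graphD(3)[OF sG', of e] by (auto simp: core_edges_def card_2_iff)
    then show ?thesis using BR(1) by (auto simp: rest_edges_def join_on_def cross_def)
  qed
  have "induced ?H (verts ?H - L') = B"
    using edges_induced_rest[OF sH, of L'] rest B(2) by (cases B) (simp add: induced_def join_on_def)
  moreover have "?H \<in> free_graphs n \<F>" using fr sH cG' by (simp add: free_graphs_def join_on_def)
  ultimately show ?thesis
    using that[of ?H] joined_join_on[OF L'V] core rest B(3,4) by (simp add: join_on_def)
qed

text \<open>Refilling the rest would give \<open>3 * ((n - k) div q)\<close> edges, at least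
  \<open>3 / 4 * (n - k - 3)\<close> with the 3 lost to rounding. By \<open>n_large\<close> this
  exceeds the bound imposed on every joined competitor.\<close>

lemma no_large_pattern:
  fixes Q :: "nat graph" and q :: nat
  assumes G': "G' \<in> free_graphs n \<F>" "joined G' L'" "card L' = k"
    and Q: "simple_graph Q" "verts Q = {..<q}" "card (edges Q) = 3" "q = 3 \<or> q = 4"
  shows "\<not> contains (induced G' (verts G' - L')) (copies Q t)"
proof
  assume cp: "contains (induced G' (verts G' - L')) (copies Q t)"
  have "q > 0" using Q(4) by linarith
  then have q: "card (verts Q) = q" "verts Q \<noteq> {}" unfolding Q(2) by (simp_all add: lessThan_empty_iff)
  obtain G'' where "G'' \<in> free_graphs n \<F>" "joined G'' L'"
    "card (rest_edges G'' L') = ((n - k) div q) * card (edges Q)"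
    by (rule replicated_graph[OF G' Q(1) q(2) cp, of "(n - k) div q"]) (simp add: q)
  then have "real ((n - k) div q * 3) \<le> r * real n + c0" using rest_bound[of G'' L'] G'(3) Q(3) by metis
  moreover have "real n - real k \<le> 4 * real ((n - k) div q) + 3"
  proof -
    have "n - k \<le> 4 * ((n - k) div q) + 3" using Q(4) by auto
    then show ?thesis by linarith
  qed
  ultimately show False using n_large by simp
qed

lemma rest_degree:
  assumes G': "G' \<in> free_graphs n \<F>" "joined G' L'" "card L' = k" and v: "v \<in> verts G' - L'"
  shows "card (nbr (induced G' (verts G' - L')) v) \<le> t"
proof -
  have sG': "simple_graph G'" and free: "free_of \<F> G'" using G'(1) by (auto simp: free_graphs_def)
  have L'V: "L' \<subseteq> verts G'" using G'(2) by (simp add: joined_def)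
  have fL': "finite L'" using L'V simple_graphD(1)[OF sG'] finite_subset by blast
  have "nbr (induced G' (verts G' - L')) v \<subseteq> common G' (insert v L')"
  proof
    fix z assume "z \<in> nbr (induced G' (verts G' - L')) v"
    then have z: "z \<in> verts G' - L'" "v \<in> nbr G' z"
      by (auto simp: nbr_def induced_def insert_commute)
    moreover have "u \<in> nbr G' z" if "u \<in> L'" for u
      using joined_edge[OF G'(2) that, of z] z by (simp add: nbr_def insert_commute)
    ultimately show "z \<in> common G' (insert v L')" by (auto simp: common_def)
  qed
  then have "card (nbr (induced G' (verts G' - L')) v) \<le> card (common G' (insert v L'))"
    using simple_graphD(1)[OF sG'] by (intro card_mono) (auto simp: common_def)
  also have "\<dots> < t" using v L'V fL' G'(3) by (intro fam.no_K[OF sG' free]) auto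
  finally show ?thesis by simp
qed

text \<open>Up to a bounded deletion the components are isolated vertices, edges and three-vertex
  paths; the number \<open>m\<close> of such paths controls the excess of the edge count over half
  the vertices.\<close>

lemma rest_structure:
  assumes G': "G' \<in> free_graphs n \<F>" "joined G' L'" "card L' = k"
  obtains m where "contains (induced G' (verts G' - L')) (copies path3 m)"
    "2 * card (rest_edges G' L') \<le> (n - k) + m + 22 * t * t" "3 * m \<le> n - k"
    "2 * m \<le> card (rest_edges G' L')"
proof -
  have sG': "simple_graph G'" and cG': "card (verts G') = n" using G'(1) by (auto simp: free_graphs_def)
  have L'V: "L' \<subseteq> verts G'" using G'(2) by (simp add: joined_def)
  have fL': "finite L'" using L'V simple_graphD(1)[OF sG'] finite_subset by blast
  let ?B = "induced G' (verts G' - L')"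
  have sB: "simple_graph ?B" by (rule simple_induced[OF sG']) auto
  have VB: "card (verts ?B) = n - k" using L'V fL' G'(3) cG' by (simp add: induced_def card_Diff_subset)
  have deg: "card (nbr ?B v) \<le> t" if "v \<in> verts ?B" for v
    using rest_degree[OF G', of v] that by (simp add: induced_def)
  have n1: "\<not> contains ?B (copies tri3 t)"
    by (rule no_large_pattern[OF G' simple_patterns(5), of 3]) (simp_all add: card_edges_patterns, simp add: tri3_def)
  have n2: "\<not> contains ?B (copies path4 t)"
    by (rule no_large_pattern[OF G' simple_patterns(3), of 4]) (simp_all add: card_edges_patterns, simp add: path4_def)
  have n3: "\<not> contains ?B (copies claw t)"
    by (rule no_large_pattern[OF G' simple_patterns(4), of 4]) (simp_all add: card_edges_patterns, simp add: claw_def)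
  obtain m where m: "contains ?B (copies path3 m)" "2 * card (edges ?B) \<le> card (verts ?B) + m + 22 * t * t"
    using few_large_patterns_structure[OF sB deg n1 n2 n3] by metis
  have "m * card (edges path3) \<le> card (edges ?B)" "m * card (verts path3) \<le> card (verts ?B)"
    using contains_copies_card[OF m(1) sB simple_patterns(2)] by auto
  then have "3 * m \<le> n - k" "2 * m \<le> card (rest_edges G' L')"
    using VB edges_induced_rest[OF sG', of L'] by (simp_all add: card_edges_patterns) (simp_all add: path3_def)
  then show ?thesis using that[OF m(1)] m(2) VB edges_induced_rest[OF sG', of L'] by simp
qed

text \<open>It suffices to find a packing common to both rests that misses at most
  \<open>55 * W\<close> edges of \<open>G\<close>. If three-vertex paths are rare in both, single
  edges serve. Otherwise one rest can be refilled with such paths, and comparison with the refilled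
  graph shows that both rests are already nearly full of them.\<close>

lemma rest_max:
  assumes G': "G' \<in> free_graphs n \<F>" "joined G' L'" "card L' = k"
    and \<tau>: "bij_betw \<tau> L' L" "core_edges G L \<subseteq> (`) \<tau> ` core_edges G' L'"
    and small: "6 * \<epsilon> \<le> 1" "55 * (1 + 11 * real t ^ 2) * \<epsilon> < 1"
  shows "card (rest_edges G' L') \<le> card (rest_edges G L)"
proof (rule ccontr)
  define b where "b = real (card (rest_edges G L))"
  define b' where "b' = real (card (rest_edges G' L'))"
  assume "\<not> ?thesis"
  then have bb: "b + 1 \<le> b'" by (simp add: b_def b'_def)
  have sG': "simple_graph G'" using G'(1) by (auto simp: free_graphs_def)
  let ?B = "induced G (V - L)" and ?B' = "induced G' (verts G' - L')"
  have sB: "simple_graph ?B" by (rule simple_induced[OF sg]) auto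
  have sB': "simple_graph ?B'" by (rule simple_induced[OF sG']) auto
  have degB: "card (nbr ?B v) \<le> t" if "v \<in> verts ?B" for v
    using rest_degree[OF G_free L, of v] that by (simp add: induced_def)
  have degB': "card (nbr ?B' v) \<le> t" if "v \<in> verts ?B'" for v
    using rest_degree[OF G', of v] that by (simp add: induced_def)
  have eB: "card (edges ?B) = card (rest_edges G L)" "card (edges ?B') = card (rest_edges G' L')"
    using edges_induced_rest[OF sg, of L] edges_induced_rest[OF sG', of L'] by auto
  define W where "W = 1 + 11 * real t ^ 2"
  have W: "W \<ge> 1" by (simp add: W_def)
  have W\<epsilon>: "55 * W * \<epsilon> < 1" using small(2) by (simp add: W_def)
  have contra: False if Q: "simple_graph Q" "contains ?B (copies Q m)" "contains ?B' (copies Q m)"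
    and d: "b - real (m * card (edges Q)) \<le> 55 * W" for Q :: "nat graph" and m
  proof -
    have "b' \<le> b + \<epsilon> * (b - real (m * card (edges Q)))"
      unfolding b_def b'_def by (rule rest_compare[OF G' \<tau> Q])
    also have "\<epsilon> * (b - real (m * card (edges Q))) \<le> \<epsilon> * (55 * W)"
      using d \<epsilon>_nonneg by (rule mult_left_mono)
    finally show False using bb W\<epsilon> by (simp add: mult_ac)
  qed
  show False
  proof (cases "contains ?B (copies path3 t) \<or> contains ?B' (copies path3 t)")
    case False
    obtain m where m: "contains ?B (copies single_edge m)" "card (edges ?B) \<le> m + 3 * t * t"
      using few_path3_structure[OF sB degB] False by metis
    obtain m' where m': "contains ?B' (copies single_edge m')" "card (edges ?B') \<le> m' + 3 * t * t"
      using few_path3_structure[OF sB' degB'] False by metis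
    have tt: "real (3 * t * t) = 3 * real t ^ 2" by (simp add: power2_eq_square)
    have "b \<le> real m + real (3 * t * t)" "b' \<le> real m' + real (3 * t * t)"
      using m(2) m'(2) eB unfolding b_def b'_def by linarith+
    define p where "p = min m m'"
    have p: "p \<le> m" "p \<le> m'" by (auto simp: p_def)
    \<comment> \<open>Since \<open>b \<le> b'\<close>, both matchings have at least
      \<open>b - 3 * t\<^sup>2\<close> edges.\<close>
    have "b \<le> real m + 3 * real t ^ 2" "b \<le> real m' + 3 * real t ^ 2"
      using \<open>b \<le> real m + real (3 * t * t)\<close> \<open>b' \<le> real m' + real (3 * t * t)\<close> bb tt by auto
    then have "b \<le> real p + 3 * real t ^ 2" by (simp add: p_def min_def)
    moreover have "real (p * card (edges single_edge)) = real p" by (simp add: card_edges_patterns)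
    ultimately have "b - real (p * card (edges single_edge)) \<le> 3 * real t ^ 2" by linarith
    also have "\<dots> \<le> 55 * W" by (simp add: W_def)
    finally show False
      using contra[OF simple_patterns(1)] contains_copies_le[OF m(1) p(1)] contains_copies_le[OF m'(1) p(2)]
      by blast
  next
    case True
    define m0 where "m0 = (n - k) div 3"
    have m0: "3 * m0 \<le> n - k" "n - k \<le> 3 * m0 + 2" by (auto simp: m0_def)
    have vp: "verts path3 \<noteq> {}" "card (verts path3) = 3" by (auto simp: path3_def lessThan_empty_iff)
    have m0v: "m0 * card (verts path3) \<le> n - k" using m0(1) vp by simp
    obtain q where q: "contains ?B (copies path3 q)"
      "2 * card (rest_edges G L) \<le> (n - k) + q + 22 * t * t" "3 * q \<le> n - k" "2 * q \<le> card (rest_edges G L)"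
      by (rule rest_structure[OF G_free L])
    obtain q' where q': "contains ?B' (copies path3 q')"
      "2 * card (rest_edges G' L') \<le> (n - k) + q' + 22 * t * t" "3 * q' \<le> n - k"
      by (rule rest_structure[OF G'])
    have qm: "q \<le> m0" "q' \<le> m0" using q(3) q'(3) m0(2) by linarith+
    have tt: "real (22 * t * t) = 2 * (W - 1)" by (simp add: power2_eq_square W_def)
    have N3: "real (n - k) \<le> 3 * real m0 + 2" using m0(2) by linarith
    have "2 * b \<le> real (n - k) + real q + real (22 * t * t)"
      unfolding b_def using q(2) by linarith
    then have b_up: "2 * b \<le> 3 * real m0 + real q + 2 * W" using N3 unfolding tt by simp
    have "2 * b' \<le> real (n - k) + real q' + real (22 * t * t)"
      unfolding b'_def using q'(2) by linarith
    then have b'_up: "2 * b' \<le> 3 * real m0 + real q' + 2 * W" using N3 unfolding tt by simp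
    have b_low: "2 * real q \<le> b" unfolding b_def using q(4) by linarith
    \<comment> \<open>Whichever rest is refilled, the core of \<open>G3\<close> still covers that of
      \<open>G\<close>, so \<open>rest_compare\<close> applies along the \<open>q\<close> paths
      already present in \<open>G\<close>.\<close>
    have "2 * real m0 \<le> b + \<epsilon> * (b - 2 * real q)"
    proof -
      have "\<exists>G3 L3 \<tau>3. G3 \<in> free_graphs n \<F> \<and> joined G3 L3 \<and> card L3 = k \<and> bij_betw \<tau>3 L3 L \<and>
         core_edges G L \<subseteq> (`) \<tau>3 ` core_edges G3 L3 \<and> card (rest_edges G3 L3) = m0 * card (edges path3) \<and>
         contains (induced G3 (verts G3 - L3)) (copies path3 m0)"
        using True
      proof
        assume c: "contains ?B (copies path3 t)"
        obtain G3 where G3: "G3 \<in> free_graphs n \<F>" "joined G3 L" "verts G3 = V"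
          "core_edges G3 L = core_edges G L" "card (rest_edges G3 L) = m0 * card (edges path3)"
          "contains (induced G3 (verts G3 - L)) (copies path3 m0)"
          by (rule replicated_graph[OF G_free L simple_patterns(2) vp(1) c m0v])
        show ?thesis
          using G3 L(2) by (intro exI[of _ G3] exI[of _ L] exI[of _ id]) simp
      next
        assume c: "contains ?B' (copies path3 t)"
        obtain G3 where G3: "G3 \<in> free_graphs n \<F>" "joined G3 L'" "verts G3 = verts G'"
          "core_edges G3 L' = core_edges G' L'" "card (rest_edges G3 L') = m0 * card (edges path3)"
          "contains (induced G3 (verts G3 - L')) (copies path3 m0)"
          by (rule replicated_graph[OF G' simple_patterns(2) vp(1) c m0v])
        show ?thesis
          using G3 G'(3) \<tau> by (intro exI[of _ G3] exI[of _ L'] exI[of _ \<tau>]) simp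
      qed
      then obtain G3 L3 \<tau>3 where G3: "G3 \<in> free_graphs n \<F>" "joined G3 L3" "card L3 = k"
        "bij_betw \<tau>3 L3 L" "core_edges G L \<subseteq> (`) \<tau>3 ` core_edges G3 L3"
        "card (rest_edges G3 L3) = m0 * card (edges path3)"
        "contains (induced G3 (verts G3 - L3)) (copies path3 m0)" by blast
      have "real (card (rest_edges G3 L3)) \<le> b + \<epsilon> * (b - real (q * card (edges path3)))"
        unfolding b_def
        by (rule rest_compare[OF G3(1-5) simple_patterns(2) q(1) contains_copies_le[OF G3(7) qm(1)]])
      then show ?thesis using G3(6) by (simp add: card_edges_patterns mult.commute)
    qed
    also have "\<epsilon> * (b - 2 * real q) \<le> 1 / 6 * (b - 2 * real q)"
      using small(1) b_low by (intro mult_right_mono) auto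
    finally have "2 * real m0 \<le> b + 1 / 6 * (b - 2 * real q)" by simp
    then have "12 * real m0 \<le> 7 * b - 2 * real q" by (simp add: field_simps)
    \<comment> \<open>Eliminating \<open>b\<close> by \<open>b_up\<close> gives
      \<open>3 * (m0 - q) \<le> 14 * W\<close>.\<close>
    then have q_low: "real m0 - real q \<le> 5 * W" using b_up W by argo
    \<comment> \<open>Here 22 = 20 + 2: \<open>2 * b'\<close> exceeds \<open>4 * q\<close>, which is
      at least \<open>4 * m0 - 20 * W\<close>, and \<open>b'_up\<close> adds
      \<open>2 * W\<close>.\<close>
    have q'_low: "real m0 - real q' \<le> 22 * W" using bb b'_up b_low q_low W by linarith
    \<comment> \<open>From \<open>b \<le> 2 * m0 + W\<close> and the two bounds above the difference
      is even at most \<open>45 * W\<close>.\<close>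
    have "b - 2 * real (min q q') \<le> 55 * W"
      using b_up q_low q'_low qm W by (simp add: min_def)
    then have "b - real (min q q' * card (edges path3)) \<le> 55 * W"
      by (simp add: card_edges_patterns mult.commute)
    then show False
      using contra[OF simple_patterns(2), of "min q q'"] contains_copies_le[OF q(1), of "min q q'"]
        contains_copies_le[OF q'(1), of "min q q'"] by simp
  qed
qed

end

end

section \<open>Lower bound on the spectral radius, choice of thresholds, assembly\<close>

context degenerate_family begin

lemma join_in_free_graphs:
  assumes V: "finite V" "card V = n" "L \<subseteq> V" "card L = k" and E: "\<And>e. e \<in> E \<Longrightarrow> e \<subseteq> L \<and> card e = 2"
    and M: "free_of (M_fam \<F>) (Graph L E)"
  shows "join_on V L E {} \<in> free_graphs n \<F>"
proof -
  have fL: "finite L" using V finite_subset by blast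
  have "e \<subseteq> L \<and> e \<noteq> {}" if "e \<in> E" for e using E[OF that] by auto
  then have "free_of \<F> (join_on V L E {})" using V(4) M by (intro join_free[OF fL]) auto
  moreover have "simple_graph (join_on V L E {})"
    unfolding simple_graph_def
  proof (intro conjI subsetI)
    fix e assume "e \<in> edges (join_on V L E {})"
    then have "e \<in> E \<or> e \<in> cross L (V - L)" by (simp add: join_on_def)
    then show "e \<in> {e. e \<subseteq> verts (join_on V L E {}) \<and> card e = 2}"
      using E[of e] V(3) by (auto simp: join_on_def cross_def card_2_iff)
  qed (simp add: join_on_def V(1))
  ultimately show ?thesis using V(2) by (simp add: free_graphs_def join_on_def)
qed

lemma rho_join_ge:
  assumes H: "simple_graph H" "joined H L" and n: "card (verts H) = n" "card L = k" "k < n"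
  shows "sqrt (real k * (real n - real k)) \<le> rho H"
proof -
  define p where "p = real k" 
  define q where "q = real n - real k"
  have pq: "p > 0" "q > 0" using k n(3) by (auto simp: p_def q_def)
  have fV: "finite (verts H)" using H(1) simple_graphD(1) by blast
  have LV: "L \<subseteq> verts H" using H(2) by (simp add: joined_def)
  have fL: "finite L" using LV fV finite_subset by blast
  have cR: "real (card (verts H - L)) = q"
    using LV fL n by (simp add: card_Diff_subset q_def of_nat_diff)
  \<comment> \<open>Up to scaling, the Perron vector of the complete bipartite graph with parts
    \<open>k\<close> and \<open>n - k\<close>; its crossing edges alone give the bound.\<close>
  define y where "y v = (if v \<in> L then sqrt q else sqrt p)" for v
  have y0: "0 \<le> y v" for v using pq by (simp add: y_def)
  have cc: "real (card (cross L (verts H - L))) = p * q"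
    using card_cross[of L "verts H - L"] fL fV n(2) cR by (auto simp: p_def)
  have "(\<Sum>e\<in>cross L (verts H - L). sqrt (p * q)) \<le> (\<Sum>e\<in>cross L (verts H - L). \<Prod>v\<in>e. y v)"
  proof (rule sum_mono)
    fix e assume "e \<in> cross L (verts H - L)"
    then obtain u v where uv: "e = {u, v}" "u \<in> L" "v \<notin> L" by (auto simp: cross_def)
    moreover have "u \<noteq> v" using uv by blast
    ultimately show "sqrt (p * q) \<le> (\<Prod>v\<in>e. y v)" by (simp add: y_def real_sqrt_mult)
  qed
  also have "\<dots> \<le> (\<Sum>e\<in>edges H. \<Prod>v\<in>e. y v)"
    using H(2) finite_edges[OF H(1)] y0 by (intro sum_mono2 prod_nonneg) (auto simp: joined_def)
  finally have "2 * (p * q * sqrt (p * q)) \<le> qform (adj H) (verts H) y"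
    using qform_adj[OF H(1), of y] cc by simp
  also have "\<dots> \<le> rho H * (\<Sum>v\<in>verts H. (y v)\<^sup>2)" by (rule qform_le_rho[OF H(1)])
  also have "(\<Sum>v\<in>verts H. (y v)\<^sup>2) = (\<Sum>v\<in>verts H - L. (y v)\<^sup>2) + (\<Sum>v\<in>L. (y v)\<^sup>2)"
    by (rule sum.subset_diff[OF LV fV])
  also have "(\<Sum>v\<in>verts H - L. (y v)\<^sup>2) = (\<Sum>v\<in>verts H - L. p)"
    using pq by (intro sum.cong refl) (simp add: y_def)
  also have "(\<Sum>v\<in>L. (y v)\<^sup>2) = (\<Sum>v\<in>L. q)" using pq by (intro sum.cong refl) (simp add: y_def)
  finally have "sqrt (p * q) * (2 * (p * q)) \<le> rho H * (2 * (p * q))"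
    using cR n(2) by (simp add: p_def algebra_simps)
  then have "sqrt (p * q) \<le> rho H" by (rule mult_right_le_imp_le) (use pq in simp)
  then show ?thesis by (simp add: p_def q_def)
qed

lemma Ex_sp_rho_ge:
  assumes G: "G \<in> Ex_sp n \<F>" and n: "k < n"
  shows "sqrt (real k * (real n - real k)) \<le> rho G"
proof -
  have sG: "simple_graph G" "card (verts G) = n" using G by (auto simp: Ex_sp_def free_graphs_def)
  have fV: "finite (verts G)" using sG simple_graphD(1) by blast
  obtain L where L: "L \<subseteq> verts G" "card L = k"
    using obtain_subset_with_card_n[of k "verts G"] sG(2) n by (metis less_imp_le)
  have H: "join_on (verts G) L {} {} \<in> free_graphs n \<F>"
    by (rule join_in_free_graphs[OF fV sG(2) L _ edgeless_free]) simp
  have "sqrt (real k * (real n - real k)) \<le> rho (join_on (verts G) L {} {})"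
    by (rule rho_join_ge[OF _ joined_join_on[OF L(1)] _ L(2) n])
       (use H in \<open>auto simp: free_graphs_def\<close>)
  also have "\<dots> \<le> rho G" using G H by (auto simp: Ex_sp_def)
  finally show ?thesis .
qed

text \<open>The threshold \<open>n0\<close> is uniform in \<open>G\<close> and \<open>x\<close>. The
  parameter \<open>E\<close> prescribes how small \<open>\<epsilon>\<close> must be for the later
  comparisons.\<close>

lemma extremal_structure:
  fixes C \<theta> E :: real
  assumes C: "C \<ge> 1" and sparse: "\<And>m G'. G' \<in> free_graphs m \<F> \<Longrightarrow> real (card (edges G')) \<le> C * real m"
    and \<theta>: "0 < \<theta>" "4 * real (k + 1) * \<theta> \<le> 1" "256 * C * real k ^ 3 * \<theta> \<le> 1" "14 * real (k * t) * \<theta> \<le> 1"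
    and E: "E \<ge> 1"
  obtains n0 where "\<And>n G x. n \<ge> n0 \<Longrightarrow> G \<in> Ex_sp n \<F> \<Longrightarrow> perron G x \<Longrightarrow>
    \<exists>L. extremal_join \<F> k t G x n C L \<and> (\<forall>v\<in>L. 1 - \<theta> \<le> x v) \<and> extremal_join.\<epsilon> t G * E \<le> 1"
proof -
  define \<eta> where "\<eta> = \<theta> / (4 * C)"
  have \<eta>: "\<eta> > 0" "4 * C * \<eta> \<le> \<theta>" using \<theta> C by (auto simp: \<eta>_def)
  define m where "m = nat \<lceil>16 * C\<^sup>2 / \<eta>\<rceil>"
  have "16 * C\<^sup>2 / \<eta> \<le> real m" unfolding m_def by linarith
  then have m: "16 * C\<^sup>2 \<le> real m * \<eta>" using \<eta>(1) by (simp add: pos_divide_le_eq)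
  \<comment> \<open>A lower bound wanted for the spectral radius: the first summand serves the
    level-set bootstrap, the others make \<open>\<epsilon>\<close> small. It is reached once
    \<open>2 * \<Lambda>\<^sup>2 \<le> n\<close>, because the squared radius is at least
    \<open>n / 2\<close>.\<close>
  define \<Lambda> where "\<Lambda> = 512 * C ^ 3 / \<eta>\<^sup>2 + real t + 3 * E * real t + 1"
  have \<Lambda>0: "\<Lambda> > 0" using \<eta> C E by (simp add: \<Lambda>_def add_nonneg_pos)
  define K where "K = 2 * (real k ^ 2 + real (2 ^ m * t * m) + real (k * t)) / \<theta>"
  define n0 where "n0 = nat \<lceil>2 * \<Lambda>\<^sup>2\<rceil> + nat \<lceil>K\<rceil> + 2 * k + 2 * t + k + 3"
  have main: "\<exists>L. extremal_join \<F> k t G x n C L \<and> (\<forall>v\<in>L. 1 - \<theta> \<le> x v) \<and> extremal_join.\<epsilon> t G * E \<le> 1"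
    if n: "n \<ge> n0" and G: "G \<in> Ex_sp n \<F>" and pf: "perron G x" for n G x
  proof -
    have nn: "2 * \<Lambda>\<^sup>2 \<le> real n" "K \<le> real n" "2 * k \<le> n" "k < n" "2 * t + 2 \<le> n"
      using n unfolding n0_def by linarith+
    have Gf: "G \<in> free_graphs n \<F>" and opt: "\<And>G'. G' \<in> free_graphs n \<F> \<Longrightarrow> rho G' \<le> rho G"
      using G by (auto simp: Ex_sp_def)
    have sG: "simple_graph G" "card (verts G) = n" "free_of \<F> G" using Gf by (auto simp: free_graphs_def)
    have kn: "0 \<le> real k * (real n - real k)" using nn(4) by simp
    have rge: "sqrt (real k * (real n - real k)) \<le> rho G" by (rule Ex_sp_rho_ge[OF G nn(4)])
    have r0: "0 \<le> rho G" using rge kn real_sqrt_ge_zero order_trans by blast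
    have r2: "real k * (real n - real k) \<le> (rho G)\<^sup>2" using rge r0 kn by (metis real_sqrt_le_iff real_sqrt_abs abs_of_nonneg)
    interpret sp: sparse_perron G x n k t C
    proof
      show "real (card {e \<in> edges G. e \<subseteq> S}) \<le> C * real (card S)" if S: "S \<subseteq> verts G" for S
      proof -
        have "induced G S \<in> free_graphs (card S) \<F>"
          unfolding free_graphs_def
        proof (intro CollectI conjI)
          show "simple_graph (induced G S)" by (rule simple_induced[OF sG(1) S])
          show "card (verts (induced G S)) = card S" by (simp add: induced_def)
          show "free_of \<F> (induced G S)"
            using sG(3) contains_mono[of "induced G S" _ G] S by (auto simp: free_of_def induced_def)
        qed
        from sparse[OF this] show ?thesis by (simp add: induced_def)
      qed
      show "card (common G S) < t" if "S \<subseteq> verts G" "card S = k + 1" for S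
        by (rule no_K[OF sG(1,3) that])
    qed (use sG pf k t nn r0 r2 C in auto)
    have "\<Lambda>\<^sup>2 \<le> (rho G)\<^sup>2"
    proof -
      have "1 * real n \<le> real k * real n" using k by (intro mult_right_mono) auto
      then have "real n / 2 \<le> real k * real n / 2" by simp
      then show ?thesis using sp.half_n_le nn(1) by linarith
    qed
    then have r\<Lambda>: "\<Lambda> \<le> rho G" using r0 by (rule power2_le_imp_le)
    have "512 * C ^ 3 / \<eta>\<^sup>2 \<le> rho G" using r\<Lambda> E unfolding \<Lambda>_def by (smt (verit) mult_nonneg_nonneg of_nat_0_le_iff)
    then have big: "512 * C ^ 3 \<le> rho G * \<eta>\<^sup>2" using \<eta>(1) by (simp add: pos_divide_le_eq)
    have Kn: "2 * (real k ^ 2 + real (2 ^ m * t * m) + real (k * t)) \<le> \<theta> * real n"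
      using nn(2) \<theta>(1) unfolding K_def by (simp add: pos_divide_le_eq mult.commute)
    obtain L where L: "L \<subseteq> verts G" "card L = k" "\<And>v. v \<in> L \<Longrightarrow> x v \<ge> 1 - \<theta>"
      "\<And>v. v \<in> L \<Longrightarrow> (1 - 2 * \<theta>) * real n \<le> real (card (nbr G v))"
      "\<And>v. v \<in> verts G - L \<Longrightarrow> x v \<le> 6 * real k * \<theta>"
      using sp.dominant_set[OF \<eta>(1) big m \<theta>(1,2) \<eta>(2) Kn] by metis
    have cm: "t < card (common G L)"
    proof -
      have "real (card (verts G - common G L)) \<le> real k * (2 * \<theta> * real n)"
        using sp.card_not_common[OF L(1) L(4)] L(2) by simp
      also have "\<dots> = (4 * real k * \<theta>) * (real n / 2)" by simp
      also have "\<dots> \<le> 1 * (real n / 2)"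
      proof (rule mult_right_mono)
        have "4 * real k * \<theta> \<le> 4 * real (k + 1) * \<theta>" using \<theta>(1) by (intro mult_right_mono) auto
        then show "4 * real k * \<theta> \<le> 1" using \<theta>(2) by simp
      qed simp
      finally have "real n / 2 \<le> real (card (common G L))"
        using sp.fV sG(2) card_Diff_subset[of "common G L" "verts G"] card_mono[OF sp.fV, of "common G L"]
        by (auto simp: common_def of_nat_diff)
      then show ?thesis using nn(5) by linarith
    qed
    have full: "L \<subseteq> nbr G v" if v: "v \<in> verts G - L" for v
    proof (rule sp.dominant_set_joined[OF L \<theta>(1,3,4) _ v])
      fix u assume u: "u \<in> verts G - L" "\<not> L \<subseteq> nbr G u"
      have "free_of \<F> (rewire G u L)"
        by (rule rewire_free[OF sG(1,3) L(1) u cm]) (use simple_F size_F in auto)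
      then have "rewire G u L \<in> free_graphs n \<F>"
        using simple_rewire[OF sG(1) u(1) L(1)] sG(2) by (simp add: free_graphs_def rewire_def)
      then show "rho (rewire G u L) \<le> rho G" by (rule opt)
    qed
    have "{u, v} \<in> edges G" if uv: "u \<in> L" "v \<in> verts G - L" for u v
    proof -
      have "u \<in> nbr G v" using full[OF uv(2)] uv(1) by blast
      then show ?thesis by (simp add: nbr_def insert_commute)
    qed
    then have jn: "joined G L" using L(1) by (auto simp: joined_def cross_def)
    have rt: "rho G - real t \<ge> 3 * E * real t" "real t < rho G"
    proof -
      have "0 \<le> 512 * C ^ 3 / \<eta>\<^sup>2" using C by simp
      then show 1: "rho G - real t \<ge> 3 * E * real t" using r\<Lambda> unfolding \<Lambda>_def by linarith
      have "0 \<le> 3 * E * real t" using E by simp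
      then show "real t < rho G" using r\<Lambda> \<open>0 \<le> 512 * C ^ 3 / \<eta>\<^sup>2\<close> unfolding \<Lambda>_def by linarith
    qed
    interpret ej: extremal_join \<F> k t G x n C L
      by unfold_locales (use Gf opt jn L(2) rt(2) in auto)
    have "ej.\<epsilon> * E \<le> 1"
    proof -
      \<comment> \<open>Here \<open>1 + \<epsilon> = (1 + d)\<^sup>2\<close>, so
        \<open>\<epsilon> \<le> 3 * d\<close> as soon as \<open>d \<le> 1\<close>; this is the
        factor 3 in \<open>\<Lambda>\<close>.\<close>
      define d where "d = real t / (rho G - real t)"
      have d0: "0 \<le> d" using rt(2) by (simp add: d_def)
      have "3 * E * real t / (rho G - real t) \<le> 1" using rt by simp
      then have dE: "3 * E * d \<le> 1" by (simp add: d_def)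
      have "1 * d \<le> 3 * E * d" using E d0 by (intro mult_right_mono) auto
      then have d1: "d \<le> 1" using dE by simp
      have "rho G / (rho G - real t) = 1 + d" using rt(2) by (simp add: d_def field_simps)
      then have "ej.\<epsilon> = 2 * d + d * d" by (simp add: ej.\<epsilon>_def power2_eq_square algebra_simps)
      also have "\<dots> \<le> 3 * d" using d0 d1 mult_right_mono[OF d1 d0] by simp
      finally have "ej.\<epsilon> * E \<le> 3 * d * E" using E by (intro mult_right_mono) auto
      then show ?thesis using dE by (simp add: mult_ac)
    qed
    then show ?thesis using ej.extremal_join_axioms L(3) by blast
  qed
  show ?thesis by (rule that[of n0]) (rule main)
qed

lemma card_edges_complete_bipartite: "card (edges (complete_bipartite_graph s m)) = s * m"
proof -
  have "edges (complete_bipartite_graph s m) = cross (Inl ` {..<s}) (Inr ` {..<m})"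
    by (auto simp: complete_bipartite_graph_def cross_def)
  then show ?thesis by (simp add: card_cross card_image) (subst card_cross, auto simp: card_image)
qed

text \<open>The graph \<open>H'\<close> required by \<open>G_fam\<close> is built from the actual
  core \<open>T'\<close> of \<open>G\<close>, which need not be isomorphic to \<open>T\<close>. It
  remains to see that \<open>T'\<close> is extremal for \<open>H_fam\<close>, through
  \<open>core_max\<close>, and that no graph containing \<open>H'\<close> has more edges than
  \<open>G\<close>, through \<open>rest_max\<close>.\<close>

lemma extremal_in_G_fam:
  assumes ej: "extremal_join \<F> k t G x n C L"
    and T: "T \<in> Ex_set k (H_fam \<F>)"
    and ub: "real (ex_containing (complete_bipartite_graph k (n - k)) n \<F>) \<le> real (k * (n - k)) + r * real n + c0"
    and gap: "real (ex_containing (complete_bipartite_graph k (n - k)) n \<F>)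
      - real (ex_containing (graph_join T (edgeless_graph (n - k))) n \<F>) \<le> real n / (8 * real k)"
    and n: "t + k \<le> n" "32 * real k ^ 3 \<le> real n" "4 * (r * real n + c0) < 3 * (real n - real k - 3)"
    and \<theta>: "0 < \<theta>" "4 * real k ^ 2 * \<theta> \<le> 1" "\<forall>v\<in>L. 1 - \<theta> \<le> x v"
    and \<epsilon>: "32 * real k * C * extremal_join.\<epsilon> t G \<le> 1" "6 * extremal_join.\<epsilon> t G \<le> 1"
      "55 * (1 + 11 * real t ^ 2) * extremal_join.\<epsilon> t G < 1"
  shows "G \<in> G_fam n \<F>"
proof -
  interpret extremal_join \<F> k t G x n C L by (rule ej)
  let ?Kb = "complete_bipartite_graph k (n - k)"
  have bn: "beta'_nat \<F> = k + 1" by (simp add: beta'_nat_def beta'_F)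
  have kn: "k \<le> n" using n(1) by simp
  have Kb_le: "card (edges G') \<le> ex_containing ?Kb n \<F>"
    if G': "G' \<in> free_graphs n \<F>" "joined G' L'" "card L' = k" for G' L'
  proof (rule card_edges_le_ex_containing[OF G'(1)])
    have sG': "simple_graph G'" "card (verts G') = n" using G'(1) by (auto simp: free_graphs_def)
    have L'V: "L' \<subseteq> verts G'" using G'(2) by (simp add: joined_def)
    have fL': "finite L'" using L'V simple_graphD(1)[OF sG'(1)] finite_subset by blast
    obtain f where "bij_betw f {..<k} L'"
      using ex_bij_betw_nat_finite[OF fL'] G'(3) by (auto simp: lessThan_atLeast0)
    moreover have "card (verts G' - L') = n - k" using L'V fL' sG' G'(3) by (simp add: card_Diff_subset)
    ultimately show "contains G' ?Kb"
      unfolding complete_bipartite_graph_eq_join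
      by (intro joined_contains_join[OF sG'(1) G'(2), of _ f]) (auto simp: edgeless_graph_def bij_betw_def)
  qed
  have rest_bound: "real (card (rest_edges G' L')) \<le> r * real n + c0"
    if G': "G' \<in> free_graphs n \<F>" "joined G' L'" "card L' = k" for G' L'
  proof -
    have sG': "simple_graph G'" "card (verts G') = n" using G'(1) by (auto simp: free_graphs_def)
    have "k * (n - k) + card (rest_edges G' L') \<le> card (edges G')"
      using card_edges_joined[OF sG'(1) G'(2) sG'(2) G'(3)] by simp
    then have "real (k * (n - k)) + real (card (rest_edges G' L')) \<le> real (ex_containing ?Kb n \<F>)"
      using Kb_le[OF G'] by (metis le_trans of_nat_add of_nat_le_iff)
    then show ?thesis using ub by simp
  qed
  have core_H: "induced G' L' \<in> free_graphs k (H_fam \<F>)"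
    if G': "G' \<in> free_graphs n \<F>" "joined G' L'" "card L' = k" for G' L'
  proof -
    have sG': "simple_graph G'" "card (verts G') = n" "free_of \<F> G'" using G'(1) by (auto simp: free_graphs_def)
    have L'V: "L' \<subseteq> verts G'" using G'(2) by (simp add: joined_def)
    have fL': "finite L'" using L'V simple_graphD(1)[OF sG'(1)] finite_subset by blast
    have "t \<le> card (verts G' - L')" using L'V fL' sG' G'(3) n(1) by (simp add: card_Diff_subset)
    then have "free_of (M_fam \<F>) (induced G' L')" by (rule core_free[OF sG'(1,3) G'(2)])
    then have "free_of (H_fam \<F>) (induced G' L')"
      using H_free_iff_M_free[of "induced G' L'"] fL' G'(3) by (simp add: induced_def)
    then show ?thesis using simple_induced[OF sG'(1) L'V] G'(3) by (simp add: free_graphs_def induced_def)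
  qed
  have core_card: "card (edges (induced G' L')) = card (core_edges G' L')" for G' :: "nat graph" and L'
    by (simp add: induced_def core_edges_def)
  define T' where "T' = induced G L"
  have T'f: "T' \<in> free_graphs k (H_fam \<F>)" unfolding T'_def by (rule core_H[OF G_free L])
  have sT': "simple_graph T'" "card (verts T') = k" "verts T' = L"
    using T'f L(2) by (auto simp: free_graphs_def T'_def induced_def)
  have Tf: "T \<in> free_graphs k (H_fam \<F>)" "card (edges T) = ex_num k (H_fam \<F>)"
    using T by (auto simp: Ex_set_def)
  have sT: "simple_graph T" "card (verts T) = k" "free_of (H_fam \<F>) T" using Tf(1) by (auto simp: free_graphs_def)
  have fT: "finite (verts T)" using sT(1) simple_graphD(1) by blast
  \<comment> \<open>\<open>T\<close> yields a competitor \<open>G1\<close> whose core has at least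
    \<open>card (edges T)\<close> edges. As \<open>G\<close> itself contains the complete bipartite
    graph, the gap hypothesis keeps \<open>G1\<close> within \<open>n / (8 * k)\<close> edges of
    \<open>G\<close>.\<close>
  have "card (edges T) \<le> card (edges T')"
  proof -
    obtain \<phi> where \<phi>: "bij_betw \<phi> (verts T) L" using finite_same_card_bij[OF fT fL] sT(2) L(2) by auto
    have inj: "inj_on \<phi> (verts T)" using \<phi> by (simp add: bij_betw_def)
    let ?M = "map_graph \<phi> T"
    have sM: "simple_graph ?M" by (rule simple_map_graph[OF sT(1) inj])
    have M: "?M = Graph L ((`) \<phi> ` edges T)" using \<phi> by (simp add: map_graph_def bij_betw_def)
    have "free_of (M_fam \<F>) T" using H_free_iff_M_free[OF fT sT(2)] sT(3) by simp
    moreover have "simple_graph A" if A: "A \<in> M_fam \<F>" for A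
    proof -
      obtain F0 S where "A = induced F0 S" "F0 \<in> \<F>" "covering F0 S" using A by (auto simp: M_fam_def)
      then show ?thesis using simple_induced[OF simple_F] by (auto simp: covering_def)
    qed
    ultimately have "free_of (M_fam \<F>) ?M" by (rule free_of_contains[OF _ contains_map_graph[OF sT(1) inj]])
    then have J: "join_on V L ((`) \<phi> ` edges T) {} \<in> free_graphs n \<F>"
      using simple_graphD(2,3)[OF sM] unfolding M by (intro join_in_free_graphs[OF fV card_V LV L(2)]) auto
    have "contains (join_on V L ((`) \<phi> ` edges T) {}) (graph_join T (edgeless_graph (n - k)))"
    proof (rule joined_contains_join[OF _ joined_join_on[OF LV], where \<phi> = \<phi>])
      show "simple_graph (join_on V L ((`) \<phi> ` edges T) {})" using J by (simp add: free_graphs_def)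
      show "card (verts (join_on V L ((`) \<phi> ` edges T) {}) - L) = n - k" using card_R by (simp add: join_on_def)
    qed (use \<phi> in \<open>auto simp: bij_betw_def join_on_def\<close>)
    then obtain G1 where G1: "G1 \<in> free_graphs n \<F>" "contains G1 (graph_join T (edgeless_graph (n - k)))"
      "card (edges G1) = ex_containing (graph_join T (edgeless_graph (n - k))) n \<F>"
      using ex_containing_attained[OF J] by metis
    have sG1: "simple_graph G1" "card (verts G1) = k + (n - k)" using G1(1) kn by (auto simp: free_graphs_def)
    obtain L1 \<phi>1 where L1: "joined G1 L1" "card L1 = k" "bij_betw \<phi>1 (verts T) L1"
      "\<And>e. e \<in> edges T \<Longrightarrow> \<phi>1 ` e \<in> edges G1"
      using contains_join_joined[OF sG1 sT(1,2) G1(2)] by metis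
    have inj1: "inj_on \<phi>1 (verts T)" using L1(3) by (simp add: bij_betw_def)
    have "(`) \<phi>1 ` edges T \<subseteq> core_edges G1 L1"
      using L1(3,4) simple_graphD(2)[OF sT(1)] by (fastforce simp: core_edges_def bij_betw_def)
    then have "card ((`) \<phi>1 ` edges T) \<le> card (core_edges G1 L1)"
      using finite_edges[OF sG1(1)] by (intro card_mono) (auto simp: core_edges_def)
    then have "card (edges T) \<le> card (core_edges G1 L1)"
      using card_image[OF inj_on_image_edges[OF sT(1) inj1]] by simp
    also have "\<dots> \<le> card (core_edges G L)"
    proof (rule core_max[OF G1(1) L1(1,2) _ \<theta>(1,2) _ n(2) \<epsilon>(1)])
      show "x v \<ge> 1 - \<theta>" if "v \<in> L" for v using \<theta>(3) that by blast
      have "real (card (edges G)) \<le> real (ex_containing ?Kb n \<F>)" using Kb_le[OF G_free L] by simp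
      then show "real (card (edges G)) - real n / (8 * real k) \<le> real (card (edges G1))"
        using gap G1(3) by simp
    qed
    finally show ?thesis by (simp add: T'_def core_card)
  qed
  then have T'E: "T' \<in> Ex_set k (H_fam \<F>)"
    using T'f Tf(2) card_edges_le_ex_num[OF T'f] by (simp add: Ex_set_def)
  let ?H' = "graph_join T' (edgeless_graph (n - k))"
  have cont: "contains G ?H'"
    by (rule joined_contains_join[OF sg L(1) card_R, where \<phi> = id])
       (use LV in \<open>auto simp: sT'(3), auto simp: T'_def induced_def\<close>)
  have "card (edges G) = ex_containing ?H' n \<F>"
  proof (rule antisym)
    show "card (edges G) \<le> ex_containing ?H' n \<F>" by (rule card_edges_le_ex_containing[OF G_free cont])
    obtain G2 where G2: "G2 \<in> free_graphs n \<F>" "contains G2 ?H'" "card (edges G2) = ex_containing ?H' n \<F>"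
      using ex_containing_attained[OF G_free cont] by metis
    have sG2: "simple_graph G2" "card (verts G2) = n" using G2(1) by (auto simp: free_graphs_def)
    have sG2': "card (verts G2) = k + (n - k)" using sG2(2) kn by simp
    obtain L2 \<phi> where L2: "joined G2 L2" "card L2 = k" "bij_betw \<phi> (verts T') L2"
      "\<And>e. e \<in> edges T' \<Longrightarrow> \<phi> ` e \<in> edges G2"
      using contains_join_joined[OF sG2(1) sG2' sT'(1,2) G2(2)] by metis
    have \<phi>: "bij_betw \<phi> L L2" using L2(3) sT'(3) by simp
    \<comment> \<open>Inverting the embedding of \<open>T'\<close> lays the core of
      \<open>G2\<close> over that of \<open>G\<close>, as \<open>rest_max\<close> requires.\<close>
    define \<tau> where "\<tau> = the_inv_into L \<phi>"
    have \<tau>: "bij_betw \<tau> L2 L" unfolding \<tau>_def by (rule bij_betw_the_inv_into[OF \<phi>])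
    have sub: "core_edges G L \<subseteq> (`) \<tau> ` core_edges G2 L2"
    proof
      fix e assume e: "e \<in> core_edges G L"
      then have eL: "e \<subseteq> L" and eT: "e \<in> edges T'" by (auto simp: core_edges_def T'_def induced_def)
      have "\<phi> ` e \<in> core_edges G2 L2" using L2(4)[OF eT] eL \<phi> by (auto simp: core_edges_def bij_betw_def)
      moreover have "\<tau> ` (\<phi> ` e) = e"
        unfolding image_image \<tau>_def using eL \<phi> by (force simp: bij_betw_def the_inv_into_f_f subset_iff)
      ultimately show "e \<in> (`) \<tau> ` core_edges G2 L2" by (metis imageI)
    qed
    have "card (rest_edges G2 L2) \<le> card (rest_edges G L)"
      by (rule rest_max[OF rest_bound n(3) G2(1) L2(1,2) \<tau> sub \<epsilon>(2,3)])
    \<comment> \<open>The core of \<open>G2\<close> is itself \<open>H_fam\<close>-free, so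
      extremality of \<open>T'\<close> leaves no room for further core edges.\<close>
    moreover have "card (core_edges G2 L2) \<le> card (core_edges G L)"
    proof -
      have "card (edges (induced G2 L2)) \<le> ex_num k (H_fam \<F>)"
        by (rule card_edges_le_ex_num[OF core_H[OF G2(1) L2(1,2)]])
      also have "\<dots> = card (edges T')" using T'E by (simp add: Ex_set_def)
      finally show ?thesis by (simp add: T'_def core_card)
    qed
    ultimately have "card (edges G2) \<le> card (edges G)"
      using card_edges_joined[OF sG2(1) L2(1) sG2(2) L2(2)] card_edges_joined[OF sg L(1) card_V L(2)] by simp
    then show "ex_containing ?H' n \<F> \<le> card (edges G)" using G2(3) by simp
  qed
  then have "G \<in> Ex_containing ?H' n \<F>" using G_free cont by (simp add: Ex_containing_def)
  moreover have "?H' \<in> G0_fam n \<F>" unfolding G0_fam_def bn using T'E by auto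
  ultimately show ?thesis by (auto simp: G_fam_def)
qed

end

text \<open>A class of a bipartition is an independent covering.\<close>

lemma beta'_fam_finite:
  assumes "finite_degenerate \<F>"
  obtains b where "beta'_fam \<F> = enat b"
proof -
  obtain F where F: "F \<in> \<F>" "bipartite F" using assms by (auto simp: finite_degenerate_def)
  then obtain X Y where XY: "X \<union> Y = verts F" "X \<inter> Y = {}" "\<forall>e\<in>edges F. \<exists>x\<in>X. \<exists>y\<in>Y. e = {x, y}"
    by (auto simp: bipartite_def)
  have "e \<inter> X \<noteq> {} \<and> \<not> e \<subseteq> X" if e: "e \<in> edges F" for e
  proof -
    obtain u v where "u \<in> X" "v \<in> Y" "e = {u, v}" using XY(3) e by blast
    then show ?thesis using XY(2) by blast
  qed
  then have "independent_covering F X" using XY(1) by (auto simp: independent_covering_def covering_def)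
  then have "beta' F \<le> enat (card X)" unfolding beta'_def by (intro INF_lower) simp
  moreover have "beta'_fam \<F> \<le> beta' F" unfolding beta'_fam_def by (rule INF_lower[OF F(1)])
  ultimately have "beta'_fam \<F> \<le> enat (card X)" by (rule order_trans[rotated])
  then show ?thesis using that by (cases "beta'_fam \<F>") auto
qed

text \<open>The bound has to hold for every order, because \<open>sparse\<close> is applied to
  arbitrarily small vertex sets. Below the asymptotic threshold \<open>N\<close> the trivial bound
  \<open>m * m \<le> N * m\<close> is absorbed into \<open>C\<close>.\<close>

lemma linear_ex_num_bound:
  assumes "(\<lambda>n. real (ex_num n \<F>)) \<in> O(\<lambda>n. real n)"
  obtains C where "C \<ge> 1" "\<And>m G. G \<in> free_graphs m \<F> \<Longrightarrow> real (card (edges G)) \<le> C * real m"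
proof -
  obtain c where c: "c > 0" "\<forall>\<^sub>F n in sequentially. norm (real (ex_num n \<F>)) \<le> c * norm (real n)"
    using assms by (auto elim: landau_o.bigE)
  then obtain N where N: "\<And>n. n \<ge> N \<Longrightarrow> real (ex_num n \<F>) \<le> c * real n"
    by (auto simp: eventually_sequentially)
  define C where "C = 1 + c + real N"
  have "real (card (edges G)) \<le> C * real m" if G: "G \<in> free_graphs m \<F>" for m G
  proof (cases "m \<ge> N")
    case True
    have "real (card (edges G)) \<le> real (ex_num m \<F>)" using card_edges_le_ex_num[OF G] by simp
    also have "\<dots> \<le> c * real m" by (rule N[OF True])
    also have "\<dots> \<le> C * real m" by (intro mult_right_mono) (auto simp: C_def)
    finally show ?thesis .
  next
    case False
    have "card (edges G) \<le> m * m" using card_edges_le_square[of G] G by (auto simp: free_graphs_def)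
    then have "real (card (edges G)) \<le> real (m * m)" by (rule of_nat_mono)
    also have "\<dots> = real m * real m" by simp
    also have "\<dots> \<le> C * real m" using False c(1) by (intro mult_right_mono) (auto simp: C_def)
    finally show ?thesis .
  qed
  moreover have "C \<ge> 1" using c(1) by (simp add: C_def)
  ultimately show ?thesis by (rule that[rotated])
qed

theorem theorem1p2:
  fixes \<F> :: "nat graph set" and T :: "nat graph" and r :: real and c :: "nat \<Rightarrow> real"
  assumes "finite_degenerate \<F>"
    and "beta'_fam \<F> \<ge> 2"
    and "(\<lambda>n. real (ex_num n \<F>)) \<in> O(\<lambda>n. real n)"
    and "T \<in> Ex_set (beta'_nat \<F> - 1) (H_fam \<F>)"
    and "1 / 2 \<le> r" and "r < 3 / 4"
    and "c \<in> O(\<lambda>_. 1)"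
  shows "\<forall>\<^sub>F n in sequentially.
    (let b = beta'_nat \<F>;
         H = complete_bipartite_graph (b - 1) (n + 1 - b);
         H\<^sub>1 = graph_join T (edgeless_graph (n + 1 - b))
     in card (edges H) + (n + 1 - b) div 2 \<le> ex_containing H n \<F> \<and>
        real (ex_containing H n \<F>) \<le> real (card (edges H)) + r * real n + c n \<and>
        real (ex_containing H n \<F>) - real (ex_containing H\<^sub>1 n \<F>)
          \<le> 1 / (8 * (real b - 1)) * real n
        \<longrightarrow> Ex_sp n \<F> \<subseteq> G_fam n \<F>)"
proof -
  obtain b where b: "beta'_fam \<F> = enat b" using beta'_fam_finite[OF assms(1)] .
  have b2: "b \<ge> 2" using assms(2) b by (simp add: numeral_eq_enat)
  define k where "k = b - 1"
  have bk: "b = k + 1" "k \<ge> 1" using b2 by (auto simp: k_def)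
  have bn: "beta'_nat \<F> = k + 1" by (simp add: beta'_nat_def b bk)
  obtain t0 where t0: "\<forall>F\<in>\<F>. card (verts F) \<le> t0" using assms(1) by (auto simp: finite_degenerate_def)
  \<comment> \<open>The shift by one guarantees \<open>t \<ge> 1\<close>.\<close>
  define t where "t = t0 + 1"
  interpret degenerate_family \<F> k t
  proof
    show "simple_graph A" if "A \<in> \<F>" for A using assms(1) that by (auto simp: finite_degenerate_def)
    show "card (verts A) \<le> t" if "A \<in> \<F>" for A using t0 that by (auto simp: t_def intro: le_SucI)
  qed (use b bk in \<open>auto simp: t_def\<close>)
  obtain C where C: "C \<ge> 1" "\<And>m G. G \<in> free_graphs m \<F> \<Longrightarrow> real (card (edges G)) \<le> C * real m"
    using linear_ex_num_bound[OF assms(3)] by metis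
  obtain c0 where "\<forall>\<^sub>F n in sequentially. norm (c n) \<le> c0 * norm (1 :: real)"
    using assms(7) by (auto elim: landau_o.bigE)
  then obtain n1 where n1: "\<And>n. n \<ge> n1 \<Longrightarrow> c n \<le> c0"
    by (fastforce simp: eventually_sequentially)
  define W where "W = 55 * (1 + 11 * real t ^ 2)"
  \<comment> \<open>The reciprocal of a sum of nonnegative terms meets all upper bounds on
    \<open>\<theta>\<close> at once.\<close>
  define D where "D = 4 * real (k + 1) + 256 * C * real k ^ 3 + 14 * real (k * t) + 4 * real k ^ 2"
  define \<theta> where "\<theta> = 1 / D"
  have nn: "0 \<le> 256 * C * real k ^ 3" "0 \<le> 14 * real (k * t)" "0 \<le> 4 * real k ^ 2" using C(1) by auto
  then have D0: "D > 0" by (simp add: D_def add_pos_nonneg)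
  have \<theta>: "0 < \<theta>" "4 * real (k + 1) * \<theta> \<le> 1" "256 * C * real k ^ 3 * \<theta> \<le> 1"
    "14 * real (k * t) * \<theta> \<le> 1" "4 * real k ^ 2 * \<theta> \<le> 1"
    using D0 nn by (simp_all add: \<theta>_def) (simp_all add: D_def)
  \<comment> \<open>The factor 2 gives \<open>W * \<epsilon> \<le> 1 / 2\<close> and hence the
    strict inequality that \<open>rest_max\<close> asks for.\<close>
  define E where "E = 6 + 2 * W + 32 * real k * C"
  have W1: "W \<ge> 1" by (simp add: W_def)
  have kC: "0 \<le> 32 * real k * C" using C(1) by simp
  have E1: "E \<ge> 1" using W1 kC by (simp add: E_def)
  obtain n0 where n0: "\<And>n G x. n \<ge> n0 \<Longrightarrow> G \<in> Ex_sp n \<F> \<Longrightarrow> perron G x \<Longrightarrow>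
    \<exists>L. extremal_join \<F> k t G x n C L \<and> (\<forall>v\<in>L. 1 - \<theta> \<le> x v) \<and> extremal_join.\<epsilon> t G * E \<le> 1"
    using extremal_structure[OF C \<theta>(1-4) E1] by metis
  \<comment> \<open>Here \<open>r < 3 / 4\<close> enters: \<open>3 - 4 * r\<close> is positive, and
    \<open>K < n\<close> is the density condition against large patterns solved for
    \<open>n\<close>.\<close>
  define K where "K = (4 * c0 + 3 * real k + 9) / (3 - 4 * r)"
  define N where "N = n0 + n1 + t + k + 1 + 32 * k ^ 3 + nat \<lceil>K\<rceil> + 1"
  show ?thesis
    unfolding eventually_sequentially Let_def bn
  proof (intro exI[of _ N] allI impI subsetI)
    fix n G
    assume n: "n \<ge> N" and G: "G \<in> Ex_sp n \<F>"
      and hyp: "card (edges (complete_bipartite_graph (k + 1 - 1) (n + 1 - (k + 1)))) + (n + 1 - (k + 1)) div 2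
          \<le> ex_containing (complete_bipartite_graph (k + 1 - 1) (n + 1 - (k + 1))) n \<F> \<and>
        real (ex_containing (complete_bipartite_graph (k + 1 - 1) (n + 1 - (k + 1))) n \<F>)
          \<le> real (card (edges (complete_bipartite_graph (k + 1 - 1) (n + 1 - (k + 1))))) + r * real n + c n \<and>
        real (ex_containing (complete_bipartite_graph (k + 1 - 1) (n + 1 - (k + 1))) n \<F>)
          - real (ex_containing (graph_join T (edgeless_graph (n + 1 - (k + 1)))) n \<F>)
          \<le> 1 / (8 * (real (k + 1) - 1)) * real n"
    have Nn: "n \<ge> n0" "n \<ge> n1" "t + k \<le> n" "32 * k ^ 3 \<le> n" "n \<ge> 1" "K < real n"
      using n unfolding N_def by linarith+
    have "real (32 * k ^ 3) \<le> real n" using Nn(4) by (rule of_nat_mono)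
    then have n32: "32 * real k ^ 3 \<le> real n" by simp
    have ub: "real (ex_containing (complete_bipartite_graph k (n - k)) n \<F>) \<le> real (k * (n - k)) + r * real n + c0"
      using hyp n1[OF Nn(2)] by (simp add: card_edges_complete_bipartite)
    have gap: "real (ex_containing (complete_bipartite_graph k (n - k)) n \<F>)
      - real (ex_containing (graph_join T (edgeless_graph (n - k))) n \<F>) \<le> real n / (8 * real k)"
      using hyp by simp
    have "4 * c0 + 3 * real k + 9 < real n * (3 - 4 * r)"
      using Nn(6) assms(6) unfolding K_def by (simp add: pos_divide_less_eq)
    then have large: "4 * (r * real n + c0) < 3 * (real n - real k - 3)" by (simp add: algebra_simps)
    have sG: "simple_graph G" "card (verts G) = n" using G by (auto simp: Ex_sp_def free_graphs_def)
    then have "verts G \<noteq> {}" using Nn(5) by auto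
    then obtain x where x: "perron G x" by (rule perron_exists[OF sG(1)])
    obtain L where L: "extremal_join \<F> k t G x n C L" "\<forall>v\<in>L. 1 - \<theta> \<le> x v" "extremal_join.\<epsilon> t G * E \<le> 1"
      using n0[OF Nn(1) G x] by blast
    define e where "e = extremal_join.\<epsilon> t G"
    have e0: "0 \<le> e" unfolding e_def by (rule extremal_join.\<epsilon>_nonneg[OF L(1)])
    have "e * E = 6 * e + 2 * (W * e) + 32 * real k * C * e" by (simp add: E_def algebra_simps)
    moreover have "0 \<le> W * e" "0 \<le> 32 * real k * C * e" using W1 kC e0 by auto
    ultimately have "32 * real k * C * e \<le> 1" "6 * e \<le> 1" "W * e < 1"
      using L(3)[folded e_def] e0 by linarith+
    moreover have "T \<in> Ex_set k (H_fam \<F>)" using assms(4) bn by simp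
    ultimately show "G \<in> G_fam n \<F>"
      using extremal_in_G_fam[OF L(1) _ ub gap Nn(3) n32 large \<theta>(1,5) L(2)]
      unfolding e_def W_def by blast
  qed
qed

end
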